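(* Let $0<p\le1$, $0<q,r\le\infty$, $s\in\mathbb{R}$, and assume $q\le2$. Then the embedding $W_{p,q}\hookrightarrow F_{p,r}^s$ is true if and only if one of the following conditions is satisfied: (1) $p\ge q$, $q\le r$, $s\le0$; (2) $p\ge q$, $q>r$, $s<0$; (3) $p<q$, $q\le2$, $q\le r$, $s\le0$; (4) $p<q$, $q\le2$, $q>r$, $s<0$.
   Context: All function spaces are on $\mathbb{R}^d$, $d\ge 1$; $\hookrightarrow$ denotes continuous embedding (inclusion with $\|f\|_Y\le C\|f\|_X$ for all $f\in X$); $\mathscr{F}$ is the Fourier transform on $\mathscr{S}'(\mathbb{R}^d)$. Wiener amalgam spaces: let $\sigma$ be a smooth function adapted to $[-1/2,1/2]^d$, vanishing outside $[-3/4,3/4]^d$, with $\sum_{k\in\mathbb{Z}^d}\sigma(\xi-k)=1$ for all $\xi$, and put $\Box_k=\mathscr{F}^{-1}\sigma(\cdot-k)\mathscr{F}$. For $0<p,q\le\infty$, $W_{p,q}=\{f\in\mathscr{S}':\ \|f\|_{W_{p,q}}=\big\|\,\|\Box_kf(x)\|_{\ell^q_{k\in\mathbb{Z}^d}}\big\|_{L^p_x}<\infty\}$ (independent of $\sigma$ up to equivalent norms). Triebel(-Lizorkin) spaces (inhomogeneous): let $\psi$ be a smooth radial function with values in $[0,1]$, $\psi=1$ on $|\xi|\le1$, $\psi=0$ on $|\xi|\ge2$; $\varphi(\xi)=\psi(\xi)-\psi(2\xi)$, $\varphi_j(\xi)=\varphi(2^{-j}\xi)$ for $j\ge1$, $\varphi_0=1-\sum_{j\ge1}\varphi_j$,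 $\triangle_j=\mathscr{F}^{-1}\varphi_j\mathscr{F}$. Then $F_{p,r}^s=\{f\in\mathscr{S}':\|f\|_{F_{p,r}^s}=\big\|\,\|2^{js}\triangle_jf(x)\|_{\ell^r_{j\ge0}}\big\|_{L^p_x}<\infty\}$. *)

theory Defs
  imports "HOL-Analysis.Analysis" "HOL-Probability.Essential_Supremum"
begin

definition partial_deriv ::
    "'n::finite \<Rightarrow> (real ^ 'n \<Rightarrow> 'b::real_normed_vector) \<Rightarrow> real ^ 'n \<Rightarrow> 'b" where
  "partial_deriv i f x = frechet_derivative f (at x) (axis i 1)"

definition partial_derivs ::
    "'n::finite list \<Rightarrow> (real ^ 'n \<Rightarrow> 'b::real_normed_vector) \<Rightarrow> real ^ 'n \<Rightarrow> 'b" where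
  "partial_derivs is f = foldr partial_deriv is f"

text \<open>Differentiability of all iterated partial derivatives is the same as being of class
  \<open>C\<close>-infinity.\<close>

definition smooth :: "(real ^ 'n::finite \<Rightarrow> 'b::real_normed_vector) \<Rightarrow> bool" where
  "smooth f \<longleftrightarrow> (\<forall>is x. partial_derivs is f differentiable (at x))"

definition schwartz :: "(real ^ 'n::finite \<Rightarrow> complex) set" where
  "schwartz = {\<phi>. smooth \<phi> \<and>
     (\<forall>is N. bounded (range (\<lambda>x. (1 + norm x) ^ N *\<^sub>R partial_derivs is \<phi> x)))}"

definition schwartz_seminorm :: "nat \<Rightarrow> (real ^ 'n::finite \<Rightarrow> complex) \<Rightarrow> real" where
  "schwartz_seminorm N \<phi> =
     (SUP (is, x) \<in> {is. length is \<le> N} \<times> UNIV. (1 + norm x) ^ N * norm (partial_derivs is \<phi> x))"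

text \<open>The dual of the Schwartz space. Functionals are extended by 0 to functions that are not
  Schwartz, so that equal distributions are equal as HOL functions.\<close>

type_synonym 'n functional = "(real ^ 'n \<Rightarrow> complex) \<Rightarrow> complex"

definition tempered :: "'n::finite functional set" where
  "tempered = {u.
     (\<forall>\<phi>\<in>schwartz. \<forall>\<theta>\<in>schwartz. \<forall>a b. u (\<lambda>x. a * \<phi> x + b * \<theta> x) = a * u \<phi> + b * u \<theta>) \<and>
     (\<exists>N C. \<forall>\<phi>\<in>schwartz. norm (u \<phi>) \<le> C * schwartz_seminorm N \<phi>) \<and>
     (\<forall>\<phi>. \<phi> \<notin> schwartz \<longrightarrow> u \<phi> = 0)}"

definition fourier :: "(real ^ 'n::finite \<Rightarrow> complex) \<Rightarrow> real ^ 'n \<Rightarrow> complex" where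
  "fourier \<phi> \<xi> = (LINT x|lborel. exp (- 2 * pi * \<i> * (x \<bullet> \<xi>)) * \<phi> x)"

definition inv_fourier :: "(real ^ 'n::finite \<Rightarrow> complex) \<Rightarrow> real ^ 'n \<Rightarrow> complex" where
  "inv_fourier \<phi> x = (LINT \<xi>|lborel. exp (2 * pi * \<i> * (x \<bullet> \<xi>)) * \<phi> \<xi>)"

text \<open>Transposition extends these operations to tempered distributions. Multipliers \<open>m\<close> are meant
  to be smooth with compact support.\<close>

definition dist_fourier :: "'n::finite functional \<Rightarrow> 'n functional" where
  "dist_fourier u = (\<lambda>\<phi>. if \<phi> \<in> schwartz then u (fourier \<phi>) else 0)"

definition dist_inv_fourier :: "'n::finite functional \<Rightarrow> 'n functional" where
  "dist_inv_fourier u = (\<lambda>\<phi>. if \<phi> \<in> schwartz then u (inv_fourier \<phi>) else 0)"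

definition dist_mult :: "(real ^ 'n::finite \<Rightarrow> complex) \<Rightarrow> 'n functional \<Rightarrow> 'n functional" where
  "dist_mult m u = (\<lambda>\<phi>. if \<phi> \<in> schwartz then u (\<lambda>x. m x * \<phi> x) else 0)"

definition fourier_multiplier ::
    "(real ^ 'n::finite \<Rightarrow> complex) \<Rightarrow> 'n functional \<Rightarrow> 'n functional" where
  "fourier_multiplier m u = dist_inv_fourier (dist_mult m (dist_fourier u))"

text \<open>The continuous function that a distribution is given by. It is unique when it exists, and by
  the Paley--Wiener--Schwartz theorem it exists for \<^term>\<open>fourier_multiplier m u\<close> whenever \<open>u\<close> is
  tempered and \<open>m\<close> is smooth with compact support, the only case in which it is used below.\<close>

definition dist_function :: "'n::finite functional \<Rightarrow> real ^ 'n \<Rightarrow> complex" where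
  "dist_function u = (THE g. continuous_on UNIV g \<and>
     (\<forall>\<phi>\<in>schwartz. integrable lborel (\<lambda>x. g x * \<phi> x) \<and> u \<phi> = (LINT x|lborel. g x * \<phi> x)))"

text \<open>Only used for exponents \<open>a > 0\<close>.\<close>

definition ennpowr :: "ennreal \<Rightarrow> real \<Rightarrow> ennreal" where
  "ennpowr t a = (if t = \<infinity> then \<infinity> else ennreal (enn2real t powr a))"

definition Lp_norm :: "'a measure \<Rightarrow> ennreal \<Rightarrow> ('a \<Rightarrow> ennreal) \<Rightarrow> ennreal" where
  "Lp_norm M p f =
     (if p = \<infinity> then esssup M f
      else ennpowr (\<integral>\<^sup>+ x. ennpowr (f x) (enn2real p) \<partial>M) (1 / enn2real p))"

abbreviation lp_norm :: "ennreal \<Rightarrow> ('k \<Rightarrow> ennreal) \<Rightarrow> ennreal" where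
  "lp_norm q a \<equiv> Lp_norm (count_space UNIV) q a"

definition space_of :: "('n::finite functional \<Rightarrow> ennreal) \<Rightarrow> 'n functional set" where
  "space_of N = {u \<in> tempered. N u < \<infinity>}"

definition embeds ::
    "('n::finite functional \<Rightarrow> ennreal) \<Rightarrow> ('n functional \<Rightarrow> ennreal) \<Rightarrow> bool" where
  "embeds NX NY \<longleftrightarrow> space_of NX \<subseteq> space_of NY \<and>
     (\<exists>C::real. \<forall>u\<in>space_of NX. NY u \<le> ennreal C * NX u)"

definition lattice_point :: "int ^ 'n \<Rightarrow> real ^ 'n::finite" where
  "lattice_point k = (\<chi> i. of_int (k $ i))"

definition wiener_window :: "(real ^ 'n::finite \<Rightarrow> complex) \<Rightarrow> bool" where
  "wiener_window \<sigma> \<longleftrightarrow> smooth \<sigma> \<and>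
     (\<forall>\<xi>. (\<exists>i. \<xi> $ i \<notin> {-3/4..3/4}) \<longrightarrow> \<sigma> \<xi> = 0) \<and>
     (\<forall>\<xi>. ((\<lambda>k. \<sigma> (\<xi> - lattice_point k)) has_sum 1) UNIV)"

definition box_op ::
    "(real ^ 'n::finite \<Rightarrow> complex) \<Rightarrow> int ^ 'n \<Rightarrow> 'n functional \<Rightarrow> 'n functional" where
  "box_op \<sigma> k u = fourier_multiplier (\<lambda>\<xi>. \<sigma> (\<xi> - lattice_point k)) u"

definition wiener_norm ::
    "(real ^ 'n::finite \<Rightarrow> complex) \<Rightarrow> ennreal \<Rightarrow> ennreal \<Rightarrow> 'n functional \<Rightarrow> ennreal" where
  "wiener_norm \<sigma> p q u =
     Lp_norm lborel p (\<lambda>x. lp_norm q (\<lambda>k. ennreal (norm (dist_function (box_op \<sigma> k u) x))))"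

definition triebel_window :: "(real ^ 'n::finite \<Rightarrow> real) \<Rightarrow> bool" where
  "triebel_window \<psi> \<longleftrightarrow> smooth \<psi> \<and>
     (\<forall>\<xi> \<eta>. norm \<xi> = norm \<eta> \<longrightarrow> \<psi> \<xi> = \<psi> \<eta>) \<and>
     (\<forall>\<xi>. \<psi> \<xi> \<in> {0..1}) \<and>
     (\<forall>\<xi>. norm \<xi> \<le> 1 \<longrightarrow> \<psi> \<xi> = 1) \<and>
     (\<forall>\<xi>. norm \<xi> \<ge> 2 \<longrightarrow> \<psi> \<xi> = 0)"

definition dyadic_bump :: "(real ^ 'n::finite \<Rightarrow> real) \<Rightarrow> real ^ 'n \<Rightarrow> real" where
  "dyadic_bump \<psi> \<xi> = \<psi> \<xi> - \<psi> (2 *\<^sub>R \<xi>)"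

definition dyadic_piece :: "(real ^ 'n::finite \<Rightarrow> real) \<Rightarrow> nat \<Rightarrow> real ^ 'n \<Rightarrow> real" where
  "dyadic_piece \<psi> j \<xi> =
     (if j = 0 then 1 - (\<Sum>i. dyadic_bump \<psi> ((1 / 2) ^ Suc i *\<^sub>R \<xi>))
      else dyadic_bump \<psi> ((1 / 2) ^ j *\<^sub>R \<xi>))"

definition triangle_op ::
    "(real ^ 'n::finite \<Rightarrow> real) \<Rightarrow> nat \<Rightarrow> 'n functional \<Rightarrow> 'n functional" where
  "triangle_op \<psi> j u = fourier_multiplier (\<lambda>\<xi>. of_real (dyadic_piece \<psi> j \<xi>)) u"

definition triebel_norm ::
    "(real ^ 'n::finite \<Rightarrow> real) \<Rightarrow> real \<Rightarrow> ennreal \<Rightarrow> ennreal \<Rightarrow> 'n functional \<Rightarrow> ennreal" where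
  "triebel_norm \<psi> s p r u =
     Lp_norm lborel p (\<lambda>x. lp_norm r (\<lambda>j.
       ennreal (2 powr (real j * s) * norm (dist_function (triangle_op \<psi> j u) x))))"

end

theory Submission
  imports Defs "HOL-Probability.Sinc_Integral" "HOL-Probability.Characteristic_Functions"
begin

text \<open>The four conditions amount to \<open>s \<le> 0\<close> together with \<open>q \<le> r\<close> or \<open>s < 0\<close>.

  For sufficiency it is enough to treat \<open>s = 0\<close> and \<open>r = q\<close>. Each \<open>\<box>\<^sub>k u\<close> has its spectrum in a fixed
  translate of a ball, hence satisfies the Plancherel--Polya inequality
  \<open>|\<box>\<^sub>k u(x)|\<^sup>a \<le> C M\<^sub>k(z) (1 + |x - z|)\<^sup>L\<^sup>a\<close>, where \<open>M\<^sub>k(z)\<close> is the integral of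
  \<open>|\<box>\<^sub>k u(y)|\<^sup>a (1 + |y - z|)\<^sup>-\<^sup>L\<^sup>a\<close> and \<open>a = min p q\<close>. The same bound holds for \<open>\<triangle>\<^sub>j \<box>\<^sub>k u\<close>, because
  the kernels of the \<open>\<triangle>\<^sub>j\<close> are \<open>L\<^sup>1\<close>-normalised dilates at scale at most 1. If \<open>q \<le> p\<close> then \<open>q \<le> 1\<close> and
  one sums over \<open>k\<close> termwise. If \<open>p \<le> q \<le> 2\<close>, then on a small ball the \<open>\<triangle>\<^sub>j \<box>\<^sub>k u\<close> are almost
  orthogonal in \<open>k\<close>, which bounds the local \<open>L\<^sup>2\<close> norm of \<open>\<triangle>\<^sub>j u\<close> by the \<open>\<ell>\<^sup>2\<close> norm, and so by the
  \<open>\<ell>\<^sup>q\<close> norm, of the \<open>M\<^sub>k(z)\<^bsup>1/p\<^esup>\<close>; Minkowski's inequality finishes the proof.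

  For necessity, sums of \<open>N\<close> copies of one narrow bump placed at the frequencies \<open>2\<^sup>j e\<close>, with \<open>j\<close> large
  and spaced by two, have \<open>W\<close> norm proportional to \<open>N\<^bsup>1/q\<^esup>\<close> and \<open>F\<close> norm at least a multiple of the
  \<open>\<ell>\<^sup>r\<close> norm of the \<open>2\<^bsup>js\<^esup>\<close>.\<close>

section \<open>Schwartz functions\<close>

text \<open>For p < 1 neither duality nor a convolution inequality is available in L^p, so every
  estimate passes through a pointwise bound by a weighted power mean with a free centre z. The
  centre is put at the point itself when the q-th power is subadditive, and is averaged over balls
  when local L^2 orthogonality is used. Measuring the local L^2 norm with a weight of compact
  spectrum makes distant boxes exactly orthogonal.

  The obstacle is uniformity. The Plancherel-Polya inequality needs a growth bound of the same order
  L as the kernel decay, but the growth order of a tempered distribution depends on the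
  distribution. It is therefore used twice: once with an order taken from \<open>u\<close>, only to
  see that all box pieces are bounded when the norm is finite, and then with an order fixed by the
  dimension and the exponent, where that bound does not enter the constant.

  Distribution theory is confined to one identity: the function representing a multiplier applied to
  \<open>u\<close> has at x the value of \<open>u\<close> on the transform of the symbol shifted by
  x.\<close>

lemma partial_derivs_simps [simp]:
  "partial_derivs [] f = f"
  "partial_derivs (i # is) f = partial_deriv i (partial_derivs is f)"
  by (auto simp: partial_derivs_def)

lemma partial_derivs_append: "partial_derivs (is @ js) f = partial_derivs is (partial_derivs js f)"
  by (simp add: partial_derivs_def)

lemma partial_deriv_eq:
  assumes "(f has_derivative D) (at x)"
  shows "partial_deriv i f x = D (axis i 1)"
  using frechet_derivative_at[OF assms] by (simp add: partial_deriv_def)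

lemma smooth_differentiable: "smooth f \<Longrightarrow> f differentiable (at x)"
  unfolding smooth_def by (metis partial_derivs_simps(1))

lemma smooth_partial_deriv: "smooth f \<Longrightarrow> smooth (partial_deriv i f)"
  unfolding smooth_def by (metis partial_derivs_append partial_derivs_simps)

text \<open>Smoothness quantifies over all lists of derivatives, so it behaves like a greatest fixed
  point: a set of differentiable functions closed under partial derivatives consists of smooth
  functions. Closure properties then need only one derivative at a time.\<close>

lemma smooth_coinduct:
  assumes "f \<in> A" "\<And>g x. g \<in> A \<Longrightarrow> g differentiable (at x)"
    and "\<And>g i. g \<in> A \<Longrightarrow> partial_deriv i g \<in> A"
  shows "smooth f"
proof -
  have "partial_derivs is f \<in> A" for "is"
    by (induction "is") (use assms in auto)
  then show ?thesis
    using assms(2) by (auto simp: smooth_def)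
qed

definition rapid :: "(real ^ 'n::finite \<Rightarrow> complex) \<Rightarrow> bool" where
  "rapid f \<longleftrightarrow> (\<forall>N. \<exists>B. \<forall>x. norm (f x) * (1 + norm x) ^ N \<le> B)"

lemma rapidD:
  assumes "rapid f" obtains B where "B > 0" "\<And>x. norm (f x) * (1 + norm x) ^ N \<le> B"
proof -
  obtain B where "\<And>x. norm (f x) * (1 + norm x) ^ N \<le> B"
    using assms unfolding rapid_def by blast
  then have "norm (f x) * (1 + norm x) ^ N \<le> max B 1" for x
    by (meson max.coboundedI1)
  then show ?thesis using that[of "max B 1"] by auto
qed

lemma rapid_mono:
  assumes "rapid f" "\<And>x. norm (g x) \<le> C * (1 + norm x) ^ M * norm (f x)"
  shows "rapid g"
  unfolding rapid_def
proof
  fix N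
  obtain B where B: "B > 0" "\<And>x. norm (f x) * (1 + norm x) ^ (M + N) \<le> B"
    using rapidD[OF assms(1)] by blast
  have "norm (g x) * (1 + norm x) ^ N \<le> \<bar>C\<bar> * B" for x
  proof -
    have "norm (g x) * (1 + norm x) ^ N \<le> (C * (1 + norm x) ^ M * norm (f x)) * (1 + norm x) ^ N"
      by (intro mult_right_mono assms) auto
    also have "\<dots> = C * (norm (f x) * (1 + norm x) ^ (M + N))"
      by (simp add: power_add algebra_simps)
    also have "\<dots> \<le> \<bar>C\<bar> * (norm (f x) * (1 + norm x) ^ (M + N))"
      by (intro mult_right_mono) auto
    also have "\<dots> \<le> \<bar>C\<bar> * B"
      by (intro mult_left_mono B) auto
    finally show ?thesis .
  qed
  then show "\<exists>B. \<forall>x. norm (g x) * (1 + norm x) ^ N \<le> B" by blast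
qed

lemma rapid_add:
  assumes "rapid f" "rapid g" shows "rapid (\<lambda>x. f x + g x)"
  unfolding rapid_def
proof
  fix N
  obtain B where B: "\<And>x. norm (f x) * (1 + norm x) ^ N \<le> B"
    using rapidD[OF assms(1)] by blast
  obtain C where C: "\<And>x. norm (g x) * (1 + norm x) ^ N \<le> C"
    using rapidD[OF assms(2)] by blast
  have "norm (f x + g x) * (1 + norm x) ^ N \<le> B + C" for x
  proof -
    have "norm (f x + g x) * (1 + norm x) ^ N \<le> (norm (f x) + norm (g x)) * (1 + norm x) ^ N"
      by (intro mult_right_mono norm_triangle_ineq) auto
    then show ?thesis using B[of x] C[of x] by (simp add: algebra_simps)
  qed
  then show "\<exists>B. \<forall>x. norm (f x + g x) * (1 + norm x) ^ N \<le> B" by blast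
qed

lemma schwartz_iff: "f \<in> schwartz \<longleftrightarrow> smooth f \<and> (\<forall>is. rapid (partial_derivs is f))"
  by (auto simp: schwartz_def rapid_def bounded_iff mult.commute)

text \<open>The set \<open>A\<close> usually has to be larger than the family of interest: it must
  absorb whatever terms one differentiation produces, which explains the sets chosen in the
  instances below.\<close>

lemma schwartz_coinduct:
  assumes "f \<in> A" "\<And>g x. g \<in> A \<Longrightarrow> g differentiable (at x)" "\<And>g. g \<in> A \<Longrightarrow> rapid g"
    and "\<And>g i. g \<in> A \<Longrightarrow> partial_deriv i g \<in> A"
  shows "f \<in> schwartz"
proof -
  have "partial_derivs is f \<in> A" for "is"
    by (induction "is") (use assms in auto)
  moreover have "smooth f" using smooth_coinduct[of f A] assms by blast
  ultimately show ?thesis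
    using assms(3) by (auto simp: schwartz_iff)
qed

lemma schwartz_smooth: "f \<in> schwartz \<Longrightarrow> smooth f"
  by (simp add: schwartz_iff)

lemma schwartz_rapid: "f \<in> schwartz \<Longrightarrow> rapid f"
  unfolding schwartz_iff by (metis partial_derivs_simps(1))

lemma schwartz_differentiable: "f \<in> schwartz \<Longrightarrow> f differentiable (at x)"
  by (simp add: schwartz_smooth smooth_differentiable)

lemma schwartz_has_derivative: "f \<in> schwartz \<Longrightarrow> (f has_derivative frechet_derivative f (at x)) (at x)"
  using frechet_derivative_works schwartz_differentiable by blast

lemma schwartz_continuous: "f \<in> schwartz \<Longrightarrow> continuous_on UNIV f"
  by (simp add: schwartz_differentiable differentiable_imp_continuous_on differentiable_on_def differentiable_at_withinI)

lemma schwartz_partial_deriv: "f \<in> schwartz \<Longrightarrow> partial_deriv i f \<in> schwartz"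
  unfolding schwartz_iff using smooth_partial_deriv
  by (metis partial_derivs_append partial_derivs_simps)

lemma schwartz_partial_derivs: "f \<in> schwartz \<Longrightarrow> partial_derivs is f \<in> schwartz"
  by (induction "is") (auto intro: schwartz_partial_deriv)

lemma partial_deriv_add:
  "f \<in> schwartz \<Longrightarrow> g \<in> schwartz \<Longrightarrow>
    partial_deriv i (\<lambda>x. f x + g x) = (\<lambda>x. partial_deriv i f x + partial_deriv i g x)"
  by (rule ext, subst partial_deriv_eq[OF has_derivative_add[OF schwartz_has_derivative schwartz_has_derivative]])
    (auto simp: partial_deriv_def)

lemma schwartz_add:
  assumes "f \<in> schwartz" "g \<in> schwartz" shows "(\<lambda>x. f x + g x) \<in> schwartz"
proof (rule schwartz_coinduct[where A="{(\<lambda>x. f x + g x) | f g. f \<in> schwartz \<and> g \<in> schwartz}"])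
  show "(\<lambda>x. f x + g x) \<in> {(\<lambda>x. f x + g x) | f g. f \<in> schwartz \<and> g \<in> schwartz}"
    using assms by blast
next
  fix g i assume "g \<in> {(\<lambda>x. f x + g x) | f g. f \<in> schwartz \<and> g \<in> schwartz}"
  then obtain a b where "g = (\<lambda>x. a x + b x)" "a \<in> schwartz" "b \<in> schwartz" by blast
  then show "partial_deriv i g \<in> {(\<lambda>x. f x + g x) | f g. f \<in> schwartz \<and> g \<in> schwartz}"
    using partial_deriv_add[of a b i] schwartz_partial_deriv[of a i] schwartz_partial_deriv[of b i]
    by blast
qed (use assms in \<open>auto intro: differentiable_add schwartz_differentiable rapid_add schwartz_rapid\<close>)

lemma partial_deriv_mult:
  assumes "f \<in> schwartz" "g \<in> schwartz"
  shows "partial_deriv i (\<lambda>x. f x * g x) = (\<lambda>x. f x * partial_deriv i g x + partial_deriv i f x * g x)"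
  by (rule ext, subst partial_deriv_eq[OF has_derivative_mult[OF schwartz_has_derivative schwartz_has_derivative]])
    (use assms in \<open>auto simp: partial_deriv_def\<close>)

text \<open>The derivatives of a product are sums of products, so the coinduction runs over the span of
  the products.\<close>

inductive schwartz_product :: "(real ^ 'n::finite \<Rightarrow> complex) \<Rightarrow> bool" where
  "f \<in> schwartz \<Longrightarrow> g \<in> schwartz \<Longrightarrow> schwartz_product (\<lambda>x. f x * g x)"
| "schwartz_product f \<Longrightarrow> schwartz_product g \<Longrightarrow> schwartz_product (\<lambda>x. f x + g x)"

lemma schwartz_product_props:
  assumes "schwartz_product h"
  shows "(\<forall>x. h differentiable (at x)) \<and> rapid h \<and> (\<forall>i. schwartz_product (partial_deriv i h))"
  using assms
proof induction
  case (1 f g)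
  obtain B where B: "\<And>x. norm (f x) * (1 + norm x) ^ 0 \<le> B"
    using rapidD[OF schwartz_rapid[OF 1(1)]] by blast
  have "rapid (\<lambda>x. f x * g x)"
    by (rule rapid_mono[OF schwartz_rapid[OF 1(2)], of _ B 0])
      (use B in \<open>auto simp: norm_mult intro!: mult_right_mono\<close>)
  then show ?case
    using 1 by (auto simp: partial_deriv_mult intro!: schwartz_product.intros
        schwartz_partial_deriv intro: differentiable_mult schwartz_differentiable)
next
  case (2 f g)
  have "partial_deriv i (\<lambda>x. f x + g x) = (\<lambda>x. partial_deriv i f x + partial_deriv i g x)" for i
    using 2 by (intro ext, subst partial_deriv_eq[OF has_derivative_add[OF
         frechet_derivative_works[THEN iffD1] frechet_derivative_works[THEN iffD1]]])
     (auto simp: partial_deriv_def)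
  then show ?case
    using 2 by (auto intro!: rapid_add schwartz_product.intros)
qed

lemma schwartz_mult:
  assumes "f \<in> schwartz" "g \<in> schwartz" shows "(\<lambda>x. f x * g x) \<in> schwartz"
  by (rule schwartz_coinduct[where A="Collect schwartz_product"])
    (use assms schwartz_product_props in \<open>auto intro: schwartz_product.intros\<close>)

lemma schwartz_cmult:
  assumes "f \<in> schwartz" shows "(\<lambda>x. c * f x) \<in> schwartz"
proof (rule schwartz_coinduct[where A="{(\<lambda>x. c * f x) | f. f \<in> schwartz}"])
  have "partial_deriv i (\<lambda>x. c * f x) = (\<lambda>x. c * partial_deriv i f x)" if "f \<in> schwartz" for f i
    by (rule ext, subst partial_deriv_eq[OF has_derivative_mult_right[OF schwartz_has_derivative[OF that]]])
      (auto simp: partial_deriv_def)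
  then show "partial_deriv i g \<in> {(\<lambda>x. c * f x) | f. f \<in> schwartz}"
    if "g \<in> {(\<lambda>x. c * f x) | f. f \<in> schwartz}" for g i
    using that by (auto intro: schwartz_partial_deriv)
  show "rapid g" if "g \<in> {(\<lambda>x. c * f x) | f. f \<in> schwartz}" for g
    using that by (auto intro!: rapid_mono[OF schwartz_rapid, of _ _ "norm c" 0] simp: norm_mult)
qed (use assms in \<open>auto intro: differentiable_mult schwartz_differentiable\<close>)

lemma schwartz_uminus: "f \<in> schwartz \<Longrightarrow> (\<lambda>x. - f x) \<in> schwartz"
  using schwartz_cmult[of f "-1"] by simp

lemma schwartz_diff: "f \<in> schwartz \<Longrightarrow> g \<in> schwartz \<Longrightarrow> (\<lambda>x. f x - g x) \<in> schwartz"
  using schwartz_add[OF _ schwartz_uminus, of f g] by simp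

lemma rapid_zero: "rapid (\<lambda>x. 0)"
  by (auto simp: rapid_def)

lemma schwartz_zero: "(\<lambda>x. 0) \<in> schwartz"
  by (rule schwartz_coinduct[where A="{\<lambda>x. 0}"])
    (simp_all add: rapid_zero partial_deriv_eq[OF has_derivative_const, abs_def] ext)

lemma schwartz_sum:
  assumes "\<And>i. i \<in> I \<Longrightarrow> f i \<in> schwartz" shows "(\<lambda>x. \<Sum>i\<in>I. f i x) \<in> schwartz"
  using assms by (induction I rule: infinite_finite_induct) (auto simp: schwartz_zero intro!: schwartz_add)

lemma schwartz_affine:
  assumes "f \<in> schwartz" "a \<noteq> 0"
  shows "(\<lambda>x. f (a *\<^sub>R x + b)) \<in> schwartz"
proof (rule schwartz_coinduct[where A="{(\<lambda>x. f (a *\<^sub>R x + b)) | f. f \<in> schwartz}"])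
  have der: "((\<lambda>x. f (a *\<^sub>R x + b)) has_derivative (\<lambda>h. frechet_derivative f (at (a *\<^sub>R x + b)) (a *\<^sub>R h))) (at x)"
    if "f \<in> schwartz" for f x
    by (rule has_derivative_compose[OF _ schwartz_has_derivative[OF that]])
      (auto intro!: derivative_eq_intros)
  then show "g differentiable (at x)" if "g \<in> {(\<lambda>x. f (a *\<^sub>R x + b)) | f. f \<in> schwartz}" for g x
    using that by (auto simp: differentiable_def)
  have "partial_deriv i (\<lambda>x. f (a *\<^sub>R x + b)) = (\<lambda>x. of_real a * partial_deriv i f (a *\<^sub>R x + b))"
    if "f \<in> schwartz" for f i
  proof
    fix x
    have "linear (frechet_derivative f (at (a *\<^sub>R x + b)))"
      using schwartz_has_derivative[OF that] has_derivative_linear by blast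
    then show "partial_deriv i (\<lambda>x. f (a *\<^sub>R x + b)) x = of_real a * partial_deriv i f (a *\<^sub>R x + b)"
      using partial_deriv_eq[OF der[OF that]] by (simp add: partial_deriv_def linear_cmul scaleR_conv_of_real[where 'a=complex])
  qed
  then show "partial_deriv i g \<in> {(\<lambda>x. f (a *\<^sub>R x + b)) | f. f \<in> schwartz}"
    if "g \<in> {(\<lambda>x. f (a *\<^sub>R x + b)) | f. f \<in> schwartz}" for g i
    using that by (force intro!: schwartz_cmult schwartz_partial_deriv)
  show "rapid g" if g: "g \<in> {(\<lambda>x. f (a *\<^sub>R x + b)) | f. f \<in> schwartz}" for g
    unfolding rapid_def
  proof
    fix N
    obtain f where f: "f \<in> schwartz" "g = (\<lambda>x. f (a *\<^sub>R x + b))" using g by blast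
    obtain B where B: "B > 0" "\<And>x. norm (f x) * (1 + norm x) ^ N \<le> B"
      using rapidD[OF schwartz_rapid[OF f(1)]] by blast
    \<comment> \<open>\<open>C\<close> is the constant with 1 + |x| \<le> C (1 + |ax + b|); its N-th
      power transfers the decay of order N.\<close>
    define C where "C = 1 + (1 + norm b) / \<bar>a\<bar>"
    have C: "1 + norm x \<le> C * (1 + norm (a *\<^sub>R x + b))" for x
    proof -
      have "\<bar>a\<bar> * norm x \<le> norm (a *\<^sub>R x + b) + norm b"
        using norm_triangle_ineq4[of "a *\<^sub>R x + b" b] by simp
      then have "norm x \<le> (norm (a *\<^sub>R x + b) + norm b) / \<bar>a\<bar>"
        using assms(2) by (simp add: field_simps)
      also have "\<dots> \<le> ((1 + norm b) / \<bar>a\<bar>) * (1 + norm (a *\<^sub>R x + b))"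
        using assms(2) by (simp add: field_simps)
      finally have "norm x \<le> ((1 + norm b) / \<bar>a\<bar>) * (1 + norm (a *\<^sub>R x + b))" .
      moreover have "0 \<le> norm (a *\<^sub>R x + b)" by simp
      moreover have "C * (1 + norm (a *\<^sub>R x + b)) = 1 + norm (a *\<^sub>R x + b) + ((1 + norm b) / \<bar>a\<bar>) * (1 + norm (a *\<^sub>R x + b))"
        unfolding C_def by (simp only: distrib_right) simp
      ultimately show ?thesis by linarith
    qed
    have "C \<ge> 0" by (auto simp: C_def)
    have "norm (g x) * (1 + norm x) ^ N \<le> C ^ N * B" for x
    proof -
      have "norm (g x) * (1 + norm x) ^ N \<le> norm (g x) * (C * (1 + norm (a *\<^sub>R x + b))) ^ N"
        by (intro mult_left_mono power_mono C) auto
      also have "\<dots> = C ^ N * (norm (f (a *\<^sub>R x + b)) * (1 + norm (a *\<^sub>R x + b)) ^ N)"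
        by (simp add: f power_mult_distrib)
      also have "\<dots> \<le> C ^ N * B"
        using \<open>C \<ge> 0\<close> by (intro mult_left_mono B) auto
      finally show ?thesis .
    qed
    then show "\<exists>B. \<forall>x. norm (g x) * (1 + norm x) ^ N \<le> B" by blast
  qed
qed (use assms in auto)

lemma schwartz_translate: "f \<in> schwartz \<Longrightarrow> (\<lambda>x. f (x + b)) \<in> schwartz"
  using schwartz_affine[of f 1 b] by simp

lemma schwartz_translate': "f \<in> schwartz \<Longrightarrow> (\<lambda>x. f (x - b)) \<in> schwartz"
  using schwartz_affine[of f 1 "- b"] by simp

lemma schwartz_reflect: "f \<in> schwartz \<Longrightarrow> (\<lambda>x. f (- x)) \<in> schwartz"
  using schwartz_affine[of f "-1" 0] by simp

lemma schwartz_scale: "f \<in> schwartz \<Longrightarrow> a \<noteq> 0 \<Longrightarrow> (\<lambda>x. f (a *\<^sub>R x)) \<in> schwartz"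
  using schwartz_affine[of f a 0] by simp

lemma schwartz_mult_coord:
  fixes f :: "real ^ 'n::finite \<Rightarrow> complex"
  assumes "f \<in> schwartz"
  shows "(\<lambda>x. of_real (x $ i) * f x) \<in> schwartz"
proof -
  \<comment> \<open>The added \<open>g\<close> gives closure: the product rule leaves one term in
    which the coordinate has been differentiated away.\<close>
  define A where "A = {(\<lambda>x. of_real (x $ i) * f x + g x) | f g. f \<in> (schwartz :: (real ^ 'n \<Rightarrow> complex) set) \<and> g \<in> schwartz}"
  have der: "((\<lambda>x. of_real (x $ i) * f x + g x) has_derivative
      (\<lambda>h. of_real (x $ i) * frechet_derivative f (at x) h + of_real (h $ i) * f x + frechet_derivative g (at x) h)) (at x)"
    if "f \<in> schwartz" "g \<in> schwartz" for f g :: "real ^ 'n \<Rightarrow> complex" and x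
    by (rule derivative_eq_intros schwartz_has_derivative that refl bounded_linear_imp_has_derivative
        bounded_linear_compose[OF bounded_linear_of_real] bounded_linear_vec_nth)+
  show ?thesis
  proof (rule schwartz_coinduct[where A=A])
    show "(\<lambda>x. of_real (x $ i) * f x) \<in> A"
      unfolding A_def using assms schwartz_zero by force
    show "g differentiable (at x)" if "g \<in> A" for g x
      using that der unfolding A_def differentiable_def by blast
    show "rapid g" if "g \<in> A" for g
      using that unfolding A_def
    proof safe
      fix f g :: "real ^ 'n \<Rightarrow> complex" assume fg: "f \<in> schwartz" "g \<in> schwartz"
      show "rapid (\<lambda>x. of_real (x $ i) * f x + g x)"
      proof (rule rapid_add[OF rapid_mono[OF schwartz_rapid[OF fg(1)], of _ 1 1] schwartz_rapid[OF fg(2)]])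
        fix x :: "real ^ 'n"
        have "\<bar>x $ i\<bar> \<le> 1 + norm x"
          using component_le_norm_cart[of x i] by simp
        then show "norm (complex_of_real (x $ i) * f x) \<le> 1 * (1 + norm x) ^ 1 * norm (f x)"
          by (auto simp: norm_mult intro!: mult_right_mono)
      qed
    qed
    show "partial_deriv j g \<in> A" if "g \<in> A" for g j
      using that unfolding A_def
    proof safe
      fix f g :: "real ^ 'n \<Rightarrow> complex" assume fg: "f \<in> schwartz" "g \<in> schwartz"
      have "partial_deriv j (\<lambda>x. of_real (x $ i) * f x + g x) =
        (\<lambda>x. of_real (x $ i) * partial_deriv j f x + (of_real (axis j 1 $ i) * f x + partial_deriv j g x))"
        by (intro ext partial_deriv_eq[THEN trans, OF der[OF fg]]) (auto simp: partial_deriv_def)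
      then show "\<exists>f' g'. partial_deriv j (\<lambda>x. of_real (x $ i) * f x + g x) = (\<lambda>x. of_real (x $ i) * f' x + g' x) \<and>
         f' \<in> schwartz \<and> g' \<in> schwartz"
        using fg by (intro exI[of _ "partial_deriv j f"] exI[of _ "\<lambda>x. of_real (axis j 1 $ i) * f x + partial_deriv j g x"])
          (auto intro!: schwartz_add schwartz_cmult schwartz_partial_deriv)
    qed
  qed
qed

section \<open>Characters, modulation and functions of compact support\<close>

definition unit_char :: "real \<Rightarrow> complex" where "unit_char t = cis (2 * pi * t)"

lemma unit_char_add: "unit_char (s + t) = unit_char s * unit_char t"
  by (simp add: unit_char_def cis_mult distrib_left)

lemma unit_char_0 [simp]: "unit_char 0 = 1" by (simp add: unit_char_def)

lemma norm_unit_char [simp]: "norm (unit_char t) = 1" by (simp add: unit_char_def)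

lemma cnj_unit_char [simp]: "cnj (unit_char t) = unit_char (- t)" by (simp add: unit_char_def cis_cnj)

lemma unit_char_minus_mult [simp]: "unit_char (- t) * unit_char t = 1" "unit_char t * unit_char (- t) = 1"
  by (simp_all flip: unit_char_add)

lemma continuous_on_unit_char [continuous_intros]: "continuous_on S f \<Longrightarrow> continuous_on S (\<lambda>x. unit_char (f x))"
  unfolding unit_char_def by (intro continuous_intros)

lemma unit_char_measurable [measurable]: "unit_char \<in> borel_measurable borel"
  by (intro borel_measurable_continuous_onI continuous_intros)

lemma unit_char_eq: "exp (2 * complex_of_real pi * \<i> * complex_of_real t) = unit_char t"
  by (simp add: unit_char_def cis_conv_exp mult_ac)

lemma fourier_eq: "fourier f \<xi> = (LINT x|lborel. unit_char (- (x \<bullet> \<xi>)) * f x)"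
  unfolding fourier_def by (simp flip: unit_char_eq)

lemma inv_fourier_eq: "inv_fourier f x = (LINT \<xi>|lborel. unit_char (x \<bullet> \<xi>) * f \<xi>)"
  unfolding inv_fourier_def by (simp flip: unit_char_eq)

lemma inv_fourier_fourier: "inv_fourier f x = fourier f (- x)"
  by (simp add: fourier_eq inv_fourier_eq inner_commute)

lemma has_derivative_unit_char_inner:
  "((\<lambda>\<xi>. unit_char (x \<bullet> \<xi>)) has_derivative (\<lambda>h. 2 * pi * \<i> * of_real (x \<bullet> h) * unit_char (x \<bullet> \<xi>))) (at \<xi>)"
proof -
  have "((\<lambda>\<xi>. exp (2 * pi * \<i> * of_real (x \<bullet> \<xi>))) has_derivative (\<lambda>h. 2 * pi * \<i> * of_real (x \<bullet> h) * exp (2 * pi * \<i> * of_real (x \<bullet> \<xi>)))) (at \<xi>)"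
    by (rule has_derivative_eq_rhs, rule derivative_intros bounded_linear_imp_has_derivative
        bounded_linear_compose[OF bounded_linear_of_real] bounded_linear_inner_right
        has_derivative_in_compose[OF _ DERIV_exp[unfolded has_field_derivative_def, THEN has_derivative_at_withinI]])+ (auto simp: mult_ac)
  then show ?thesis by (simp add: unit_char_eq)
qed

lemma schwartz_modulate:
  fixes f :: "real ^ 'n::finite \<Rightarrow> complex"
  assumes "f \<in> schwartz"
  shows "(\<lambda>\<xi>. unit_char (x \<bullet> \<xi>) * f \<xi>) \<in> schwartz"
proof -
  define A where "A = {(\<lambda>\<xi>. unit_char (x \<bullet> \<xi>) * f \<xi>) | f. f \<in> (schwartz :: (real ^ 'n \<Rightarrow> complex) set)}"
  have der: "((\<lambda>\<xi>. unit_char (x \<bullet> \<xi>) * f \<xi>) has_derivative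
      (\<lambda>h. unit_char (x \<bullet> \<xi>) * frechet_derivative f (at \<xi>) h + (2 * pi * \<i> * of_real (x \<bullet> h) * unit_char (x \<bullet> \<xi>)) * f \<xi>)) (at \<xi>)"
    if "f \<in> schwartz" for f :: "real ^ 'n \<Rightarrow> complex" and \<xi>
    by (intro has_derivative_mult has_derivative_unit_char_inner schwartz_has_derivative that)
  show ?thesis
  proof (rule schwartz_coinduct[where A=A])
    show "(\<lambda>\<xi>. unit_char (x \<bullet> \<xi>) * f \<xi>) \<in> A"
      unfolding A_def using assms by force
    show "g differentiable (at x)" if "g \<in> A" for g x
      using that der unfolding A_def differentiable_def by blast
    show "rapid g" if "g \<in> A" for g
      using that unfolding A_def by (auto intro!: rapid_mono[OF schwartz_rapid, of _ _ 1 0] simp: norm_mult)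
    show "partial_deriv j g \<in> A" if "g \<in> A" for g j
      using that unfolding A_def
    proof safe
      fix f :: "real ^ 'n \<Rightarrow> complex" assume fg: "f \<in> schwartz"
      have "partial_deriv j (\<lambda>\<xi>. unit_char (x \<bullet> \<xi>) * f \<xi>) =
        (\<lambda>\<xi>. unit_char (x \<bullet> \<xi>) * (partial_deriv j f \<xi> + (2 * pi * \<i> * of_real (x \<bullet> axis j 1)) * f \<xi>))"
        by (intro ext partial_deriv_eq[THEN trans, OF der[OF fg]]) (auto simp: partial_deriv_def algebra_simps)
      then show "\<exists>f'. partial_deriv j (\<lambda>\<xi>. unit_char (x \<bullet> \<xi>) * f \<xi>) = (\<lambda>\<xi>. unit_char (x \<bullet> \<xi>) * f' \<xi>) \<and> f' \<in> schwartz"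
        using fg by (intro exI[of _ "\<lambda>\<xi>. partial_deriv j f \<xi> + (2 * pi * \<i> * of_real (x \<bullet> axis j 1)) * f \<xi>"])
          (auto intro!: schwartz_add schwartz_cmult schwartz_partial_deriv)
    qed
  qed
qed

lemma smooth_of_real:
  fixes f :: "real ^ 'n::finite \<Rightarrow> real"
  assumes "smooth f" shows "smooth (\<lambda>x. complex_of_real (f x))"
proof (rule smooth_coinduct[where A="{(\<lambda>x. complex_of_real (f x)) | f. smooth f}"])
  have der: "((\<lambda>x. complex_of_real (f x)) has_derivative (\<lambda>h. of_real (frechet_derivative f (at x) h))) (at x)"
    if "smooth f" for f :: "real ^ 'n::finite \<Rightarrow> real" and x
    using smooth_differentiable[OF that, of x]
    by (auto intro!: derivative_eq_intros simp: frechet_derivative_works)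
  show "g differentiable (at x)" if "g \<in> {(\<lambda>x. complex_of_real (f x)) | f. smooth f}" for g :: "real ^ 'n::finite \<Rightarrow> complex" and x
    using that der unfolding differentiable_def by blast
  have "partial_deriv i (\<lambda>x. complex_of_real (f x)) = (\<lambda>x. complex_of_real (partial_deriv i f x))" if "smooth f"
    for f :: "real ^ 'n::finite \<Rightarrow> real" and i
    by (intro ext partial_deriv_eq[THEN trans, OF der[OF that]]) (auto simp: partial_deriv_def)
  then show "partial_deriv i g \<in> {(\<lambda>x. complex_of_real (f x)) | f. smooth f}"
    if "g \<in> {(\<lambda>x. complex_of_real (f x)) | f. smooth f}" for g :: "real ^ 'n::finite \<Rightarrow> complex" and i
    using that smooth_partial_deriv by blast
qed (use assms in auto)

lemma schwartz_compact_support: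
  fixes f :: "real ^ 'n::finite \<Rightarrow> complex"
  assumes "smooth f" "\<And>x. norm x > R \<Longrightarrow> f x = 0"
  shows "f \<in> schwartz"
proof (rule schwartz_coinduct[where A="{f. smooth f \<and> (\<forall>x. norm x > R \<longrightarrow> f x = 0)}"])
  show "partial_deriv i g \<in> {f. smooth f \<and> (\<forall>x. norm x > R \<longrightarrow> f x = 0)}"
    if g: "g \<in> {f. smooth f \<and> (\<forall>x. norm x > R \<longrightarrow> f x = 0)}" for g :: "real ^ 'n \<Rightarrow> complex" and i
  proof -
    have "partial_deriv i g x = 0" if "norm x > R" for x
    proof (rule partial_deriv_eq[THEN trans])
      \<comment> \<open>The strict inequality makes the region open, so the derivative vanishes
        there as well.\<close>
      have "open {x :: real ^ 'n. norm x > R}"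
        by (intro open_Collect_less continuous_intros)
      then show "(g has_derivative (\<lambda>h. 0)) (at x)"
        using g that by (intro has_derivative_transform_within_open[OF has_derivative_const[of 0], of _ _ g]) auto
    qed auto
    then show ?thesis using g smooth_partial_deriv by auto
  qed
  show "rapid g" if g: "g \<in> {f. smooth f \<and> (\<forall>x. norm x > R \<longrightarrow> f x = 0)}" for g :: "real ^ 'n \<Rightarrow> complex"
    unfolding rapid_def
  proof
    fix N
    have "continuous_on (cball 0 R) g"
      using g by (intro differentiable_imp_continuous_on differentiable_at_imp_differentiable_on)
        (auto intro: smooth_differentiable)
    then have "compact ((\<lambda>x. norm (g x) * (1 + norm x) ^ N) ` cball 0 R)"
      by (intro compact_continuous_image continuous_intros) auto
    then have "bdd_above ((\<lambda>x. norm (g x) * (1 + norm x) ^ N) ` cball 0 R)"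
      by (intro bounded_imp_bdd_above compact_imp_bounded)
    then obtain B where B: "\<And>x. x \<in> cball 0 R \<Longrightarrow> norm (g x) * (1 + norm x) ^ N \<le> B"
      unfolding bdd_above_def by blast
    have "norm (g x) * (1 + norm x) ^ N \<le> max B 0" for x
      using B[of x] g by (cases "norm x > R") (auto simp: max_def)
    then show "\<exists>B. \<forall>x. norm (g x) * (1 + norm x) ^ N \<le> B" by blast
  qed
qed (use assms smooth_differentiable in auto)

section \<open>The Fourier transform\<close>

lemma nn_integral_lborel_affine:
  fixes t :: "'a::euclidean_space"
  assumes [measurable]: "f \<in> borel_measurable borel" and c: "c \<noteq> 0"
  shows "(\<integral>\<^sup>+x. f x \<partial>lborel) = \<bar>c\<bar> ^ DIM('a) * (\<integral>\<^sup>+x. f (t + c *\<^sub>R x) \<partial>lborel)"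
  by (subst lborel_affine[OF c, of t])
     (simp add: nn_integral_density nn_integral_distr nn_integral_cmult ennreal_power)

lemma lborel_integrable_affine:
  fixes f :: "'a::euclidean_space \<Rightarrow> 'b :: {banach, second_countable_topology}"
  assumes f: "integrable lborel f" and "c \<noteq> 0"
  shows "integrable lborel (\<lambda>x. f (t + c *\<^sub>R x))"
  using f f[THEN borel_measurable_integrable] assms(2) unfolding integrable_iff_bounded
  by (subst (asm) nn_integral_lborel_affine[where c=c and t=t]) (auto simp: ennreal_mult_less_top)

lemma lborel_integrable_affine_iff:
  fixes f :: "'a::euclidean_space \<Rightarrow> 'b :: {banach, second_countable_topology}"
  shows "c \<noteq> 0 \<Longrightarrow> integrable lborel (\<lambda>x. f (t + c *\<^sub>R x)) \<longleftrightarrow> integrable lborel f"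
  using
    lborel_integrable_affine[of f c t]
    lborel_integrable_affine[of "\<lambda>x. f (t + c *\<^sub>R x)" "1/c" "-(1/c) *\<^sub>R t"]
  by (auto simp add: algebra_simps)

lemma lborel_integral_affine:
  fixes f :: "'a::euclidean_space \<Rightarrow> 'b :: {banach, second_countable_topology}" and c :: real
  assumes c: "c \<noteq> 0"
  shows "(\<integral>x. f x \<partial>lborel) = \<bar>c\<bar> ^ DIM('a) *\<^sub>R (\<integral>x. f (t + c *\<^sub>R x) \<partial>lborel)"
proof cases
  assume f[measurable]: "integrable lborel f" then show ?thesis
    using c f f[THEN borel_measurable_integrable] f[THEN lborel_integrable_affine, of c t]
    by (subst lborel_affine[OF c, of t])
       (simp add: integral_density integral_distr)
next
  assume "\<not> integrable lborel f" with c show ?thesis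
    by (simp add: lborel_integrable_affine_iff not_integrable_integral_eq)
qed

lemma lborel_integral_translate:
  fixes f :: "'a::euclidean_space \<Rightarrow> 'b :: {banach, second_countable_topology}"
  shows "(\<integral>x. f (x + t) \<partial>lborel) = (\<integral>x. f x \<partial>lborel)"
  using lborel_integral_affine[of 1 f t] by (simp add: add.commute)

lemma lborel_integral_reflect:
  fixes f :: "'a::euclidean_space \<Rightarrow> 'b :: {banach, second_countable_topology}"
  shows "(\<integral>x. f (t - x) \<partial>lborel) = (\<integral>x. f x \<partial>lborel)"
  using lborel_integral_affine[of "-1" f t] by simp

lemma lborel_integrable_translate:
  fixes f :: "'a::euclidean_space \<Rightarrow> 'b :: {banach, second_countable_topology}"
  shows "integrable lborel f \<Longrightarrow> integrable lborel (\<lambda>x. f (x + t))"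
  using lborel_integrable_affine[of f 1 t] by (simp add: add.commute)

lemma nn_integral_lborel_reflect:
  assumes "f \<in> borel_measurable borel"
  shows "(\<integral>\<^sup>+x. f (t - x) \<partial>lborel) = (\<integral>\<^sup>+x. f x \<partial>lborel)"
  using nn_integral_lborel_affine[OF assms, of "-1" t] by simp

text \<open>Every factor 1 + (x . b)^2 is at most (1 + |x|)^2, so the integrand lies below a product
  of one-variable functions, whose integral factorises by Tonelli. This is the origin of the
  exponent 2n, the integrability threshold in all later estimates.\<close>

lemma integrable_inverse_power_norm:
  assumes "N \<ge> 2 * CARD('n::finite)"
  shows "integrable lborel (\<lambda>x::real ^ 'n. inverse ((1 + norm x) ^ N))"
proof (rule Bochner_Integration.integrable_bound[where f="\<lambda>x. \<Prod>b\<in>Basis. inverse (1 + (x \<bullet> b)\<^sup>2)"])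
  have *: "(\<integral>\<^sup>+(t::real). ennreal (inverse (1 + t\<^sup>2)) \<partial>lborel) < \<infinity>"
  proof -
    have "integrable lborel (\<lambda>t::real. inverse (1 + t\<^sup>2))"
      using integrable_inverse_1_plus_square by (simp add: set_integrable_def)
    then show ?thesis
      using integrableD(2) by (fastforce simp: integrable_iff_bounded)
  qed
  show "integrable lborel (\<lambda>x::real^'n. \<Prod>b\<in>Basis. inverse (1 + (x \<bullet> b)\<^sup>2))"
  proof (rule integrableI_bounded)
    have "(\<integral>\<^sup>+(x::real^'n). ennreal (norm (\<Prod>b\<in>Basis. inverse (1 + (x \<bullet> b)\<^sup>2))) \<partial>lborel) =
      (\<integral>\<^sup>+(x::real^'n). (\<Prod>b\<in>Basis. ennreal (inverse (1 + (x \<bullet> b)\<^sup>2))) \<partial>lborel)"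
      by (intro nn_integral_cong) (simp add: prod_ennreal abs_prod)
    also have "\<dots> = (\<Prod>b\<in>(Basis::(real^'n) set). \<integral>\<^sup>+(t::real). ennreal (inverse (1 + t\<^sup>2)) \<partial>lborel)"
      by (rule nn_integral_lborel_prod) auto
    also have "\<dots> < \<infinity>"
      using * by (simp add: power_less_top_ennreal)
    finally show "(\<integral>\<^sup>+(x::real^'n). ennreal (norm (\<Prod>b\<in>Basis. inverse (1 + (x \<bullet> b)\<^sup>2))) \<partial>lborel) < \<infinity>" .
  qed measurable
  show "AE x::real^'n in lborel. norm (inverse ((1 + norm x) ^ N)) \<le> norm (\<Prod>b\<in>Basis. inverse (1 + (x \<bullet> b)\<^sup>2))"
  proof (rule AE_I2)
    fix x :: "real ^ 'n"
    have "(\<Prod>b\<in>Basis. 1 + (x \<bullet> b)\<^sup>2) \<le> (\<Prod>b\<in>(Basis :: (real ^ 'n) set). (1 + norm x)\<^sup>2)"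
    proof (intro prod_mono conjI)
      fix b :: "real ^ 'n" assume "b \<in> Basis"
      then have "\<bar>x \<bullet> b\<bar> \<le> norm x" by (rule Basis_le_norm)
      then have "(x \<bullet> b)\<^sup>2 \<le> (norm x)\<^sup>2" using abs_le_square_iff by fastforce
      then show "1 + (x \<bullet> b)\<^sup>2 \<le> (1 + norm x)\<^sup>2" by (simp add: power2_sum add_increasing2)
    qed auto
    also have "\<dots> = (1 + norm x) ^ (2 * CARD('n))"
      by (simp add: power_mult)
    also have "\<dots> \<le> (1 + norm x) ^ N"
      using assms by (intro power_increasing) auto
    finally have "(\<Prod>b\<in>Basis. 1 + (x \<bullet> b)\<^sup>2) \<le> (1 + norm x) ^ N" .
    moreover have "0 < (\<Prod>b\<in>Basis. 1 + (x \<bullet> b)\<^sup>2)" by (intro prod_pos) (auto intro: add_pos_nonneg)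
    ultimately show "norm (inverse ((1 + norm x) ^ N)) \<le> norm (\<Prod>b\<in>Basis. inverse (1 + (x \<bullet> b)\<^sup>2))"
      unfolding prod_inversef[of "\<lambda>b. 1 + (x \<bullet> b)\<^sup>2" Basis, unfolded comp_def]
      by (simp add: le_imp_inverse_le)
  qed
qed measurable

lemma integrable_rapid:
  fixes f :: "real ^ 'n::finite \<Rightarrow> complex"
  assumes "rapid f" and [measurable]: "f \<in> borel_measurable borel"
  shows "integrable lborel f"
proof -
  obtain B where B: "B > 0" "\<And>x. norm (f x) * (1 + norm x) ^ (2 * CARD('n)) \<le> B"
    using rapidD[OF assms(1)] by blast
  show ?thesis
  proof (rule Bochner_Integration.integrable_bound)
    show "integrable lborel (\<lambda>x::real^'n. B * inverse ((1 + norm x) ^ (2 * CARD('n))))"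
      by (intro integrable_mult_right integrable_inverse_power_norm) auto
    show "AE x in lborel. norm (f x) \<le> norm (B * inverse ((1 + norm x) ^ (2 * CARD('n))))"
    proof (rule AE_I2)
      fix x :: "real ^ 'n"
      have "0 < (1 + norm x) ^ (2 * CARD('n))" by (auto intro!: zero_less_power add_pos_nonneg)
      then have "norm (f x) \<le> B * inverse ((1 + norm x) ^ (2 * CARD('n)))"
        using B(2)[of x] by (simp add: field_simps)
      then show "norm (f x) \<le> norm (B * inverse ((1 + norm x) ^ (2 * CARD('n))))"
        using abs_ge_self order_trans unfolding real_norm_def by blast
    qed
  qed measurable
qed

lemma schwartz_measurable [measurable_dest]: "f \<in> schwartz \<Longrightarrow> f \<in> borel_measurable borel"
  by (intro borel_measurable_continuous_onI schwartz_continuous)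

lemma schwartz_integrable: "f \<in> schwartz \<Longrightarrow> integrable lborel f"
  by (intro integrable_rapid schwartz_rapid schwartz_measurable)

lemma integrable_unit_char_mult:
  fixes f :: "real ^ 'n::finite \<Rightarrow> complex"
  assumes "integrable lborel f" and [measurable]: "g \<in> borel_measurable borel"
  shows "integrable lborel (\<lambda>x. unit_char (g x) * f x)"
  using assms(1) by (rule Bochner_Integration.integrable_bound) (use assms in \<open>auto simp: norm_mult\<close>)

text \<open>The default value 0 of the integral of a non-integrable function satisfies the bound
  too, so later uses only have to supply an integrable pointwise majorant.\<close>

lemma norm_lebesgue_integral_le:
  fixes f :: "'a \<Rightarrow> 'b::{banach, second_countable_topology}"
  assumes "integrable M g" "\<And>x. norm (f x) \<le> g x"
  shows "norm (integral\<^sup>L M f) \<le> integral\<^sup>L M g"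
proof (cases "integrable M f")
  case True
  have "norm (integral\<^sup>L M f) \<le> (LINT x|M. norm (f x))" by (rule integral_norm_bound)
  also have "\<dots> \<le> integral\<^sup>L M g" using True assms by (intro integral_mono) auto
  finally show ?thesis .
next
  case False
  have "0 \<le> g x" for x using assms(2)[of x] norm_ge_zero order_trans by blast
  then show ?thesis using False by (simp add: not_integrable_integral_eq)
qed

lemma norm_fourier_le: "norm (fourier f \<xi>) \<le> (LINT x|lborel. norm (f x))"
  unfolding fourier_eq by (rule order_trans[OF integral_norm_bound]) (simp add: norm_mult)

text \<open>Boundedness of the kernel makes the double integral absolutely convergent. The instances
  are exponentials, with bound 1, and a reproducing kernel conjugated by polynomial weights.\<close>

lemma Fubini_bounded_kernel:
  fixes f :: "'a::euclidean_space \<Rightarrow> complex" and g :: "'b::euclidean_space \<Rightarrow> complex"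
  assumes f: "integrable lborel f" and g: "integrable lborel g"
    and [measurable]: "e \<in> borel_measurable borel" and B: "\<And>x y. norm (e (x, y)) \<le> B"
  shows "(LINT x|lborel. f x * (LINT y|lborel. g y * e (x, y))) = (LINT y|lborel. g y * (LINT x|lborel. f x * e (x, y)))"
proof -
  have [measurable]: "f \<in> borel_measurable borel" "g \<in> borel_measurable borel"
    using f g by auto
  have em: "e \<in> borel_measurable (lborel \<Otimes>\<^sub>M lborel)" unfolding lborel_prod by simp
  have [measurable]: "(\<lambda>y. e (x, y)) \<in> borel_measurable borel" for x by measurable
  have int: "integrable lborel (\<lambda>y. g y * e (x, y))" for x
    by (rule Bochner_Integration.integrable_bound[OF integrable_mult_right[OF g, of "of_real B"]])
      (auto simp: norm_mult mult.commute[of "norm (g _)"] intro!: mult_right_mono order_trans[OF B abs_ge_self])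
  have "integrable (lborel \<Otimes>\<^sub>M lborel) (\<lambda>(x, y). f x * (g y * e (x, y)))"
  proof (rule lborel_pair.Fubini_integrable)
    show "(\<lambda>(x, y). f x * (g y * e (x, y))) \<in> borel_measurable (lborel \<Otimes>\<^sub>M lborel)"
      using em by measurable
    show "AE x in lborel. integrable lborel (\<lambda>y. case (x, y) of (x, y) \<Rightarrow> f x * (g y * e (x, y)))"
      using int by simp
    show "integrable lborel (\<lambda>x. LINT y|lborel. norm (case (x, y) of (x, y) \<Rightarrow> f x * (g y * e (x, y))))"
    proof (rule Bochner_Integration.integrable_bound[OF integrable_mult_left[OF f, of "of_real (LINT y|lborel. norm (g y) * B)"]])
      show "AE x in lborel. norm (LINT y|lborel. norm (case (x, y) of (x, y) \<Rightarrow> f x * (g y * e (x, y))))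
        \<le> norm (f x * complex_of_real (LINT y|lborel. cmod (g y) * B))"
      proof (rule AE_I2)
        fix x
        have le: "(LINT y|lborel. norm (g y * e (x, y))) \<le> (LINT y|lborel. norm (g y) * B)"
          using int[THEN integrable_norm] g[THEN integrable_norm]
          by (intro integral_mono) (auto simp: norm_mult intro!: mult_left_mono B)
        have "norm (LINT y|lborel. norm (case (x, y) of (x, y) \<Rightarrow> f x * (g y * e (x, y)))) = norm (f x) * (LINT y|lborel. norm (g y * e (x, y)))"
          by (simp add: norm_mult[of "f x"] integral_nonneg_AE)
        also have "\<dots> \<le> norm (f x) * (LINT y|lborel. norm (g y) * B)"
          by (intro mult_left_mono le) auto
        also have "\<dots> \<le> norm (f x * complex_of_real (LINT y|lborel. cmod (g y) * B))"
          by (auto simp: norm_mult intro!: mult_left_mono)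
        finally show "norm (LINT y|lborel. norm (case (x, y) of (x, y) \<Rightarrow> f x * (g y * e (x, y))))
          \<le> norm (f x * complex_of_real (LINT y|lborel. cmod (g y) * B))" .
      qed
    qed (use em in measurable)
  qed
  from lborel_pair.Fubini_integral[OF this]
  have "(LINT y|lborel. LINT x|lborel. f x * (g y * e (x, y))) = (LINT x|lborel. LINT y|lborel. f x * (g y * e (x, y)))" .
  moreover have "(LINT x|lborel. f x * (g y * e (x, y))) = g y * (LINT x|lborel. f x * e (x, y))" for y
    by (subst mult.left_commute) simp
  ultimately show ?thesis by simp
qed

lemma borel_measurable_unit_char_inner [measurable]:
  "(\<lambda>p::(real ^ 'n::finite) \<times> (real ^ 'n). unit_char (fst p \<bullet> snd p)) \<in> borel_measurable borel"
  "(\<lambda>p::(real ^ 'n::finite) \<times> (real ^ 'n). unit_char (- (fst p \<bullet> snd p))) \<in> borel_measurable borel"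
  by (intro borel_measurable_continuous_onI continuous_intros)+

text \<open>The exponential kernel is symmetric in its two variables, so Fubini moves the transform
  from one factor to the other. Fourier inversion and the action of multipliers on the test
  distributions both rest on this.\<close>

lemma fourier_multiplication:
  fixes f g :: "real ^ 'n::finite \<Rightarrow> complex"
  assumes "integrable lborel f" "integrable lborel g"
  shows "(LINT \<xi>|lborel. fourier f \<xi> * g \<xi>) = (LINT \<xi>|lborel. f \<xi> * fourier g \<xi>)"
proof -
  have "(LINT x|lborel. g x * (LINT y|lborel. f y * unit_char (- (fst (x, y) \<bullet> snd (x, y))))) =
      (LINT y|lborel. f y * (LINT x|lborel. g x * unit_char (- (fst (x, y) \<bullet> snd (x, y)))))"
    by (rule Fubini_bounded_kernel[where B=1]) (use assms in auto)
  then show ?thesis by (simp add: fourier_eq mult.commute inner_commute)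
qed

section \<open>Derivatives of the Fourier transform\<close>

lemma has_derivative_quadratic:
  fixes F :: "'a::real_normed_vector \<Rightarrow> 'b::real_normed_vector"
  assumes "bounded_linear D" "\<And>h. norm (F (x + h) - F x - D h) \<le> C * (norm h)\<^sup>2"
  shows "(F has_derivative D) (at x)"
  unfolding has_derivative_at
proof (intro conjI assms)
  have "((\<lambda>h::'a. \<bar>C\<bar> * norm h) \<longlongrightarrow> \<bar>C\<bar> * norm (0::'a)) (at 0)" by (intro tendsto_intros)
  then have lim: "((\<lambda>h::'a. \<bar>C\<bar> * norm h) \<longlongrightarrow> 0) (at 0)" by simp
  have "norm (F (x + h) - F x - D h) / norm h \<le> \<bar>C\<bar> * norm h" if "h \<noteq> 0" for h
  proof -
    have "norm (F (x + h) - F x - D h) \<le> \<bar>C\<bar> * (norm h)\<^sup>2"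
      by (rule order_trans[OF assms(2)]) (intro mult_right_mono, auto)
    then show ?thesis using that by (simp add: field_simps power2_eq_square)
  qed
  then show "(\<lambda>h. norm (F (x + h) - F x - D h) / norm h) \<midarrow>0\<rightarrow> 0"
    by (intro tendsto_sandwich[OF _ _ tendsto_const lim]) (auto simp: eventually_at_filter)
qed

lemma norm_unit_char_taylor: "norm (unit_char t - 1 - 2 * pi * \<i> * t) \<le> (2 * pi * t)\<^sup>2"
proof -
  have "norm (iexp (2 * pi * t) - (\<Sum>k \<le> 1. (\<i> * complex_of_real (2 * pi * t)) ^ k / fact k)) \<le> \<bar>2 * pi * t\<bar> ^ Suc 1 / fact (Suc 1)"
    by (rule iexp_approx1)
  also have "\<dots> \<le> (2 * pi * t)\<^sup>2" by (simp add: power2_eq_square)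
  finally show ?thesis by (simp add: unit_char_def cis_conv_exp mult_ac diff_diff_eq)
qed

lemma schwartz_mult_inner:
  assumes "f \<in> schwartz" shows "(\<lambda>x. of_real (x \<bullet> h) * f x) \<in> schwartz"
proof -
  have "(\<lambda>x. \<Sum>i\<in>UNIV. of_real (h $ i) * (of_real (x $ i) * f x)) \<in> schwartz"
    by (intro schwartz_sum schwartz_cmult schwartz_mult_coord assms)
  then show ?thesis by (simp add: inner_vec_def sum_distrib_left mult_ac)
qed

text \<open>Differentiation under the integral sign by an explicit remainder: the error of the
  exponential after its linear term is at most the square of 2 pi times x . h, and the decay of
  \<open>f\<close> makes |x|^2 |f(x)| integrable, so the remainder is quadratic in h.\<close>

lemma fourier_has_derivative:
  fixes f :: "real ^ 'n::finite \<Rightarrow> complex"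
  assumes "f \<in> schwartz"
  shows "(fourier f has_derivative
     (\<lambda>h. \<Sum>i\<in>UNIV. h $ i *\<^sub>R fourier (\<lambda>x. - 2 * pi * \<i> * (of_real (x $ i) * f x)) \<xi>)) (at \<xi>)"
proof -
  define D where "D h = (\<Sum>i\<in>UNIV. h $ i *\<^sub>R fourier (\<lambda>x. - 2 * pi * \<i> * (of_real (x $ i) * f x)) \<xi>)" for h :: "real ^ 'n"
  have i1: "integrable lborel (\<lambda>x. unit_char (- (x \<bullet> \<xi>)) * f x)" for \<xi>
    using schwartz_integrable[OF assms] by (intro integrable_unit_char_mult) auto
  have unit_char_split: "unit_char (- (x \<bullet> (\<xi> + h))) = unit_char (- (x \<bullet> \<xi>)) * unit_char (- (x \<bullet> h))" for x h
    by (simp add: inner_add_right flip: unit_char_add)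
  have i2: "integrable lborel (\<lambda>x. unit_char (- (x \<bullet> \<xi>)) * (- 2 * pi * \<i> * (of_real (x $ i) * f x)))" for i
    by (intro integrable_unit_char_mult schwartz_integrable schwartz_cmult schwartz_mult_coord assms) measurable
  have D_eq: "D h = (LINT x|lborel. unit_char (- (x \<bullet> \<xi>)) * (- 2 * pi * \<i> * (of_real (x \<bullet> h) * f x)))" for h
  proof -
    have "D h = (\<Sum>i\<in>UNIV. (LINT x|lborel. h $ i *\<^sub>R (unit_char (- (x \<bullet> \<xi>)) * (- 2 * pi * \<i> * (of_real (x $ i) * f x)))))"
      unfolding D_def fourier_eq using i2 by simp
    also have "\<dots> = (LINT x|lborel. (\<Sum>i\<in>UNIV. h $ i *\<^sub>R (unit_char (- (x \<bullet> \<xi>)) * (- 2 * pi * \<i> * (of_real (x $ i) * f x)))))"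
      using i2 by (intro Bochner_Integration.integral_sum[symmetric]) auto
    also have "(\<lambda>x. (\<Sum>i\<in>UNIV. h $ i *\<^sub>R (unit_char (- (x \<bullet> \<xi>)) * (- 2 * pi * \<i> * (of_real (x $ i) * f x))))) =
       (\<lambda>x. unit_char (- (x \<bullet> \<xi>)) * (- 2 * pi * \<i> * (of_real (x \<bullet> h) * f x)))"
      by (auto simp: inner_vec_def sum_distrib_left sum_distrib_right scaleR_conv_of_real mult_ac)
    finally show ?thesis .
  qed
  have i3: "integrable lborel (\<lambda>x. unit_char (- (x \<bullet> \<xi>)) * (- 2 * pi * \<i> * (of_real (x \<bullet> h) * f x)))" for h
    by (intro integrable_unit_char_mult schwartz_integrable schwartz_cmult schwartz_mult_inner assms) measurable
  \<comment> \<open>Two powers of the weight absorb |x|^2 from the Taylor error; the remaining 2n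
    make the majorant integrable.\<close>
  obtain B where B: "B > 0" "\<And>x. norm (f x) * (1 + norm x) ^ (2 + 2 * CARD('n)) \<le> B"
    using rapidD[OF schwartz_rapid[OF assms]] by blast
  have bl: "bounded_linear D"
    unfolding D_def by (intro bounded_linear_sum bounded_linear_scaleR_left[THEN bounded_linear_compose] bounded_linear_vec_nth)
  define I where "I = (LINT x::real^'n|lborel. inverse ((1 + norm x) ^ (2 * CARD('n))))"
  have "norm (fourier f (\<xi> + h) - fourier f \<xi> - D h) \<le> ((2 * pi)\<^sup>2 * B * I) * (norm h)\<^sup>2" for h
  proof -
    have "fourier f (\<xi> + h) - fourier f \<xi> - D h = (LINT x|lborel. unit_char (- (x \<bullet> (\<xi> + h))) * f x - unit_char (- (x \<bullet> \<xi>)) * f x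
         - unit_char (- (x \<bullet> \<xi>)) * (- 2 * pi * \<i> * (of_real (x \<bullet> h) * f x)))"
      unfolding fourier_eq D_eq using i1 i3 by simp
    also have "(\<lambda>x. unit_char (- (x \<bullet> (\<xi> + h))) * f x - unit_char (- (x \<bullet> \<xi>)) * f x
         - unit_char (- (x \<bullet> \<xi>)) * (- 2 * pi * \<i> * (of_real (x \<bullet> h) * f x))) =
       (\<lambda>x. unit_char (- (x \<bullet> \<xi>)) * (unit_char (- (x \<bullet> h)) - 1 - 2 * pi * \<i> * (- (x \<bullet> h))) * f x)"
      unfolding unit_char_split by (simp add: algebra_simps)
    finally have "norm (fourier f (\<xi> + h) - fourier f \<xi> - D h) =
       norm (LINT x|lborel. unit_char (- (x \<bullet> \<xi>)) * (unit_char (- (x \<bullet> h)) - 1 - 2 * pi * \<i> * (- (x \<bullet> h))) * f x)" by simp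
    also have "\<dots> \<le> (LINT x::real^'n|lborel. ((2 * pi)\<^sup>2 * B * (norm h)\<^sup>2) * inverse ((1 + norm x) ^ (2 * CARD('n))))"
    proof (rule norm_lebesgue_integral_le)
      show "integrable lborel (\<lambda>x::real^'n. ((2 * pi)\<^sup>2 * B * (norm h)\<^sup>2) * inverse ((1 + norm x) ^ (2 * CARD('n))))"
        by (intro integrable_mult_right integrable_inverse_power_norm) auto
      fix x :: "real ^ 'n"
      have pos: "0 < (1 + norm x) ^ (2 * CARD('n))" by (auto intro!: zero_less_power add_pos_nonneg)
      have "norm (unit_char (- (x \<bullet> \<xi>)) * (unit_char (- (x \<bullet> h)) - 1 - 2 * pi * \<i> * (- (x \<bullet> h))) * f x)
        \<le> (2 * pi * (- (x \<bullet> h)))\<^sup>2 * norm (f x)"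
        unfolding norm_mult[of _ "f x"] norm_mult[of "unit_char _"] norm_unit_char mult_1
        using norm_unit_char_taylor[of "- (x \<bullet> h)"] by (intro mult_right_mono) auto
      also have "\<dots> = (2 * pi)\<^sup>2 * ((x \<bullet> h)\<^sup>2 * norm (f x))" by (simp add: power_mult_distrib)
      also have "\<dots> \<le> (2 * pi)\<^sup>2 * ((norm x * norm h)\<^sup>2 * norm (f x))"
        by (intro mult_left_mono mult_right_mono) (auto simp: abs_le_square_iff[symmetric] Cauchy_Schwarz_ineq2)
      also have "\<dots> \<le> (2 * pi)\<^sup>2 * (((1 + norm x) * norm h)\<^sup>2 * norm (f x))"
        by (intro mult_left_mono mult_right_mono power_mono) auto
      also have "\<dots> = (2 * pi)\<^sup>2 * (norm h)\<^sup>2 * (norm (f x) * (1 + norm x) ^ (2 + 2 * CARD('n))) * inverse ((1 + norm x) ^ (2 * CARD('n)))"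
        using pos by (simp add: power_add power_mult_distrib nonzero_eq_divide_eq power2_eq_square divide_inverse[symmetric])
      also have "\<dots> \<le> (2 * pi)\<^sup>2 * (norm h)\<^sup>2 * B * inverse ((1 + norm x) ^ (2 * CARD('n)))"
        using pos by (intro mult_left_mono mult_right_mono B) auto
      finally show "norm (unit_char (- (x \<bullet> \<xi>)) * (unit_char (- (x \<bullet> h)) - 1 - 2 * pi * \<i> * (- (x \<bullet> h))) * f x)
         \<le> ((2 * pi)\<^sup>2 * B * (norm h)\<^sup>2) * inverse ((1 + norm x) ^ (2 * CARD('n)))" by (simp add: mult_ac)
    qed
    also have "\<dots> = ((2 * pi)\<^sup>2 * B * I) * (norm h)\<^sup>2" by (simp add: I_def)
    finally show ?thesis .
  qed
  from has_derivative_quadratic[OF bl this] show ?thesis unfolding D_def .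
qed

lemma partial_deriv_fourier:
  fixes f :: "real ^ 'n::finite \<Rightarrow> complex"
  assumes "f \<in> schwartz"
  shows "partial_deriv i (fourier f) = fourier (\<lambda>x. - 2 * pi * \<i> * (of_real (x $ i) * f x))"
proof
  fix \<xi>
  have "partial_deriv i (fourier f) \<xi> = (\<Sum>j\<in>UNIV. (axis i 1 :: real ^ 'n) $ j *\<^sub>R fourier (\<lambda>x. - 2 * pi * \<i> * (of_real (x $ j) * f x)) \<xi>)"
    by (rule partial_deriv_eq[OF fourier_has_derivative[OF assms]])
  also have "\<dots> = (\<Sum>j\<in>UNIV. if j = i then fourier (\<lambda>x. - 2 * pi * \<i> * (of_real (x $ j) * f x)) \<xi> else 0)"
    by (intro sum.cong) (auto simp: axis_def)
  finally show "partial_deriv i (fourier f) \<xi> = fourier (\<lambda>x. - 2 * pi * \<i> * (of_real (x $ i) * f x)) \<xi>" by simp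
qed

text \<open>Write f(x + e) - f(x) as the integral of the derivative along the segment and integrate
  over all x. The difference contributes 0 by translation invariance; by Fubini the other side is
  the integral of the derivative, which is the same for every shift along the segment.\<close>

lemma integral_partial_deriv:
  fixes f :: "real ^ 'n::finite \<Rightarrow> complex"
  assumes "f \<in> schwartz"
  shows "(LINT x|lborel. partial_deriv i f x) = 0"
proof -
  define g where "g = partial_deriv i f"
  define e :: "real ^ 'n" where "e = axis i 1"
  have g: "g \<in> schwartz" unfolding g_def by (rule schwartz_partial_deriv[OF assms])
  note [measurable] = schwartz_measurable[OF g] schwartz_measurable[OF assms]
  have gi: "integrable lborel (\<lambda>x. g (x + t *\<^sub>R e))" for t
    by (intro lborel_integrable_translate schwartz_integrable g)
  have der: "((\<lambda>t. f (x + t *\<^sub>R e)) has_vector_derivative g (x + t *\<^sub>R e)) (at t within S)" for x t S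
  proof -
    have lin: "linear (frechet_derivative f (at (x + t *\<^sub>R e)))"
      using schwartz_has_derivative[OF assms] has_derivative_linear by blast
    have "((\<lambda>t. f (x + t *\<^sub>R e)) has_derivative (\<lambda>h. frechet_derivative f (at (x + t *\<^sub>R e)) (h *\<^sub>R e))) (at t within S)"
      by (rule has_derivative_compose[OF _ schwartz_has_derivative[OF assms]]) (auto intro!: derivative_eq_intros)
    then show ?thesis
      unfolding has_vector_derivative_def g_def partial_deriv_def e_def using lin by (simp add: linear_cmul[OF lin[unfolded e_def]])
  qed
  have cont: "continuous_on S (\<lambda>t. g (x + t *\<^sub>R e))" for x S
    by (rule continuous_on_compose2[OF schwartz_continuous[OF g]]) (auto intro!: continuous_intros)
  have "integrable (lborel \<Otimes>\<^sub>M lborel) (\<lambda>(t, x). indicat_real {0..1} t *\<^sub>R g (x + t *\<^sub>R e))"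
  proof (rule lborel_pair.Fubini_integrable)
    have "(\<lambda>p. g (snd p + fst p *\<^sub>R e)) \<in> borel_measurable borel"
      by (intro borel_measurable_continuous_onI continuous_on_compose2[OF schwartz_continuous[OF g]] continuous_intros) auto
    then have "(\<lambda>p. g (snd p + fst p *\<^sub>R e)) \<in> borel_measurable (lborel \<Otimes>\<^sub>M lborel)" by (simp add: lborel_prod)
    then show "(\<lambda>(t, x). indicat_real {0..1} t *\<^sub>R g (x + t *\<^sub>R e)) \<in> borel_measurable (lborel \<Otimes>\<^sub>M lborel)"
      by (simp add: case_prod_beta')
    show "AE t in lborel. integrable lborel (\<lambda>x. case (t, x) of (t, x) \<Rightarrow> indicat_real {0..1} t *\<^sub>R g (x + t *\<^sub>R e))"
      using gi by auto
    have "(\<lambda>t. LINT x|lborel. norm (case (t, x) of (t, x) \<Rightarrow> indicat_real {0..1} t *\<^sub>R g (x + t *\<^sub>R e))) =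
       (\<lambda>t. indicat_real {0..1} t * (LINT x|lborel. norm (g x)))"
      using lborel_integral_translate[of "\<lambda>x. norm (g x)"] by auto
    then show "integrable lborel (\<lambda>t. LINT x|lborel. norm (case (t, x) of (t, x) \<Rightarrow> indicat_real {0..1} t *\<^sub>R g (x + t *\<^sub>R e)))"
      by (auto intro!: integrable_mult_left integrable_real_indicator)
  qed
  from lborel_pair.Fubini_integral[OF this]
  have "(LINT x|lborel. LINT t|lborel. indicat_real {0..1} t *\<^sub>R g (x + t *\<^sub>R e)) =
     (LINT t|lborel. LINT x|lborel. indicat_real {0..1} t *\<^sub>R g (x + t *\<^sub>R e))" .
  also have "\<dots> = (LINT t|lborel. indicat_real {0..1::real} t *\<^sub>R (LINT x|lborel. g x))"
    by (intro Bochner_Integration.integral_cong refl) (simp add: lborel_integral_translate)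
  also have "\<dots> = (LINT t|lborel. indicat_real {0..1::real} t) *\<^sub>R (LINT x|lborel. g x)"
    by (rule integral_scaleR_left) (auto intro!: integrable_real_indicator)
  also have "(LINT t|lborel. indicat_real {0..1::real} t) = 1" by simp
  also have "1 *\<^sub>R (LINT x|lborel. g x) = (LINT x|lborel. g x)" by (rule scaleR_one)
  also have "(LINT x|lborel. LINT t|lborel. indicat_real {0..1} t *\<^sub>R g (x + t *\<^sub>R e)) = (LINT x|lborel. f (x + e) - f x)"
    by (intro Bochner_Integration.integral_cong refl)
      (subst integral_FTC_Icc[OF _ der cont], auto)
  also have "\<dots> = 0"
    using lborel_integral_translate[of f e] lborel_integrable_translate[OF schwartz_integrable[OF assms], of e] schwartz_integrable[OF assms]
    by simp
  finally show ?thesis by (simp add: g_def)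
qed

lemma fourier_partial_deriv:
  fixes f :: "real ^ 'n::finite \<Rightarrow> complex"
  assumes "f \<in> schwartz"
  shows "fourier (partial_deriv i f) \<xi> = 2 * pi * \<i> * of_real (\<xi> $ i) * fourier f \<xi>"
proof -
  \<comment> \<open>The derivative of \<open>f\<close> times this character has integral zero, and
    the product rule splits that integral into the two sides of the claim.\<close>
  define F where "F x = unit_char ((- \<xi>) \<bullet> x) * f x" for x
  have F: "F \<in> schwartz" unfolding F_def by (rule schwartz_modulate[OF assms])
  have int: "integrable lborel (\<lambda>x. unit_char (- (x \<bullet> \<xi>)) * partial_deriv i f x)" "integrable lborel (\<lambda>x. unit_char (- (x \<bullet> \<xi>)) * f x)"
    by (intro integrable_unit_char_mult schwartz_integrable schwartz_partial_deriv assms; measurable)+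
  have "partial_deriv i F x = unit_char (- (x \<bullet> \<xi>)) * partial_deriv i f x - 2 * pi * \<i> * of_real (\<xi> $ i) * (unit_char (- (x \<bullet> \<xi>)) * f x)" for x
  proof -
    have "(F has_derivative (\<lambda>h. unit_char ((- \<xi>) \<bullet> x) * frechet_derivative f (at x) h + (2 * pi * \<i> * of_real ((- \<xi>) \<bullet> h) * unit_char ((- \<xi>) \<bullet> x)) * f x)) (at x)"
      unfolding F_def by (intro has_derivative_mult has_derivative_unit_char_inner schwartz_has_derivative assms)
    from partial_deriv_eq[OF this] show ?thesis
      by (simp add: partial_deriv_def inner_axis inner_commute mult_ac)
  qed
  then have "0 = (LINT x|lborel. unit_char (- (x \<bullet> \<xi>)) * partial_deriv i f x - 2 * pi * \<i> * of_real (\<xi> $ i) * (unit_char (- (x \<bullet> \<xi>)) * f x))"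
    using integral_partial_deriv[OF F, of i] by simp
  also have "\<dots> = fourier (partial_deriv i f) \<xi> - 2 * pi * \<i> * of_real (\<xi> $ i) * fourier f \<xi>"
    unfolding fourier_eq using int by simp
  finally show ?thesis by simp
qed

text \<open>Each power of |\<xi>| is traded for one derivative of \<open>f\<close>, hence the
  induction over the power for all Schwartz \<open>f\<close> simultaneously. The norm is bounded by
  the sum of the coordinates, and the factor 2 pi is only used through 2 pi \<ge> 1.\<close>

lemma rapid_fourier:
  fixes f :: "real ^ 'n::finite \<Rightarrow> complex"
  assumes "f \<in> schwartz"
  shows "rapid (fourier f)"
proof -
  have "\<exists>B. \<forall>\<xi>. norm (fourier f \<xi>) * (1 + norm \<xi>) ^ N \<le> B" for N
    using assms
  proof (induction N arbitrary: f)
    case 0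
    then show ?case using norm_fourier_le by auto
  next
    case (Suc N)
    obtain B where B: "\<And>\<xi>. norm (fourier f \<xi>) * (1 + norm \<xi>) ^ N \<le> B"
      using Suc by blast
    have "\<forall>i. \<exists>B. \<forall>\<xi>. norm (fourier (partial_deriv i f) \<xi>) * (1 + norm \<xi>) ^ N \<le> B"
      using Suc by (blast intro: schwartz_partial_deriv)
    then obtain C where C: "\<And>i \<xi>. norm (fourier (partial_deriv i f) \<xi>) * (1 + norm \<xi>) ^ N \<le> C i"
      by metis
    have "norm (fourier f \<xi>) * (1 + norm \<xi>) ^ Suc N \<le> B + (\<Sum>i\<in>UNIV. C i)" for \<xi>
    proof -
      have c: "\<bar>\<xi> $ i\<bar> * norm (fourier f \<xi>) \<le> norm (fourier (partial_deriv i f) \<xi>)" for i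
      proof -
        have "1 * (\<bar>\<xi> $ i\<bar> * norm (fourier f \<xi>)) \<le> (2 * pi) * (\<bar>\<xi> $ i\<bar> * norm (fourier f \<xi>))"
          using pi_gt3 by (intro mult_right_mono) auto
        then show ?thesis using fourier_partial_deriv[OF Suc(2), of i \<xi>] by (simp add: norm_mult)
      qed
      have "norm (fourier f \<xi>) * (1 + norm \<xi>) ^ Suc N = norm (fourier f \<xi>) * (1 + norm \<xi>) ^ N + norm \<xi> * norm (fourier f \<xi>) * (1 + norm \<xi>) ^ N"
        by (simp add: algebra_simps)
      also have "norm \<xi> * norm (fourier f \<xi>) * (1 + norm \<xi>) ^ N \<le> (\<Sum>i\<in>UNIV. \<bar>\<xi> $ i\<bar>) * norm (fourier f \<xi>) * (1 + norm \<xi>) ^ N"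
        by (intro mult_right_mono norm_le_l1_cart) auto
      also have "\<dots> = (\<Sum>i\<in>UNIV. (\<bar>\<xi> $ i\<bar> * norm (fourier f \<xi>)) * (1 + norm \<xi>) ^ N)"
        by (simp add: sum_distrib_right)
      also have "\<dots> \<le> (\<Sum>i\<in>UNIV. norm (fourier (partial_deriv i f) \<xi>) * (1 + norm \<xi>) ^ N)"
        by (intro sum_mono mult_right_mono c) auto
      also have "\<dots> \<le> (\<Sum>i\<in>UNIV. C i)" by (intro sum_mono C)
      finally show ?thesis using B[of \<xi>] by simp
    qed
    then show ?case by blast
  qed
  then show ?thesis by (simp add: rapid_def)
qed

lemma fourier_schwartz:
  assumes "f \<in> schwartz" shows "fourier f \<in> schwartz"
proof (rule schwartz_coinduct[where A="fourier ` schwartz"])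
  show "g differentiable at x" if "g \<in> fourier ` schwartz" for g :: "real ^ 'n \<Rightarrow> complex" and x
    using that fourier_has_derivative unfolding differentiable_def by blast
  show "partial_deriv i g \<in> fourier ` schwartz" if "g \<in> fourier ` schwartz" for g :: "real ^ 'n \<Rightarrow> complex" and i
    using that by (auto simp: partial_deriv_fourier intro!: imageI schwartz_cmult schwartz_mult_coord schwartz_uminus)
qed (use assms rapid_fourier in auto)

lemma inv_fourier_schwartz: "f \<in> schwartz \<Longrightarrow> inv_fourier f \<in> schwartz"
  using schwartz_reflect[OF fourier_schwartz, of f] by (simp add: inv_fourier_fourier[abs_def])

lemma fourier_modulate: "fourier (\<lambda>\<xi>. unit_char (x \<bullet> \<xi>) * f \<xi>) y = fourier f (y - x)"
  unfolding fourier_eq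
  by (intro Bochner_Integration.integral_cong refl)
    (simp add: inner_diff_right inner_commute mult.assoc[symmetric] flip: unit_char_add)

lemma fourier_translate: "fourier (\<lambda>\<xi>. f (\<xi> + x)) y = unit_char (x \<bullet> y) * fourier f y"
proof -
  have "fourier f y = (LINT \<xi>|lborel. unit_char (- ((\<xi> + x) \<bullet> y)) * f (\<xi> + x))"
    unfolding fourier_eq by (rule lborel_integral_translate[symmetric])
  also have "\<dots> = (LINT \<xi>|lborel. unit_char (- (x \<bullet> y)) * (unit_char (- (\<xi> \<bullet> y)) * f (\<xi> + x)))"
    by (intro Bochner_Integration.integral_cong refl)
      (simp add: inner_add_left mult.assoc[symmetric] add.commute flip: unit_char_add)
  also have "\<dots> = unit_char (- (x \<bullet> y)) * fourier (\<lambda>\<xi>. f (\<xi> + x)) y" by (simp add: fourier_eq)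
  finally show ?thesis by (simp add: mult.assoc[symmetric])
qed

lemma fourier_scale:
  fixes f :: "real ^ 'n::finite \<Rightarrow> complex"
  assumes "a > 0"
  shows "fourier (\<lambda>\<xi>. f (a *\<^sub>R \<xi>)) y = of_real ((1 / a) ^ CARD('n)) * fourier f ((1 / a) *\<^sub>R y)"
proof -
  have "fourier (\<lambda>\<xi>. f (a *\<^sub>R \<xi>)) y = \<bar>1 / a\<bar> ^ CARD('n) *\<^sub>R (LINT x|lborel. unit_char (- ((0 + (1 / a) *\<^sub>R x) \<bullet> y)) * f (a *\<^sub>R (0 + (1 / a) *\<^sub>R x)))"
    unfolding fourier_eq using assms by (subst lborel_integral_affine[of "1 / a" _ 0]) auto
  then show ?thesis using assms by (simp add: fourier_eq scaleR_conv_of_real[where 'a=complex])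
qed

lemma integral_pos_continuous:
  fixes f :: "'a::euclidean_space \<Rightarrow> real"
  assumes "continuous_on UNIV f" "\<And>x. f x \<ge> 0" "integrable lborel f" "f a > 0"
  shows "(LINT x|lborel. f x) > 0"
proof -
  have "isCont f a" using assms(1) continuous_on_eq_continuous_at open_UNIV by blast
  then obtain d where d: "d > 0" "\<And>x. dist x a < d \<Longrightarrow> dist (f x) (f a) < f a / 2"
    using assms(4) unfolding continuous_at_eps_delta by (meson half_gt_zero)
  have le: "f a / 2 * indicator (ball a d) x \<le> f x" for x
    using d(2)[of x] assms(2)[of x] by (auto simp: indicator_def dist_commute dist_real_def abs_if split: if_splits)
  have "0 < f a / 2 * measure lborel (ball a d)"
    using assms(4) content_ball_pos[OF d(1)] by simp
  also have "\<dots> = (LINT x|lborel. f a / 2 * indicator (ball a d) x)" by simp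
  also have "\<dots> \<le> (LINT x|lborel. f x)"
    by (intro integral_mono assms le integrable_mult_right integrable_real_indicator) (use emeasure_lborel_ball_finite[of a d] in auto)
  finally show ?thesis .
qed

section \<open>Tempered distributions and Fourier multipliers\<close>

lemma schwartz_bounded:
  assumes "f \<in> schwartz" obtains B where "B > 0" "\<And>x. norm (f x) \<le> B"
  using rapidD[OF schwartz_rapid[OF assms], of 0] by auto

lemma schwartz_uniform_bound:
  fixes f :: "real ^ 'n::finite \<Rightarrow> complex"
  assumes "f \<in> schwartz"
  obtains B where "B > 0" "\<And>is x. length is \<le> L \<Longrightarrow> norm (partial_derivs is f x) * (1 + norm x) ^ N \<le> B"
proof -
  have "\<exists>B>0. \<forall>x. norm (partial_derivs is f x) * (1 + norm x) ^ N \<le> B" for "is"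
    using rapidD[OF schwartz_rapid[OF schwartz_partial_derivs[OF assms]]] by metis
  then obtain B where B: "\<And>is. B is > 0" "\<And>is x. norm (partial_derivs is f x) * (1 + norm x) ^ N \<le> B is"
    by metis
  have fin: "finite {is :: 'n list. length is \<le> L}"
    using finite_lists_length_le[of "UNIV :: 'n set" L] by simp
  have "norm (partial_derivs is f x) * (1 + norm x) ^ N \<le> (\<Sum>is | length is \<le> L. B is)" if "length is \<le> L" for "is" x
    using that B(1) by (intro order_trans[OF B(2)] member_le_sum fin) (auto simp: less_imp_le)
  moreover have "(\<Sum>is | length is \<le> L. B (is :: 'n list)) > 0"
    using B(1) fin by (intro sum_pos) (auto intro: exI[of _ "[]"])
  ultimately show ?thesis using that by blast
qed

lemma tempered_linear:
  assumes "u \<in> tempered" "\<phi> \<in> schwartz" "\<theta> \<in> schwartz"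
  shows "u (\<lambda>x. a * \<phi> x + b * \<theta> x) = a * u \<phi> + b * u \<theta>"
  using assms by (simp add: tempered_def)

lemma tempered_diff:
  assumes "u \<in> tempered" "\<phi> \<in> schwartz" "\<theta> \<in> schwartz"
  shows "u (\<lambda>x. \<phi> x - \<theta> x) = u \<phi> - u \<theta>"
  using tempered_linear[OF assms, of 1 "-1"] by simp

lemma tempered_cmult:
  assumes "u \<in> tempered" "\<phi> \<in> schwartz"
  shows "u (\<lambda>x. a * \<phi> x) = a * u \<phi>"
  using tempered_linear[OF assms assms(2), of a 0] by simp

lemma tempered_sum:
  assumes "u \<in> tempered" "\<And>i. i \<in> I \<Longrightarrow> f i \<in> schwartz"
  shows "u (\<lambda>x. \<Sum>i\<in>I. a i * f i x) = (\<Sum>i\<in>I. a i * u (f i))"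
  using assms(2)
proof (induction I rule: infinite_finite_induct)
  case (insert i I)
  have "u (\<lambda>x. \<Sum>i\<in>insert i I. a i * f i x) = u (\<lambda>x. a i * f i x + 1 * (\<Sum>i\<in>I. a i * f i x))"
    using insert by simp
  also have "\<dots> = a i * u (f i) + 1 * u (\<lambda>x. \<Sum>i\<in>I. a i * f i x)"
    using insert by (intro tempered_linear assms(1)) (auto intro!: schwartz_sum schwartz_cmult)
  finally show ?case using insert by simp
qed (use tempered_cmult[OF assms(1) schwartz_zero, of 0] in auto)

text \<open>Trades the supremum in the seminorm for a pointwise hypothesis with an arbitrary bound
  \<open>B\<close>. Taking |C| keeps the constant nonnegative, and the empty list at the origin
  shows that the supremum is nonnegative.\<close>

lemma tempered_bound:
  assumes "u \<in> tempered"
  obtains N C where "C \<ge> 0"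
    "\<And>\<phi> B. \<phi> \<in> schwartz \<Longrightarrow> (\<And>is x. length is \<le> N \<Longrightarrow> norm (partial_derivs is \<phi> x) * (1 + norm x) ^ N \<le> B) \<Longrightarrow> norm (u \<phi>) \<le> C * B"
proof -
  obtain N C where NC: "\<And>\<phi>. \<phi> \<in> schwartz \<Longrightarrow> norm (u \<phi>) \<le> C * schwartz_seminorm N \<phi>"
    using assms unfolding tempered_def by blast
  have "norm (u \<phi>) \<le> \<bar>C\<bar> * B"
    if "\<phi> \<in> schwartz" and B: "\<And>is x. length is \<le> N \<Longrightarrow> norm (partial_derivs is \<phi> x) * (1 + norm x) ^ N \<le> B" for \<phi> B
  proof -
    have le: "schwartz_seminorm N \<phi> \<le> B"
      unfolding schwartz_seminorm_def
      by (rule cSUP_least) (use B in \<open>auto simp: mult.commute intro!: exI[of _ "[]"]\<close>)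
    have "bdd_above ((\<lambda>(is, x). (1 + norm x) ^ N * norm (partial_derivs is \<phi> x)) ` ({is. length is \<le> N} \<times> UNIV))"
      by (rule bdd_aboveI[of _ B]) (use B in \<open>auto simp: mult.commute\<close>)
    then have "0 \<le> schwartz_seminorm N \<phi>"
      unfolding schwartz_seminorm_def by (intro cSUP_upper2[of _ _ "([], 0)"]) auto
    then have "C * schwartz_seminorm N \<phi> \<le> \<bar>C\<bar> * B"
      using le by (intro mult_mono) auto
    then show ?thesis using NC[OF that(1)] by linarith
  qed
  then show ?thesis using that[of "\<bar>C\<bar>" N] by auto
qed

lemma partial_derivs_translate:
  assumes "f \<in> schwartz"
  shows "partial_derivs is (\<lambda>y. f (y - x)) = (\<lambda>y. partial_derivs is f (y - x))"
proof (induction "is")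
  case (Cons i "is")
  have "partial_deriv i (\<lambda>y. partial_derivs is f (y - x)) y = partial_deriv i (partial_derivs is f) (y - x)" for y
  proof -
    have "((\<lambda>y. partial_derivs is f (y - x)) has_derivative (\<lambda>h. frechet_derivative (partial_derivs is f) (at (y - x)) h)) (at y)"
      by (rule has_derivative_compose[OF _ schwartz_has_derivative[OF schwartz_partial_derivs[OF assms]]])
        (auto intro!: derivative_eq_intros)
    from partial_deriv_eq[OF this] show ?thesis by (simp add: partial_deriv_def)
  qed
  then show ?case using Cons by auto
qed auto

lemma partial_derivs_diff:
  assumes "f \<in> schwartz" "g \<in> schwartz"
  shows "partial_derivs is (\<lambda>y. f y - g y) = (\<lambda>y. partial_derivs is f y - partial_derivs is g y)"
proof (induction "is")
  case (Cons i "is")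
  have "partial_deriv i (\<lambda>y. partial_derivs is f y - partial_derivs is g y) y = partial_deriv i (partial_derivs is f) y - partial_deriv i (partial_derivs is g) y" for y
    using partial_deriv_eq[OF has_derivative_diff[OF schwartz_has_derivative[OF schwartz_partial_derivs[OF assms(1)]]
        schwartz_has_derivative[OF schwartz_partial_derivs[OF assms(2)]]]]
    by (simp add: partial_deriv_def)
  then show ?case using Cons by auto
qed auto

lemma partial_derivs_sum:
  assumes "finite I" "\<And>v. v \<in> I \<Longrightarrow> f v \<in> schwartz"
  shows "partial_derivs is (\<lambda>y. \<Sum>v\<in>I. a v * f v y) = (\<lambda>y. \<Sum>v\<in>I. a v * partial_derivs is (f v) y)"
proof (induction "is")
  case (Cons i "is")
  have "partial_deriv i (\<lambda>y. \<Sum>v\<in>I. a v * partial_derivs is (f v) y) y = (\<Sum>v\<in>I. a v * partial_deriv i (partial_derivs is (f v)) y)" for y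
  proof -
    have "((\<lambda>y. \<Sum>v\<in>I. a v * partial_derivs is (f v) y) has_derivative (\<lambda>h. \<Sum>v\<in>I. a v * frechet_derivative (partial_derivs is (f v)) (at y) h)) (at y)"
      by (intro has_derivative_sum has_derivative_mult_right schwartz_has_derivative schwartz_partial_derivs assms)
    from partial_deriv_eq[OF this] show ?thesis by (simp add: partial_deriv_def)
  qed
  then show ?case using Cons by auto
qed auto

text \<open>Submultiplicativity of the weight, a form of Peetre's inequality. It is what moves
  polynomial weights from one centre to another in the kernel estimates.\<close>

lemma one_plus_norm_mult:
  "1 + norm (a + b) \<le> (1 + norm a) * (1 + norm (b :: 'a::real_normed_vector))"
proof -
  have "1 + norm (a + b) \<le> 1 + norm a + norm b" using norm_triangle_ineq[of a b] by simp
  also have "\<dots> \<le> (1 + norm a) * (1 + norm b)" by (simp add: algebra_simps)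
  finally show ?thesis .
qed

text \<open>Mean value inequality along the segment from y - v to y - x. Points of the segment are
  within |x| + |v| of y, so the weight there compares to the weight at y at the cost of (1 + |x| +
  |v|)^N.\<close>

lemma schwartz_lipschitz:
  fixes f :: "real ^ 'n::finite \<Rightarrow> complex"
  assumes f: "f \<in> schwartz" and B: "\<And>i x. norm (partial_deriv i f x) * (1 + norm x) ^ N \<le> B"
  shows "norm (f (y - x) - f (y - v)) * (1 + norm y) ^ N \<le> real CARD('n) * B * norm (x - v) * (1 + norm x + norm v) ^ N"
proof -
  have pos: "0 < (1 + norm (z::real^'n)) ^ N" for z by (auto intro!: zero_less_power add_pos_nonneg)
  define R where "R = real CARD('n) * B * (1 + norm x + norm v) ^ N / (1 + norm y) ^ N"
  have on: "onorm (frechet_derivative f (at z)) \<le> R" if z: "z \<in> closed_segment (y - v) (y - x)" for z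
  proof (rule onorm_le)
    fix h :: "real ^ 'n"
    have lin: "linear (frechet_derivative f (at z))"
      using schwartz_has_derivative[OF f] has_derivative_linear by blast
    have "norm (y - z) \<le> norm x + norm v"
    proof -
      obtain t where t: "0 \<le> t" "t \<le> 1" "z = (1 - t) *\<^sub>R (y - v) + t *\<^sub>R (y - x)"
        using z unfolding closed_segment_def by blast
      have "y - z = (1 - t) *\<^sub>R v + t *\<^sub>R x" using t by (simp add: algebra_simps)
      then have "norm (y - z) \<le> (1 - t) * norm v + t * norm x"
        using norm_triangle_ineq[of "(1 - t) *\<^sub>R v" "t *\<^sub>R x"] t by simp
      also have "\<dots> \<le> 1 * norm v + 1 * norm x" using t by (intro add_mono mult_right_mono) auto
      finally show ?thesis by simp
    qed
    have "1 + norm y \<le> (1 + norm z) * (1 + norm (y - z))"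
      using one_plus_norm_mult[of z "y - z"] by simp
    also have "\<dots> \<le> (1 + norm z) * (1 + norm x + norm v)"
      using \<open>norm (y - z) \<le> norm x + norm v\<close> by (intro mult_left_mono) auto
    finally have "(1 + norm y) ^ N \<le> ((1 + norm z) * (1 + norm x + norm v)) ^ N"
      by (intro power_mono) auto
    then have yz: "(1 + norm y) ^ N \<le> (1 + norm z) ^ N * (1 + norm x + norm v) ^ N"
      by (simp add: power_mult_distrib)
    have pd: "norm (partial_deriv i f z) \<le> B * (1 + norm x + norm v) ^ N / (1 + norm y) ^ N" for i
    proof -
      have "norm (partial_deriv i f z) * (1 + norm y) ^ N \<le> norm (partial_deriv i f z) * ((1 + norm z) ^ N * (1 + norm x + norm v) ^ N)"
        by (intro mult_left_mono yz) auto
      also have "\<dots> = (norm (partial_deriv i f z) * (1 + norm z) ^ N) * (1 + norm x + norm v) ^ N" by simp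
      also have "\<dots> \<le> B * (1 + norm x + norm v) ^ N" by (intro mult_right_mono B) auto
      finally show ?thesis using pos[of y] by (simp add: field_simps)
    qed
    have "h = (\<Sum>i\<in>UNIV. h $ i *\<^sub>R axis i 1)" by (simp add: vec_eq_iff axis_def if_distrib cong: if_cong)
    then have "frechet_derivative f (at z) h = frechet_derivative f (at z) (\<Sum>i\<in>UNIV. h $ i *\<^sub>R axis i 1)" by metis
    also have "\<dots> = (\<Sum>i\<in>UNIV. h $ i *\<^sub>R partial_deriv i f z)"
      by (simp add: linear_sum[OF lin] linear_cmul[OF lin] partial_deriv_def)
    also have "norm \<dots> \<le> (\<Sum>i\<in>(UNIV::'n set). norm h * (B * (1 + norm x + norm v) ^ N / (1 + norm y) ^ N))"
      unfolding norm_scaleR by (intro sum_norm_le, unfold norm_scaleR real_norm_def)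
        (intro mult_mono pd component_le_norm_cart, auto)
    also have "\<dots> = R * norm h" by (simp add: R_def)
    finally show "norm (frechet_derivative f (at z) h) \<le> R * norm h" .
  qed
  have "norm (f (y - x) - f (y - v)) \<le> R * norm ((y - x) - (y - v))"
    by (rule differentiable_bound[OF convex_closed_segment, of "y - v" "y - x" f "\<lambda>z. frechet_derivative f (at z)"])
      (auto intro: on has_derivative_at_withinI schwartz_has_derivative f)
  then show ?thesis
    using pos[of y] by (simp add: R_def field_simps norm_minus_commute)
qed

text \<open>The value of \<open>u\<close> on the translate of \<open>M\<close> by x will be the
  function representing a multiplier. The growth bound lets it be paired with Schwartz functions;
  the Lipschitz bound gives its continuity and controls a discretisation of x under an
  integral.\<close>

lemma tempered_translate_bounds:
  fixes M :: "real ^ 'n::finite \<Rightarrow> complex"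
  assumes u: "u \<in> tempered" and M: "M \<in> schwartz"
  obtains A N where "A \<ge> 0" "\<And>x. norm (u (\<lambda>y. M (y - x))) \<le> A * (1 + norm x) ^ N"
    "\<And>x v. norm (u (\<lambda>y. M (y - x)) - u (\<lambda>y. M (y - v))) \<le> A * norm (x - v) * (1 + norm x + norm v) ^ N"
proof -
  obtain N C where C: "C \<ge> 0"
    "\<And>\<phi> B. \<phi> \<in> schwartz \<Longrightarrow> (\<And>is x. length is \<le> N \<Longrightarrow> norm (partial_derivs is \<phi> x) * (1 + norm x) ^ N \<le> B) \<Longrightarrow> norm (u \<phi>) \<le> C * B"
    using tempered_bound[OF u] by metis
  \<comment> \<open>One derivative more than the order \<open>N\<close> of \<open>u\<close>, because
    the Lipschitz estimate for derivatives of order up to \<open>N\<close> uses the next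
    order.\<close>
  obtain B where B: "B > 0" "\<And>is x. length is \<le> Suc N \<Longrightarrow> norm (partial_derivs is M x) * (1 + norm x) ^ N \<le> B"
    using schwartz_uniform_bound[OF M] by metis
  have T: "(\<lambda>y. M (y - x)) \<in> schwartz" for x by (rule schwartz_translate'[OF M])
  have 1: "norm (u (\<lambda>y. M (y - x))) \<le> C * (B * (1 + norm x) ^ N)" for x
  proof (rule C(2)[OF T])
    fix "is" y assume l: "length (is :: 'n list) \<le> N"
    have "1 + norm y \<le> (1 + norm (y - x)) * (1 + norm x)"
      using one_plus_norm_mult[of "y - x" x] by simp
    then have "(1 + norm y) ^ N \<le> (1 + norm (y - x)) ^ N * (1 + norm x) ^ N"
      unfolding power_mult_distrib[symmetric] by (intro power_mono) auto
    then have "norm (partial_derivs is M (y - x)) * (1 + norm y) ^ N \<le> norm (partial_derivs is M (y - x)) * ((1 + norm (y - x)) ^ N * (1 + norm x) ^ N)"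
      by (intro mult_left_mono) auto
    also have "\<dots> \<le> B * (1 + norm x) ^ N"
      unfolding mult.assoc[symmetric] using l by (intro mult_right_mono B) auto
    finally show "norm (partial_derivs is (\<lambda>y. M (y - x)) y) * (1 + norm y) ^ N \<le> B * (1 + norm x) ^ N"
      by (simp add: partial_derivs_translate[OF M])
  qed
  have 2: "norm (u (\<lambda>y. M (y - x)) - u (\<lambda>y. M (y - v))) \<le> C * (real CARD('n) * B * norm (x - v) * (1 + norm x + norm v) ^ N)" for x v
    unfolding tempered_diff[OF u T T, symmetric]
  proof (rule C(2)[OF schwartz_diff[OF T T]])
    fix "is" y assume l: "length (is :: 'n list) \<le> N"
    show "norm (partial_derivs is (\<lambda>y. M (y - x) - M (y - v)) y) * (1 + norm y) ^ N \<le> real CARD('n) * B * norm (x - v) * (1 + norm x + norm v) ^ N"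
      unfolding partial_derivs_diff[OF T T] partial_derivs_translate[OF M]
    proof (rule schwartz_lipschitz[OF schwartz_partial_derivs[OF M]])
      fix i z show "norm (partial_deriv i (partial_derivs is M) z) * (1 + norm z) ^ N \<le> B"
        using B(2)[of "i # is"] l by simp
    qed
  qed
  define A where "A = C * B + C * real CARD('n) * B"
  have A: "C * B \<le> A" "C * real CARD('n) * B \<le> A" "A \<ge> 0" using C(1) B(1) by (auto simp: A_def)
  show ?thesis
  proof (rule that[OF A(3)])
    fix x v :: "real ^ 'n"
    show "norm (u (\<lambda>y. M (y - x))) \<le> A * (1 + norm x) ^ N"
      by (rule order_trans[OF 1]) (use A in \<open>auto simp: mult.assoc[symmetric] intro!: mult_right_mono\<close>)
    show "norm (u (\<lambda>y. M (y - x)) - u (\<lambda>y. M (y - v))) \<le> A * norm (x - v) * (1 + norm x + norm v) ^ N"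
      by (rule order_trans[OF 2]) (use A in \<open>auto simp: mult.assoc[symmetric] intro!: mult_right_mono\<close>)
  qed
qed

lemma tempered_translate_continuous:
  fixes M :: "real ^ 'n::finite \<Rightarrow> complex"
  assumes u: "u \<in> tempered" and M: "M \<in> schwartz"
  shows "continuous_on UNIV (\<lambda>x. u (\<lambda>y. M (y - x)))"
proof -
  obtain A N where A: "A \<ge> 0" 
    "\<And>x v. norm (u (\<lambda>y. M (y - x)) - u (\<lambda>y. M (y - v))) \<le> A * norm (x - v) * (1 + norm x + norm v) ^ N"
    using tempered_translate_bounds[OF u M] by metis
  have "((\<lambda>x. u (\<lambda>y. M (y - x))) \<longlongrightarrow> u (\<lambda>y. M (y - v))) (at v)" for v
  proof (rule Lim_null[THEN iffD2], rule Lim_null_comparison)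
    show "\<forall>\<^sub>F x in at v. norm (u (\<lambda>y. M (y - x)) - u (\<lambda>y. M (y - v))) \<le> A * norm (x - v) * (1 + norm x + norm v) ^ N"
      using A by auto
    have "((\<lambda>x. A * norm (x - v) * (1 + norm x + norm v) ^ N) \<longlongrightarrow> A * norm (v - v) * (1 + norm v + norm v) ^ N) (at v)"
      by (intro tendsto_intros)
    then show "((\<lambda>x. A * norm (x - v) * (1 + norm x + norm v) ^ N) \<longlongrightarrow> 0) (at v)" by simp
  qed
  then show ?thesis by (simp add: continuous_on_def)
qed

lemma integral_simple_function:
  fixes \<phi> :: "real ^ 'n::finite \<Rightarrow> complex" and F :: "real ^ 'n \<Rightarrow> real ^ 'n"
  assumes "integrable lborel \<phi>" "simple_function lborel F"
  shows "(LINT x|lborel. \<phi> x * H (F x)) = (\<Sum>v\<in>range F. (LINT x|lborel. indicat_real (F -` {v}) x *\<^sub>R \<phi> x) * H v)"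
    and "integrable lborel (\<lambda>x. \<phi> x * H (F x))"
proof -
  have fin: "finite (range F)" and meas: "F -` {v} \<in> sets lborel" for v
    using simple_functionD[OF assms(2)] by auto
  have int: "integrable lborel (\<lambda>x. (indicat_real (F -` {v}) x *\<^sub>R \<phi> x) * H v)" for v
    using integrable_mult_indicator[OF meas assms(1)] by (intro integrable_mult_left) auto
  have eq: "\<phi> x * H (F x) = (\<Sum>v\<in>range F. (indicat_real (F -` {v}) x *\<^sub>R \<phi> x) * H v)" for x
  proof -
    have "(\<Sum>v\<in>range F. (indicat_real (F -` {v}) x *\<^sub>R \<phi> x) * H v) = (\<Sum>v\<in>range F. if v = F x then \<phi> x * H v else 0)"
      by (intro sum.cong) auto
    then show ?thesis using fin by simp
  qed
  show "integrable lborel (\<lambda>x. \<phi> x * H (F x))"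
    unfolding eq by (intro Bochner_Integration.integrable_sum int)
  show "(LINT x|lborel. \<phi> x * H (F x)) = (\<Sum>v\<in>range F. (LINT x|lborel. indicat_real (F -` {v}) x *\<^sub>R \<phi> x) * H v)"
    unfolding eq Bochner_Integration.integral_sum[OF int] integral_mult_left_zero ..
qed

lemma integrable_poly_growth:
  fixes \<phi> g :: "real ^ 'n::finite \<Rightarrow> complex"
  assumes "\<phi> \<in> schwartz" and [measurable]: "g \<in> borel_measurable borel" and "\<And>x. norm (g x) \<le> A * (1 + norm x) ^ N"
  shows "integrable lborel (\<lambda>x. g x * \<phi> x)"
proof (rule integrable_rapid)
  note [measurable] = schwartz_measurable[OF assms(1)]
  show "(\<lambda>x. g x * \<phi> x) \<in> borel_measurable borel" by measurable
  show "rapid (\<lambda>x. g x * \<phi> x)"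
    by (rule rapid_mono[OF schwartz_rapid[OF assms(1)], of _ A N]) (use assms(3) in \<open>auto simp: norm_mult intro!: mult_right_mono\<close>)
qed

text \<open>The integration variable is replaced by simple functions, for which the integral is a finite
  sum.\<close>

lemma tempered_integral_commute:
  fixes M :: "real ^ 'n::finite \<Rightarrow> complex"
  assumes u: "u \<in> tempered" and M: "M \<in> schwartz" and \<phi>: "\<phi> \<in> schwartz" and T: "T \<in> schwartz"
    and T_eq: "\<And>is y. partial_derivs is T y = (LINT x|lborel. \<phi> x * partial_derivs is M (y - x))"
  shows "u T = (LINT x|lborel. u (\<lambda>y. M (y - x)) * \<phi> x)"
proof -
  obtain N C where C: "C \<ge> 0"
    "\<And>\<phi> B. \<phi> \<in> schwartz \<Longrightarrow> (\<And>is x. length is \<le> N \<Longrightarrow> norm (partial_derivs is \<phi> x) * (1 + norm x) ^ N \<le> B) \<Longrightarrow> norm (u \<phi>) \<le> C * B"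
    using tempered_bound[OF u] by metis
  obtain A N' where A: "A \<ge> 0" "\<And>x. norm (u (\<lambda>y. M (y - x))) \<le> A * (1 + norm x) ^ N'"
    "\<And>x v. norm (u (\<lambda>y. M (y - x)) - u (\<lambda>y. M (y - v))) \<le> A * norm (x - v) * (1 + norm x + norm v) ^ N'"
    using tempered_translate_bounds[OF u M] by metis
  obtain B where B: "B > 0" "\<And>is x. length is \<le> Suc N \<Longrightarrow> norm (partial_derivs is M x) * (1 + norm x) ^ N \<le> B"
    using schwartz_uniform_bound[OF M] by metis
  have TM: "(\<lambda>y. M (y - x)) \<in> schwartz" for x by (rule schwartz_translate'[OF M])
  have pos: "0 < (1 + norm (z::real^'n)) ^ m" for z m by (auto intro!: zero_less_power add_pos_nonneg)
  define L where "L = max N N'"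
  define D where "D = max (real CARD('n) * B) A"
  have "D \<ge> 0" using A(1) by (auto simp: D_def)
  have [measurable]: "(\<lambda>x. u (\<lambda>y. M (y - x))) \<in> borel_measurable borel"
    using tempered_translate_continuous[OF u M] by (rule borel_measurable_continuous_onI)
  note [measurable] = schwartz_measurable[OF \<phi>]
  have meas_pd: "partial_derivs is M \<in> borel_measurable borel" for "is"
    by (rule schwartz_measurable[OF schwartz_partial_derivs[OF M]])
  have "(\<lambda>x. x) \<in> borel_measurable (lborel :: (real ^ 'n) measure)" by simp
  \<comment> \<open>The identity is approximated by simple functions. The bound |F i x| \<le> 2 |x|
    lets one integrable function dominate all the errors.\<close>
  from borel_measurable_implies_sequence_metric[OF this, of 0]
  obtain F :: "nat \<Rightarrow> real ^ 'n \<Rightarrow> real ^ 'n" where F: "\<And>i. simple_function lborel (F i)"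
    "\<And>x. (\<lambda>i. F i x) \<longlonglongrightarrow> x" "\<And>i x. norm (F i x) \<le> 2 * norm x"
    by auto
  have [measurable]: "F i \<in> borel_measurable borel" for i
    using borel_measurable_simple_function[OF F(1)] by simp
  \<comment> \<open>\<open>b i\<close> majorises both errors of replacing x by \<open>F i x\<close>:
    in the weighted derivatives of \<open>T\<close>, and in the pairing of \<phi> with the values of
    \<open>u\<close> on translates of \<open>M\<close>. \<open>bb\<close> majorises all
    \<open>b i\<close> at once.\<close>
  define b where "b i x = norm (\<phi> x) * (D * norm (x - F i x) * (1 + norm x + norm (F i x)) ^ L)" for i x
  define bb where "bb x = \<phi> x * complex_of_real (D * (3 * norm x) * (1 + 3 * norm x) ^ L)" for x
  have bb: "integrable lborel bb"
  proof (rule integrable_rapid)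
    show "rapid bb"
    proof (rule rapid_mono[OF schwartz_rapid[OF \<phi>], of _ "D * 3 * 3 ^ L" "Suc L"])
      fix x :: "real ^ 'n"
      have "norm (bb x) = D * (3 * norm x) * (1 + 3 * norm x) ^ L * norm (\<phi> x)"
        using \<open>D \<ge> 0\<close> by (auto simp: bb_def norm_mult simp del: of_real_mult of_real_power of_real_add)
      also have "\<dots> \<le> D * (3 * (1 + norm x)) * (3 * (1 + norm x)) ^ L * norm (\<phi> x)"
        using \<open>D \<ge> 0\<close> by (intro mult_right_mono mult_mono power_mono mult_left_mono) auto
      also have "\<dots> = D * 3 * 3 ^ L * (1 + norm x) ^ Suc L * norm (\<phi> x)"
        by (simp only: power_mult_distrib power_Suc mult_ac)
      finally show "norm (bb x) \<le> D * 3 * 3 ^ L * (1 + norm x) ^ Suc L * norm (\<phi> x)" .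
    qed
    show "bb \<in> borel_measurable borel" unfolding bb_def by measurable
  qed
  have b_le: "norm (b i x) \<le> norm (bb x)" for i x
  proof -
    have "norm (x - F i x) \<le> 3 * norm x" using norm_triangle_ineq4[of x "F i x"] F(3)[of i x] by simp
    moreover have "1 + norm x + norm (F i x) \<le> 1 + 3 * norm x" using F(3)[of i x] by simp
    ultimately have "norm (\<phi> x) * (D * norm (x - F i x) * (1 + norm x + norm (F i x)) ^ L) \<le>
       norm (\<phi> x) * (D * (3 * norm x) * (1 + 3 * norm x) ^ L)"
      using \<open>D \<ge> 0\<close> by (intro mult_left_mono mult_mono power_mono) auto
    then show ?thesis using \<open>D \<ge> 0\<close> by (auto simp: b_def bb_def norm_mult abs_mult simp del: of_real_mult of_real_power of_real_add)
  qed
  have [measurable]: "b i \<in> borel_measurable lborel" for i unfolding b_def by measurable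
  have bi: "integrable lborel (b i)" for i
    by (rule Bochner_Integration.integrable_bound[OF bb]) (use b_le in auto)
  have "(\<lambda>i. integral\<^sup>L lborel (b i)) \<longlonglongrightarrow> (LINT x::real^'n|lborel. 0)"
  proof (rule integral_dominated_convergence[where w="\<lambda>x. norm (bb x)"])
    have "(\<lambda>i. b i x) \<longlonglongrightarrow> norm (\<phi> x) * (D * norm (x - x) * (1 + norm x + norm x) ^ L)" for x
      unfolding b_def by (intro tendsto_intros F(2))
    then show "AE x in lborel. (\<lambda>i. b i x) \<longlonglongrightarrow> 0" by simp
  qed (use bb b_le in auto)
  then have lim: "(\<lambda>i. integral\<^sup>L lborel (b i)) \<longlonglongrightarrow> 0" by simp
  have mono_pow: "K * z * (1 + norm x + norm v) ^ m \<le> D * z * (1 + norm x + norm v) ^ L"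
    if "K \<le> D" "m \<le> L" "z \<ge> 0" for K z m and x v :: "real ^ 'n"
    using that \<open>D \<ge> 0\<close> by (intro mult_mono power_increasing) auto
  have est: "norm (u T - (LINT x|lborel. u (\<lambda>y. M (y - x)) * \<phi> x)) \<le> (C + 1) * integral\<^sup>L lborel (b i)" for i
  proof -
    define w where "w v = (LINT x|lborel. indicat_real (F i -` {v}) x *\<^sub>R \<phi> x)" for v
    define Ti where "Ti y = (\<Sum>v\<in>range (F i). w v * M (y - v))" for y
    have fin: "finite (range (F i))" using simple_functionD[OF F(1)] by auto
    have Ti: "Ti \<in> schwartz" unfolding Ti_def by (intro schwartz_sum schwartz_cmult TM)
    have sum_eq: "(\<Sum>v\<in>range (F i). w v * H v) = (LINT x|lborel. \<phi> x * H (F i x))" for H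
      unfolding w_def integral_simple_function(1)[OF schwartz_integrable[OF \<phi>] F(1)] ..
    have pTi: "partial_derivs is Ti y = (LINT x|lborel. \<phi> x * partial_derivs is M (y - F i x))" for "is" y
      unfolding Ti_def by (subst partial_derivs_sum[OF fin TM]) (simp add: partial_derivs_translate[OF M] sum_eq)
    have uTi: "u Ti = (LINT x|lborel. u (\<lambda>y. M (y - F i x)) * \<phi> x)"
      unfolding Ti_def tempered_sum[OF u TM] sum_eq[of "\<lambda>v. u (\<lambda>y. M (y - v))"] by (simp add: mult.commute)
    \<comment> \<open>Here the continuity of \<open>u\<close> enters: the derivatives of
      \<open>T - Ti\<close> are integrals of differences of translates of derivatives of
      \<open>M\<close>.\<close>
    have "norm (u T - u Ti) \<le> C * integral\<^sup>L lborel (b i)"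
      unfolding tempered_diff[OF u T Ti, symmetric]
    proof (rule C(2)[OF schwartz_diff[OF T Ti]])
      fix "is" y assume l: "length (is :: 'n list) \<le> N"
      obtain Q where Q: "\<And>x. norm (partial_derivs is M x) \<le> Q"
        using schwartz_bounded[OF schwartz_partial_derivs[OF M]] by metis
      have i1: "integrable lborel (\<lambda>x. \<phi> x * partial_derivs is M (y - x))"
        using integrable_poly_growth[OF \<phi>, of "\<lambda>x. partial_derivs is M (y - x)" Q 0] Q meas_pd by (simp add: mult.commute)
      have "partial_derivs is (\<lambda>y. T y - Ti y) y = (LINT x|lborel. \<phi> x * partial_derivs is M (y - x) - \<phi> x * partial_derivs is M (y - F i x))"
        unfolding partial_derivs_diff[OF T Ti] T_eq pTi
        using i1 integral_simple_function(2)[OF schwartz_integrable[OF \<phi>] F(1), of "\<lambda>v. partial_derivs is M (y - v)"] by simp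
      then have "norm (partial_derivs is (\<lambda>y. T y - Ti y) y) * (1 + norm y) ^ N =
        norm (LINT x|lborel. (\<phi> x * partial_derivs is M (y - x) - \<phi> x * partial_derivs is M (y - F i x)) * of_real ((1 + norm y) ^ N))"
        by (simp add: norm_mult norm_power del: of_real_power of_real_add)
      also have "\<dots> \<le> integral\<^sup>L lborel (b i)"
      proof (rule norm_lebesgue_integral_le[OF bi])
        fix x
        have "norm ((\<phi> x * partial_derivs is M (y - x) - \<phi> x * partial_derivs is M (y - F i x)) * of_real ((1 + norm y) ^ N))
          = norm (\<phi> x) * (norm (partial_derivs is M (y - x) - partial_derivs is M (y - F i x)) * (1 + norm y) ^ N)"
          by (simp add: norm_mult right_diff_distrib[symmetric] del: of_real_power of_real_add)
        also have "\<dots> \<le> norm (\<phi> x) * (real CARD('n) * B * norm (x - F i x) * (1 + norm x + norm (F i x)) ^ N)"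
        proof (intro mult_left_mono schwartz_lipschitz[OF schwartz_partial_derivs[OF M]])
          fix j z show "norm (partial_deriv j (partial_derivs is M) z) * (1 + norm z) ^ N \<le> B"
            using B(2)[of "j # is"] l by simp
        qed auto
        also have "\<dots> \<le> b i x"
          unfolding b_def by (intro mult_left_mono mono_pow) (auto simp: D_def L_def)
        finally show "norm ((\<phi> x * partial_derivs is M (y - x) - \<phi> x * partial_derivs is M (y - F i x)) * of_real ((1 + norm y) ^ N)) \<le> b i x" .
      qed
      finally show "norm (partial_derivs is (\<lambda>y. T y - Ti y) y) * (1 + norm y) ^ N \<le> integral\<^sup>L lborel (b i)" .
    qed
    moreover have "norm (u Ti - (LINT x|lborel. u (\<lambda>y. M (y - x)) * \<phi> x)) \<le> integral\<^sup>L lborel (b i)"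
    proof -
      have i1: "integrable lborel (\<lambda>x. u (\<lambda>y. M (y - x)) * \<phi> x)"
        by (rule integrable_poly_growth[OF \<phi> _ A(2)]) measurable
      have i2: "integrable lborel (\<lambda>x. u (\<lambda>y. M (y - F i x)) * \<phi> x)"
        using integral_simple_function(2)[OF schwartz_integrable[OF \<phi>] F(1), of "\<lambda>v. u (\<lambda>y. M (y - v))"] by (simp add: mult.commute)
      have "u Ti - (LINT x|lborel. u (\<lambda>y. M (y - x)) * \<phi> x) = (LINT x|lborel. u (\<lambda>y. M (y - F i x)) * \<phi> x - u (\<lambda>y. M (y - x)) * \<phi> x)"
        unfolding uTi using i1 i2 by simp
      also have "norm \<dots> \<le> integral\<^sup>L lborel (b i)"
      proof (rule norm_lebesgue_integral_le[OF bi])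
        fix x
        have "norm (u (\<lambda>y. M (y - F i x)) * \<phi> x - u (\<lambda>y. M (y - x)) * \<phi> x) = norm (\<phi> x) * norm (u (\<lambda>y. M (y - x)) - u (\<lambda>y. M (y - F i x)))"
          by (simp add: norm_mult norm_minus_commute left_diff_distrib[symmetric])
        also have "\<dots> \<le> norm (\<phi> x) * (A * norm (x - F i x) * (1 + norm x + norm (F i x)) ^ N')"
          by (intro mult_left_mono A) auto
        also have "\<dots> \<le> b i x"
          unfolding b_def by (intro mult_left_mono mono_pow) (auto simp: D_def L_def)
        finally show "norm (u (\<lambda>y. M (y - F i x)) * \<phi> x - u (\<lambda>y. M (y - x)) * \<phi> x) \<le> b i x" .
      qed
      finally show ?thesis .
    qed
    ultimately show ?thesis
      using norm_triangle_ineq[of "u T - u Ti" "u Ti - (LINT x|lborel. u (\<lambda>y. M (y - x)) * \<phi> x)"]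
      by (simp add: algebra_simps)
  qed
  have "(\<lambda>i. (C + 1) * integral\<^sup>L lborel (b i)) \<longlonglongrightarrow> (C + 1) * 0" by (intro tendsto_intros lim)
  then have "norm (u T - (LINT x|lborel. u (\<lambda>y. M (y - x)) * \<phi> x)) \<le> (C + 1) * 0"
    by (rule LIMSEQ_le_const) (use est in auto)
  then show ?thesis by simp
qed

section \<open>Representation of multipliers by functions\<close>

definition monomial :: "'n::finite list \<Rightarrow> real ^ 'n \<Rightarrow> complex" where
  "monomial is x = (\<Prod>i\<leftarrow>is. - 2 * pi * \<i> * of_real (x $ i))"

lemma schwartz_monomial_mult:
  "f \<in> schwartz \<Longrightarrow> (\<lambda>x. monomial is x * f x) \<in> schwartz"
proof (induction "is")
  case (Cons i "is")
  then have "(\<lambda>x. - 2 * pi * \<i> * (of_real (x $ i) * (monomial is x * f x))) \<in> schwartz"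
    by (intro schwartz_cmult schwartz_mult_coord) auto
  then show ?case by (simp add: monomial_def mult_ac)
qed (simp add: monomial_def)

lemma partial_derivs_fourier:
  assumes "f \<in> schwartz"
  shows "partial_derivs is (fourier f) = fourier (\<lambda>x. monomial is x * f x)"
proof (induction "is")
  case (Cons i "is")
  have "partial_derivs (i # is) (fourier f) = fourier (\<lambda>x. - 2 * pi * \<i> * (of_real (x $ i) * (monomial is x * f x)))"
    by (simp only: partial_derivs_simps Cons partial_deriv_fourier[OF schwartz_monomial_mult[OF assms]])
  then show ?case by (simp add: monomial_def mult_ac)
qed (simp add: monomial_def)

text \<open>Fubini replaces the inner transform by an average of translates of
  \<open>fourier m\<close>, the shape in which \<open>u\<close> can be made to act under the
  integral.\<close>

lemma fourier_mult_inv_fourier: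
  fixes m \<phi> :: "real ^ 'n::finite \<Rightarrow> complex"
  assumes "m \<in> schwartz" "\<phi> \<in> schwartz"
  shows "fourier (\<lambda>\<xi>. m \<xi> * inv_fourier \<phi> \<xi>) y = (LINT x|lborel. \<phi> x * fourier m (y - x))"
proof -
  have 1: "unit_char (- (\<xi> \<bullet> y)) * (m \<xi> * inv_fourier \<phi> \<xi>) = (unit_char ((- y) \<bullet> \<xi>) * m \<xi>) * (LINT x|lborel. \<phi> x * unit_char (fst (\<xi>, x) \<bullet> snd (\<xi>, x)))" for \<xi>
    by (simp only: inv_fourier_eq mult.commute[of "\<phi> _"] inner_minus_left inner_commute[of y] mult.assoc fst_conv snd_conv)
  have 2: "(unit_char ((- y) \<bullet> \<xi>) * m \<xi>) * unit_char (fst (\<xi>, x) \<bullet> snd (\<xi>, x)) = unit_char (- (\<xi> \<bullet> (y - x))) * m \<xi>" for x \<xi>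
  proof -
    have "unit_char (- (\<xi> \<bullet> (y - x))) = unit_char ((- y) \<bullet> \<xi>) * unit_char (\<xi> \<bullet> x)"
      unfolding unit_char_add[symmetric] by (simp add: inner_diff_right inner_commute)
    then show ?thesis by simp
  qed
  have "fourier (\<lambda>\<xi>. m \<xi> * inv_fourier \<phi> \<xi>) y = (LINT \<xi>|lborel. (unit_char ((- y) \<bullet> \<xi>) * m \<xi>) * (LINT x|lborel. \<phi> x * unit_char (fst (\<xi>, x) \<bullet> snd (\<xi>, x))))"
    unfolding fourier_eq 1 ..
  also have "\<dots> = (LINT x|lborel. \<phi> x * (LINT \<xi>|lborel. (unit_char ((- y) \<bullet> \<xi>) * m \<xi>) * unit_char (fst (\<xi>, x) \<bullet> snd (\<xi>, x))))"
    by (rule Fubini_bounded_kernel[where B=1]) (auto intro!: schwartz_integrable schwartz_modulate assms simp del: inner_minus_left)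
  also have "\<dots> = (LINT x|lborel. \<phi> x * fourier m (y - x))"
    unfolding fourier_eq 2 ..
  finally show ?thesis .
qed

lemma fourier_multiplier_eq:
  fixes m \<phi> :: "real ^ 'n::finite \<Rightarrow> complex"
  assumes u: "u \<in> tempered" and m: "m \<in> schwartz" and \<phi>: "\<phi> \<in> schwartz"
  shows "fourier_multiplier m u \<phi> = u (fourier (\<lambda>\<xi>. m \<xi> * inv_fourier \<phi> \<xi>))"
  unfolding fourier_multiplier_def dist_inv_fourier_def dist_mult_def dist_fourier_def
  using \<phi> inv_fourier_schwartz[OF \<phi>] schwartz_mult[OF m inv_fourier_schwartz[OF \<phi>]] by simp

text \<open>A derivative of the test function on which \<open>u\<close> acts amounts to multiplying
  the symbol by a monomial, so the convolution identity for that product supplies the derivative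
  hypothesis of \<open>tempered_integral_commute\<close>.\<close>

lemma fourier_multiplier_integral:
  fixes m \<phi> :: "real ^ 'n::finite \<Rightarrow> complex"
  assumes u: "u \<in> tempered" and m: "m \<in> schwartz" and \<phi>: "\<phi> \<in> schwartz"
  shows "fourier_multiplier m u \<phi> = (LINT x|lborel. u (\<lambda>y. fourier m (y - x)) * \<phi> x)"
  unfolding fourier_multiplier_eq[OF assms]
proof (rule tempered_integral_commute[OF u fourier_schwartz[OF m] \<phi>])
  show "fourier (\<lambda>\<xi>. m \<xi> * inv_fourier \<phi> \<xi>) \<in> schwartz"
    by (intro fourier_schwartz schwartz_mult m inv_fourier_schwartz \<phi>)
  fix "is" y
  have "partial_derivs is (fourier (\<lambda>\<xi>. m \<xi> * inv_fourier \<phi> \<xi>)) = fourier (\<lambda>\<xi>. (monomial is \<xi> * m \<xi>) * inv_fourier \<phi> \<xi>)"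
    by (subst partial_derivs_fourier) (auto intro!: schwartz_mult m inv_fourier_schwartz \<phi> simp: mult.assoc)
  then show "partial_derivs is (fourier (\<lambda>\<xi>. m \<xi> * inv_fourier \<phi> \<xi>)) y = (LINT x|lborel. \<phi> x * partial_derivs is (fourier m) (y - x))"
    by (simp add: fourier_mult_inv_fourier[OF schwartz_monomial_mult[OF m] \<phi>] partial_derivs_fourier[OF m])
qed

section \<open>Fourier inversion up to a constant, and uniqueness of the representing
  function\<close>

locale triebel =
  fixes \<psi> :: "real ^ 'n::finite \<Rightarrow> real"
  assumes window: "triebel_window \<psi>"
begin

definition psi :: "real ^ 'n \<Rightarrow> complex" where "psi \<xi> = of_real (\<psi> \<xi>)"

lemma psi_props:
  "\<psi> \<xi> \<ge> 0" "\<psi> \<xi> \<le> 1" "norm \<xi> \<le> 1 \<Longrightarrow> \<psi> \<xi> = 1" "norm \<xi> \<ge> 2 \<Longrightarrow> \<psi> \<xi> = 0" "\<psi> (- \<xi>) = \<psi> \<xi>"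
proof -
  show "\<psi> \<xi> \<ge> 0" "\<psi> \<xi> \<le> 1"
    using window unfolding triebel_window_def atLeastAtMost_iff by blast+
  show "norm \<xi> \<le> 1 \<Longrightarrow> \<psi> \<xi> = 1" "norm \<xi> \<ge> 2 \<Longrightarrow> \<psi> \<xi> = 0"
    using window unfolding triebel_window_def by blast+
  show "\<psi> (- \<xi>) = \<psi> \<xi>"
    using window norm_minus_cancel unfolding triebel_window_def by blast
qed

lemma psi_schwartz: "psi \<in> schwartz"
proof -
  have "smooth \<psi>" using window by (simp only: triebel_window_def)
  then have "smooth psi" unfolding psi_def[abs_def] by (rule smooth_of_real)
  then show ?thesis by (rule schwartz_compact_support[of _ 2]) (simp add: psi_def psi_props(4))
qed

lemma continuous_on_psi: "continuous_on UNIV \<psi>"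
proof -
  have "continuous_on UNIV (\<lambda>\<xi>. Re (psi \<xi>))"
    by (intro continuous_intros schwartz_continuous psi_schwartz)
  then show ?thesis by (simp add: psi_def)
qed

text \<open>With the normalisation of \<^const>\<open>fourier\<close> the value is 1, but only \<open>inversion_const \<noteq> 0\<close> matters
  below, and this avoids the Fourier transform of the Gaussian.\<close>

definition inversion_const :: complex where "inversion_const = (LINT x|lborel. fourier psi x)"

text \<open>A dilate of psi by \<epsilon> is inserted and the transform moved onto it; after
  rescaling, the dilation sits on \<eta> instead. As \<epsilon> tends to 0, one side becomes the
  integral of the transform of \<eta>, since psi is 1 at 0, and the other \<eta>(0) times the
  integral of the transform of psi.\<close>

lemma integral_fourier:
  fixes \<eta> :: "real ^ 'n \<Rightarrow> complex"
  assumes "\<eta> \<in> schwartz" shows "(LINT \<xi>|lborel. fourier \<eta> \<xi>) = inversion_const * \<eta> 0"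
proof -
  define \<epsilon> where "\<epsilon> m = inverse (real (Suc m))" for m
  have e: "\<epsilon> m > 0" for m by (simp add: \<epsilon>_def)
  have e0: "\<epsilon> \<longlonglongrightarrow> 0" unfolding \<epsilon>_def by (rule LIMSEQ_inverse_real_of_nat)
  note S = psi_schwartz assms fourier_schwartz[OF psi_schwartz] fourier_schwartz[OF assms]
  note [measurable] = S[THEN schwartz_measurable]
  obtain B where B: "\<And>x. norm (\<eta> x) \<le> B" using schwartz_bounded[OF assms] by metis
  have lr: "(LINT \<xi>|lborel. fourier \<eta> \<xi> * psi (\<epsilon> m *\<^sub>R \<xi>)) = (LINT z|lborel. \<eta> (\<epsilon> m *\<^sub>R z) * fourier psi z)" for m
  proof -
    have "(LINT \<xi>|lborel. fourier \<eta> \<xi> * psi (\<epsilon> m *\<^sub>R \<xi>)) = (LINT \<xi>|lborel. \<eta> \<xi> * fourier (\<lambda>\<xi>. psi (\<epsilon> m *\<^sub>R \<xi>)) \<xi>)"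
      using e[of m] by (intro fourier_multiplication schwartz_integrable schwartz_scale S) auto
    also have "\<dots> = (LINT \<xi>|lborel. \<eta> \<xi> * (of_real ((1 / \<epsilon> m) ^ CARD('n)) * fourier psi ((1 / \<epsilon> m) *\<^sub>R \<xi>)))"
      by (simp only: fourier_scale[OF e])
    also have "\<dots> = \<bar>\<epsilon> m\<bar> ^ DIM(real ^ 'n) *\<^sub>R (LINT z|lborel. \<eta> (0 + \<epsilon> m *\<^sub>R z) * (of_real ((1 / \<epsilon> m) ^ CARD('n)) * fourier psi ((1 / \<epsilon> m) *\<^sub>R (0 + \<epsilon> m *\<^sub>R z))))"
      using e[of m] by (intro lborel_integral_affine) auto
    also have "\<dots> = \<epsilon> m ^ CARD('n) *\<^sub>R (LINT z|lborel. of_real ((1 / \<epsilon> m) ^ CARD('n)) * (\<eta> (\<epsilon> m *\<^sub>R z) * fourier psi z))"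
      using e[of m] by (simp add: mult.left_commute)
    also have "\<dots> = (LINT z|lborel. \<eta> (\<epsilon> m *\<^sub>R z) * fourier psi z)"
      using e[of m] by (simp add: scaleR_conv_of_real power_divide)
    finally show ?thesis .
  qed
  have "(\<lambda>m. LINT \<xi>|lborel. fourier \<eta> \<xi> * psi (\<epsilon> m *\<^sub>R \<xi>)) \<longlonglongrightarrow> (LINT \<xi>|lborel. fourier \<eta> \<xi> * psi (0 *\<^sub>R \<xi>))"
  proof (rule integral_dominated_convergence[where w="\<lambda>\<xi>. norm (fourier \<eta> \<xi>)"])
    show "AE \<xi> in lborel. (\<lambda>m. fourier \<eta> \<xi> * psi (\<epsilon> m *\<^sub>R \<xi>)) \<longlonglongrightarrow> fourier \<eta> \<xi> * psi (0 *\<^sub>R \<xi>)"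
      using schwartz_continuous[OF psi_schwartz] e0
      by (intro always_eventually allI tendsto_mult tendsto_const continuous_on_tendsto_compose[of UNIV psi] tendsto_scaleR) auto
    show "AE \<xi> in lborel. norm (fourier \<eta> \<xi> * psi (\<epsilon> m *\<^sub>R \<xi>)) \<le> norm (fourier \<eta> \<xi>)" for m
      using psi_props(1,2) by (auto simp: norm_mult psi_def intro!: mult_left_le)
  qed (auto intro!: schwartz_integrable S integrable_norm)
  moreover have "(\<lambda>m. LINT z|lborel. \<eta> (\<epsilon> m *\<^sub>R z) * fourier psi z) \<longlonglongrightarrow> (LINT z|lborel. \<eta> (0 *\<^sub>R z) * fourier psi z)"
  proof (rule integral_dominated_convergence[where w="\<lambda>z. B * norm (fourier psi z)"])
    show "AE z in lborel. (\<lambda>m. \<eta> (\<epsilon> m *\<^sub>R z) * fourier psi z) \<longlonglongrightarrow> \<eta> (0 *\<^sub>R z) * fourier psi z"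
      using schwartz_continuous[OF assms] e0
      by (intro always_eventually allI tendsto_mult tendsto_const continuous_on_tendsto_compose[of UNIV \<eta>] tendsto_scaleR) auto
    show "AE z in lborel. norm (\<eta> (\<epsilon> m *\<^sub>R z) * fourier psi z) \<le> B * norm (fourier psi z)" for m
      using B by (auto simp: norm_mult intro!: mult_right_mono)
  qed (auto intro!: schwartz_integrable S integrable_norm integrable_mult_right)
  ultimately have "(LINT \<xi>|lborel. fourier \<eta> \<xi> * psi (0 *\<^sub>R \<xi>)) = (LINT z|lborel. \<eta> (0 *\<^sub>R z) * fourier psi z)"
    unfolding lr by (rule LIMSEQ_unique)
  moreover have "psi 0 = 1" using psi_props(3)[of 0] by (simp add: psi_def)
  ultimately show ?thesis by (simp add: inversion_const_def mult.commute)
qed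

lemma fourier_inversion:
  fixes \<eta> :: "real ^ 'n \<Rightarrow> complex"
  assumes "\<eta> \<in> schwartz" shows "inv_fourier (fourier \<eta>) x = inversion_const * \<eta> x"
proof -
  have "inv_fourier (fourier \<eta>) x = (LINT \<xi>|lborel. fourier (\<lambda>y. \<eta> (y + x)) \<xi>)"
    by (simp add: inv_fourier_eq fourier_translate)
  also have "\<dots> = inversion_const * \<eta> (0 + x)"
    by (rule integral_fourier[OF schwartz_translate[OF assms]])
  finally show ?thesis by simp
qed

text \<open>The window is real and, being radial, even.\<close>

lemma fourier_psi_real: "cnj (fourier psi x) = fourier psi x"
proof -
  have "cnj (fourier psi x) = (LINT \<xi>|lborel. cnj (unit_char (- (\<xi> \<bullet> x)) * psi \<xi>))"
    unfolding fourier_eq by (rule Bochner_Integration.integral_cnj[symmetric])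
  also have "\<dots> = (LINT \<xi>|lborel. unit_char (\<xi> \<bullet> x) * psi \<xi>)" by (simp add: psi_def)
  also have "\<dots> = (LINT \<xi>|lborel. unit_char ((0 - \<xi>) \<bullet> x) * psi (0 - \<xi>))"
    by (rule lborel_integral_reflect[symmetric])
  also have "\<dots> = fourier psi x" by (simp add: fourier_eq psi_def psi_props(5))
  finally show ?thesis .
qed

lemma fourier_psi_0: "Re (fourier psi 0) > 0"
proof -
  have "integrable lborel \<psi>"
    using integrable_Re[OF schwartz_integrable[OF psi_schwartz]] by (simp add: psi_def)
  then have "(LINT \<xi>|lborel. \<psi> \<xi>) > 0"
    using psi_props continuous_on_psi by (intro integral_pos_continuous[of _ 0]) auto
  then show ?thesis by (simp add: fourier_eq psi_def)
qed

text \<open>If the constant were zero, the double transform of psi would vanish, and by the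
  multiplication formula so would the integral of the square of its transform. That square is
  nonnegative because the transform is real, and positive at 0, where the transform is the integral
  of \<psi>.\<close>

lemma inversion_const_nonzero: "inversion_const \<noteq> 0"
proof
  assume "inversion_const = 0"
  define f where "f x = (Re (fourier psi x))\<^sup>2" for x
  have eq: "fourier psi x * fourier psi x = of_real (f x)" for x
    using fourier_psi_real[of x] by (simp add: f_def complex_eq_iff power2_eq_square)
  have int: "integrable lborel (\<lambda>x. fourier psi x * fourier psi x)"
    by (intro schwartz_integrable schwartz_mult fourier_schwartz psi_schwartz)
  have "(LINT x|lborel. fourier psi x * fourier psi x) = (LINT x|lborel. psi x * fourier (fourier psi) x)"
    by (intro fourier_multiplication schwartz_integrable fourier_schwartz psi_schwartz)
  also have "\<dots> = 0"
    using fourier_inversion[OF psi_schwartz, of "- _"] \<open>inversion_const = 0\<close> by (simp add: inv_fourier_fourier)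
  finally have "(LINT x|lborel. f x) = 0" unfolding eq by (simp del: of_real_power)
  moreover have "(LINT x|lborel. f x) > 0"
  proof (rule integral_pos_continuous[of _ 0])
    show "continuous_on UNIV f"
      unfolding f_def by (intro continuous_intros schwartz_continuous fourier_schwartz psi_schwartz)
    show "integrable lborel f" using integrable_Re[OF int] unfolding eq by simp
    show "f 0 > 0" using fourier_psi_0 by (simp add: f_def)
  qed (simp add: f_def)
  ultimately show False by simp
qed

text \<open>If \<open>d a\<close> were nonzero, a bump concentrated where the real part of cnj (d a)
  d(x) is positive would detect it. This is the uniqueness behind the definite description in
  \<open>dist_function\<close>.\<close>

lemma continuous_eq_zero:
  fixes d :: "real ^ 'n \<Rightarrow> complex"
  assumes cont: "continuous_on UNIV d" and int: "\<And>\<phi>. \<phi> \<in> schwartz \<Longrightarrow> integrable lborel (\<lambda>x. d x * \<phi> x)"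
    and zero: "\<And>\<phi>. \<phi> \<in> schwartz \<Longrightarrow> (LINT x|lborel. d x * \<phi> x) = 0"
  shows "d a = 0"
proof (rule ccontr)
  assume "d a \<noteq> 0"
  define g where "g x = Re (cnj (d a) * d x)" for x
  have gc: "continuous_on UNIV g" unfolding g_def by (intro continuous_intros cont)
  have ga: "g a > 0" using \<open>d a \<noteq> 0\<close> by (simp add: g_def power2_eq_square[symmetric] sum_power2_gt_zero_iff complex_eq_iff)
  obtain e where e: "e > 0" "\<And>x. dist x a < e \<Longrightarrow> g x > 0"
  proof -
    have "isCont g a" using gc continuous_on_eq_continuous_at open_UNIV by blast
    then obtain e where "e > 0" "\<And>x. dist x a < e \<Longrightarrow> dist (g x) (g a) < g a"
      using ga unfolding continuous_at_eps_delta by blast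
    then show ?thesis using that by (force simp: dist_real_def)
  qed
  \<comment> \<open>\<psi> vanishes from radius 2 on, so the dilation by 2 / e confines the bump to
    the ball of radius e on which \<open>g\<close> is positive.\<close>
  define \<phi> where "\<phi> x = psi ((2 / e) *\<^sub>R x + (- (2 / e) *\<^sub>R a))" for x
  define p where "p x = \<psi> ((2 / e) *\<^sub>R x + (- (2 / e) *\<^sub>R a))" for x
  have \<phi>: "\<phi> \<in> schwartz" unfolding \<phi>_def using e by (intro schwartz_affine psi_schwartz) auto
  have eq: "g x * p x = Re (cnj (d a) * (d x * \<phi> x))" for x
    by (simp add: g_def \<phi>_def p_def psi_def mult.assoc[symmetric])
  have "(LINT x|lborel. g x * p x) > 0"
  proof (rule integral_pos_continuous[of _ a])
    show "continuous_on UNIV (\<lambda>x. g x * p x)"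
      unfolding p_def by (intro continuous_intros gc continuous_on_compose2[OF continuous_on_psi]) auto
    show "integrable lborel (\<lambda>x. g x * p x)"
      unfolding eq by (intro integrable_Re integrable_mult_right int \<phi>)
    show "g a * p a > 0" using ga psi_props(3)[of 0] by (simp add: p_def)
    show "g x * p x \<ge> 0" for x
    proof (cases "dist x a < e")
      case True then show ?thesis using e(2)[of x] psi_props(1) by (simp add: p_def)
    next
      case False
      have "(2 / e) *\<^sub>R x + (- (2 / e) *\<^sub>R a) = (2 / e) *\<^sub>R (x - a)" by (simp add: algebra_simps)
      then have "norm ((2 / e) *\<^sub>R x + (- (2 / e) *\<^sub>R a)) = (2 / e) * dist x a" using e(1) by (simp add: dist_norm)
      moreover have "2 \<le> (2 / e) * dist x a" using False e(1) by (simp add: field_simps)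
      ultimately have "p x = 0" unfolding p_def by (intro psi_props(4)) linarith
      then show ?thesis by simp
    qed
  qed
  moreover have "(LINT x|lborel. g x * p x) = Re (cnj (d a) * (LINT x|lborel. d x * \<phi> x))"
  proof -
    have "(LINT x|lborel. g x * p x) = Re (LINT x|lborel. cnj (d a) * (d x * \<phi> x))"
      unfolding eq by (rule integral_Re[symmetric] integral_Re) (intro integrable_mult_right int \<phi>)
    then show ?thesis by (simp only: integral_mult_right_zero)
  qed
  ultimately show False using zero[OF \<phi>] by simp
qed

text \<open>Evaluates the definite description: existence is the integral representation of the
  multiplier, uniqueness the vanishing criterion for continuous functions. From here on the pieces
  of \<open>u\<close> are explicit functions.\<close>

lemma dist_function_multiplier:
  fixes u :: "'n functional"
  assumes u: "u \<in> tempered" and m: "m \<in> schwartz"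
  shows "dist_function (fourier_multiplier m u) = (\<lambda>x. u (\<lambda>y. fourier m (y - x)))" (is "_ = ?G")
  unfolding dist_function_def
proof (rule the_equality)
  have M: "fourier m \<in> schwartz" by (rule fourier_schwartz[OF m])
  obtain A N where A: "A \<ge> 0" "\<And>x. norm (?G x) \<le> A * (1 + norm x) ^ N"
    using tempered_translate_bounds[OF u M] by metis
  have cont: "continuous_on UNIV ?G" by (rule tempered_translate_continuous[OF u M])
  have int: "integrable lborel (\<lambda>x. ?G x * \<phi> x)" if "\<phi> \<in> schwartz" for \<phi>
    by (rule integrable_poly_growth[OF that borel_measurable_continuous_onI[OF cont] A(2)])
  show "continuous_on UNIV ?G \<and> (\<forall>\<phi>\<in>schwartz. integrable lborel (\<lambda>x. ?G x * \<phi> x) \<and>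
      fourier_multiplier m u \<phi> = (LINT x|lborel. ?G x * \<phi> x))"
    using cont int fourier_multiplier_integral[OF u m] by blast
  fix g assume g: "continuous_on UNIV g \<and> (\<forall>\<phi>\<in>schwartz. integrable lborel (\<lambda>x. g x * \<phi> x) \<and>
      fourier_multiplier m u \<phi> = (LINT x|lborel. g x * \<phi> x))"
  have "g x - ?G x = 0" for x
  proof (rule continuous_eq_zero[of "\<lambda>x. g x - ?G x"])
    show "continuous_on UNIV (\<lambda>x. g x - ?G x)" using g cont by (intro continuous_intros) auto
    fix \<phi> :: "real ^ 'n \<Rightarrow> complex" assume \<phi>: "\<phi> \<in> schwartz"
    show "integrable lborel (\<lambda>x. (g x - ?G x) * \<phi> x)"
      unfolding left_diff_distrib using g int \<phi> by auto
    show "(LINT x|lborel. (g x - ?G x) * \<phi> x) = 0"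
      unfolding left_diff_distrib using g int \<phi> fourier_multiplier_integral[OF u m \<phi>] by auto
  qed
  then show "g = ?G" by auto
qed

end

section \<open>Band-limited functions\<close>

lemma one_plus_norm_diff:
  "1 + norm (a - c) \<le> (1 + norm (a - b)) * (1 + norm (b - (c :: 'a::real_normed_vector)))"
  using one_plus_norm_mult[of "a - b" "b - c"] by simp

lemma integrable_powr_weight:
  assumes "b \<ge> 2 * real CARD('n::finite)"
  shows "integrable lborel (\<lambda>y::real ^ 'n. (1 + norm (y - z)) powr (- b))"
proof -
  have "integrable lborel (\<lambda>y::real ^ 'n. (1 + norm y) powr (- b))"
  proof (rule Bochner_Integration.integrable_bound[OF integrable_inverse_power_norm[OF order_refl]])
    show "AE y::real^'n in lborel. norm ((1 + norm y) powr (- b)) \<le> norm (inverse ((1 + norm y) ^ (2 * CARD('n))))"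
    proof (rule AE_I2)
      fix y :: "real ^ 'n"
      have "(1 + norm y) powr (- b) \<le> (1 + norm y) powr (- real (2 * CARD('n)))"
        using assms by (intro powr_mono) auto
      also have "\<dots> = inverse ((1 + norm y) ^ (2 * CARD('n)))"
        by (subst powr_minus, subst powr_realpow) (auto intro: add_pos_nonneg)
      finally show "norm ((1 + norm y) powr (- b)) \<le> norm (inverse ((1 + norm y) ^ (2 * CARD('n))))" by simp
    qed
  qed measurable
  from lborel_integrable_translate[OF this, of "- z"] show ?thesis by simp
qed

text \<open>The supremum \<open>S\<close> of \<open>|f y| / (1 + |y - z|)\<^sup>L\<close> is finite by the growth bound, and splitting
  \<open>|f| = |f|\<^sup>a |f|\<^bsup>1-a\<^esup>\<close> in the reproducing formula gives \<open>S \<le> B S\<^bsup>1-a\<^esup> I\<close>.\<close>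

lemma plancherel_polya:
  fixes f K :: "real ^ 'n::finite \<Rightarrow> complex"
  assumes a: "0 < a" "a \<le> 1"
    and rep: "\<And>x. f x = (LINT y|lborel. f y * K (y - x))"
    and K: "\<And>t. norm (K t) * (1 + norm t) ^ L \<le> B"
    and growth: "\<And>x. norm (f x) \<le> A * (1 + norm x) ^ L"
    and int: "integrable lborel (\<lambda>y. norm (f y) powr a * (1 + norm (y - z)) powr (- (L * a)))"
  shows "norm (f x) powr a \<le> B * (LINT y|lborel. norm (f y) powr a * (1 + norm (y - z)) powr (- (L * a))) * (1 + norm (x - z)) powr (L * a)"
proof -
  define I where "I = (LINT y|lborel. norm (f y) powr a * (1 + norm (y - z)) powr (- (L * a)))"
  have pos: "0 < (1 + norm (v::real^'n)) ^ m" "0 < 1 + norm v" for v m by (auto intro!: zero_less_power add_pos_nonneg)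
  define S where "S = (SUP y. norm (f y) / (1 + norm (y - z)) ^ L)"
  \<comment> \<open>Finiteness of \<open>S\<close> is what later permits cancelling one of its
    powers. The growth constant \<open>A\<close> enters only here and does not reach the final
    constant.\<close>
  have bdd: "bdd_above (range (\<lambda>y. norm (f y) / (1 + norm (y - z)) ^ L))"
  proof (rule bdd_aboveI2)
    fix y
    have "(1 + norm y) ^ L \<le> ((1 + norm (y - z)) * (1 + norm z)) ^ L"
      using one_plus_norm_mult[of "y - z" z] by (intro power_mono) auto
    then have "norm (f y) \<le> \<bar>A\<bar> * ((1 + norm (y - z)) * (1 + norm z)) ^ L"
      using growth[of y] pos by (smt (verit) abs_ge_self mult_mono zero_le_power norm_ge_zero)
    then have "norm (f y) \<le> (\<bar>A\<bar> * (1 + norm z) ^ L) * (1 + norm (y - z)) ^ L"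
      by (simp only: power_mult_distrib mult_ac)
    then show "norm (f y) / (1 + norm (y - z)) ^ L \<le> \<bar>A\<bar> * (1 + norm z) ^ L"
      using pos(1)[of "y - z" L] by (simp add: divide_le_eq)
  qed
  have S: "norm (f y) \<le> S * (1 + norm (y - z)) ^ L" for y
  proof -
    have "norm (f y) / (1 + norm (y - z)) ^ L \<le> S"
      unfolding S_def by (rule cSUP_upper[OF UNIV_I bdd])
    then show ?thesis using pos(1)[of "y - z" L] by (simp add: field_simps)
  qed
  have "B \<ge> 0" using K[of 0] by (simp add: order_trans[OF norm_ge_zero])
  have "S \<ge> 0" using order_trans[OF norm_ge_zero S[of z]] by simp
  have I0: "I \<ge> 0" unfolding I_def by (intro integral_nonneg_AE) auto
  show ?thesis
  proof (cases "S = 0")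
    case True
    then have "f x = 0" using S[of x] by simp
    then show ?thesis using \<open>B \<ge> 0\<close> I0 by (simp add: I_def)
  next
    case False
    then have "S > 0" using \<open>S \<ge> 0\<close> by simp
    have key: "norm (f x') / (1 + norm (x' - z)) ^ L \<le> B * S powr (1 - a) * I" for x'
    proof -
      have "norm (f x') \<le> (LINT y|lborel. (B * S powr (1 - a) * (1 + norm (x' - z)) ^ L) * (norm (f y) powr a * (1 + norm (y - z)) powr (- (L * a))))"
        unfolding rep[of x']
      proof (rule norm_lebesgue_integral_le[OF integrable_mult_right[OF int]])
        fix y
        define d where "d = 1 + norm (y - z)"
        have d: "d > 0" using pos(2)[of "y - z"] by (simp add: d_def)
        have e1: "norm (f y) = norm (f y) powr a * norm (f y) powr (1 - a)"
          by (cases "f y = 0") (auto simp flip: powr_add)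
        have "norm (f y) powr (1 - a) \<le> (S * d ^ L) powr (1 - a)"
          using a S[of y] by (intro powr_mono2) (auto simp: d_def)
        also have "\<dots> = S powr (1 - a) * d powr (L * (1 - a))"
          using d \<open>S \<ge> 0\<close> by (simp add: powr_mult powr_powr flip: powr_realpow)
        finally have e2: "norm (f y) powr (1 - a) \<le> S powr (1 - a) * d powr (L * (1 - a))" .
        \<comment> \<open>The kernel decays in y - x'. Submultiplicativity converts this into decay
          in y - z at the price of growth in x' - z, which the quotient defining \<open>S\<close>
          divides out.\<close>
        have e3: "norm (K (y - x')) \<le> B * (1 + norm (x' - z)) ^ L * d powr (- real L)"
        proof -
          have "norm (K (y - x')) * d ^ L \<le> norm (K (y - x')) * ((1 + norm (y - x')) * (1 + norm (x' - z))) ^ L"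
            unfolding d_def using one_plus_norm_diff[of y z x'] by (intro mult_left_mono power_mono) auto
          also have "\<dots> = (norm (K (y - x')) * (1 + norm (y - x')) ^ L) * (1 + norm (x' - z)) ^ L"
            by (simp add: power_mult_distrib)
          also have "\<dots> \<le> B * (1 + norm (x' - z)) ^ L" by (intro mult_right_mono K) auto
          finally show ?thesis using d by (simp add: powr_minus powr_realpow field_simps)
        qed
        have "norm (f y * K (y - x')) \<le> (norm (f y) powr a * (S powr (1 - a) * d powr (L * (1 - a)))) * (B * (1 + norm (x' - z)) ^ L * d powr (- real L))"
          unfolding norm_mult by (subst e1) (intro mult_mono mult_left_mono e2 e3, auto)
        also have "\<dots> = (B * S powr (1 - a) * (1 + norm (x' - z)) ^ L) * (norm (f y) powr a * (d powr (L * (1 - a)) * d powr (- real L)))"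
          by (simp only: mult_ac)
        also have "d powr (L * (1 - a)) * d powr (- real L) = d powr (- (L * a))"
          unfolding powr_add[symmetric] by (simp add: algebra_simps)
        finally show "norm (f y * K (y - x')) \<le> (B * S powr (1 - a) * (1 + norm (x' - z)) ^ L) * (norm (f y) powr a * (1 + norm (y - z)) powr (- (L * a)))"
          by (simp add: d_def)
      qed
      also have "\<dots> = (B * S powr (1 - a) * (1 + norm (x' - z)) ^ L) * I" by (simp add: I_def)
      finally show ?thesis using pos(1)[of "x' - z" L] by (simp add: field_simps)
    qed
    have "S \<le> B * S powr (1 - a) * I"
      unfolding S_def by (rule cSUP_least) (use key in \<open>auto simp: S_def\<close>)
    moreover have "S = S powr a * S powr (1 - a)"
      using \<open>S > 0\<close> by (simp flip: powr_add)
    ultimately have "S powr a * S powr (1 - a) \<le> (B * I) * S powr (1 - a)" by (simp add: mult_ac)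
    then have Sa: "S powr a \<le> B * I" using \<open>S > 0\<close> by (simp add: mult_le_cancel_right)
    have "norm (f x) powr a \<le> (S * (1 + norm (x - z)) ^ L) powr a"
      using a S[of x] by (intro powr_mono2) auto
    also have "\<dots> = S powr a * (1 + norm (x - z)) powr (L * a)"
      using pos(2)[of "x - z"] \<open>S \<ge> 0\<close> by (simp add: powr_mult powr_powr flip: powr_realpow)
    also have "\<dots> \<le> (B * I) * (1 + norm (x - z)) powr (L * a)"
      by (intro mult_right_mono Sa) auto
    finally show ?thesis by (simp add: I_def)
  qed
qed

lemma lattice_point_diff: "lattice_point (k - l) = lattice_point k - lattice_point l"
  by (simp add: lattice_point_def vec_eq_iff)

lemma finite_lattice_ball: "finite {k :: int ^ 'n::finite. norm (lattice_point k) \<le> R}"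
proof (rule finite_subset)
  define F where "F = PiE (UNIV :: 'n set) (\<lambda>_. {- \<lceil>R\<rceil>..\<lceil>R\<rceil>})"
  show "{k :: int ^ 'n. norm (lattice_point k) \<le> R} \<subseteq> vec_lambda ` F"
  proof
    fix k :: "int ^ 'n" assume "k \<in> {k. norm (lattice_point k) \<le> R}"
    then have "\<bar>real_of_int (k $ i)\<bar> \<le> R" for i
      using component_le_norm_cart[of "lattice_point k" i] by (simp add: lattice_point_def)
    then have "\<bar>k $ i\<bar> \<le> \<lceil>R\<rceil>" for i
      by (metis ceiling_mono ceiling_of_int of_int_abs)
    then have "vec_nth k \<in> F" unfolding F_def by (auto simp: abs_le_iff)
       (smt (verit))
    then show "k \<in> vec_lambda ` F" by (metis image_eqI vec_nth_inverse)
  qed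
  show "finite (vec_lambda ` F)" unfolding F_def by (intro finite_imageI finite_PiE) auto
qed

context triebel
begin

text \<open>Composition of two multipliers: testing the function of symbol \<open>m\<close> against
  the transform of a modulated \<open>a\<close> gives the function whose symbol is the product. If
  \<open>a\<close> is 1 on the support of \<open>m\<close> this is a reproducing formula; if
  \<open>a\<close> is a dyadic symbol it writes a dyadic piece of a box as a convolution.\<close>

lemma multiplier_reproduce:
  fixes u :: "'n functional"
  assumes u: "u \<in> tempered" and m: "m \<in> schwartz" and a: "a \<in> schwartz"
  shows "(LINT y|lborel. u (\<lambda>t. fourier m (t - y)) * fourier a (y - x)) = inversion_const * u (\<lambda>t. fourier (\<lambda>\<xi>. m \<xi> * a \<xi>) (t - x))"
proof -
  define b where "b \<xi> = unit_char (x \<bullet> \<xi>) * a \<xi>" for \<xi>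
  have b: "b \<in> schwartz" unfolding b_def by (rule schwartz_modulate[OF a])
  have ma: "(\<lambda>\<xi>. m \<xi> * a \<xi>) \<in> schwartz" by (rule schwartz_mult[OF m a])
  have "(LINT y|lborel. u (\<lambda>t. fourier m (t - y)) * fourier b y) = u (fourier (\<lambda>\<xi>. m \<xi> * inv_fourier (fourier b) \<xi>))"
    using fourier_multiplier_integral[OF u m fourier_schwartz[OF b]] fourier_multiplier_eq[OF u m fourier_schwartz[OF b]] by simp
  also have "(\<lambda>\<xi>. m \<xi> * inv_fourier (fourier b) \<xi>) = (\<lambda>\<xi>. inversion_const * (unit_char (x \<bullet> \<xi>) * (m \<xi> * a \<xi>)))"
    by (simp add: fourier_inversion[OF b] b_def mult_ac)
  also have "fourier \<dots> = (\<lambda>t. inversion_const * fourier (\<lambda>\<xi>. m \<xi> * a \<xi>) (t - x))"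
  proof
    fix t
    have "fourier (\<lambda>\<xi>. inversion_const * (unit_char (x \<bullet> \<xi>) * (m \<xi> * a \<xi>))) t = inversion_const * fourier (\<lambda>\<xi>. unit_char (x \<bullet> \<xi>) * (m \<xi> * a \<xi>)) t"
      unfolding fourier_eq mult.left_commute[of _ inversion_const] by simp
    then show "fourier (\<lambda>\<xi>. inversion_const * (unit_char (x \<bullet> \<xi>) * (m \<xi> * a \<xi>))) t = inversion_const * fourier (\<lambda>\<xi>. m \<xi> * a \<xi>) (t - x)"
      by (simp only: fourier_modulate)
  qed
  also have "u \<dots> = inversion_const * u (\<lambda>t. fourier (\<lambda>\<xi>. m \<xi> * a \<xi>) (t - x))"
    by (rule tempered_cmult[OF u schwartz_translate'[OF fourier_schwartz[OF ma]]])
  finally show ?thesis unfolding b_def fourier_modulate .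
qed

text \<open>The ball of radius n = \<open>CARD('n)\<close> contains the cube [-3/4, 3/4]^n, so
  \<open>cutoff\<close> is 1 on the support of a Wiener window; it vanishes from radius 2n
  on.\<close>

definition cutoff :: "real ^ 'n \<Rightarrow> complex" where "cutoff \<xi> = psi ((1 / CARD('n)) *\<^sub>R \<xi>)"

lemma cutoff_schwartz: "cutoff \<in> schwartz"
  unfolding cutoff_def by (intro schwartz_scale psi_schwartz) auto

lemma cutoff_props: "norm \<xi> \<le> CARD('n) \<Longrightarrow> cutoff \<xi> = 1" "norm \<xi> \<ge> 2 * real CARD('n) \<Longrightarrow> cutoff \<xi> = 0" "cnj (cutoff \<xi>) = cutoff \<xi>"
proof -
  have c: "0 < real CARD('n)" by simp
  have n: "norm ((1 / CARD('n)) *\<^sub>R \<xi>) = norm \<xi> / CARD('n)" by simp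
  show "cutoff \<xi> = 1" if "norm \<xi> \<le> CARD('n)"
    unfolding cutoff_def psi_def using that c by (subst psi_props(3)) (simp_all add: n divide_le_eq del: norm_scaleR)
  show "cutoff \<xi> = 0" if "norm \<xi> \<ge> 2 * real CARD('n)"
    unfolding cutoff_def psi_def using that c by (subst psi_props(4)) (simp_all add: n le_divide_eq del: norm_scaleR)
qed (simp add: cutoff_def psi_def)

lemma inv_fourier_mult_fourier:
  assumes \<alpha>: "\<alpha> \<in> schwartz" and b: "b \<in> schwartz"
  shows "inv_fourier (\<lambda>x. fourier \<alpha> x * b x) \<xi> = (LINT \<eta>|lborel. \<alpha> \<eta> * inv_fourier b (\<xi> - \<eta>))"
proof -
  have "(LINT x|lborel. fourier \<alpha> x * (unit_char (\<xi> \<bullet> x) * b x)) = (LINT \<eta>|lborel. \<alpha> \<eta> * fourier (\<lambda>x. unit_char (\<xi> \<bullet> x) * b x) \<eta>)"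
    by (intro fourier_multiplication schwartz_integrable schwartz_modulate \<alpha> b)
  moreover have "fourier b (\<eta> - \<xi>) = inv_fourier b (\<xi> - \<eta>)" for \<eta>
    by (simp add: inv_fourier_fourier)
  moreover have "inv_fourier (\<lambda>x. fourier \<alpha> x * b x) \<xi> = (LINT x|lborel. fourier \<alpha> x * (unit_char (\<xi> \<bullet> x) * b x))"
    unfolding inv_fourier_eq by (simp only: mult.left_commute)
  ultimately show ?thesis by (simp only: fourier_modulate)
qed

text \<open>By the convolution theorem the spectrum of the product lies in the sum of the two
  spectra: the radii add and the centre \<open>c\<close> is kept.\<close>

lemma inv_fourier_mult_support:
  fixes \<alpha> b :: "real ^ 'n \<Rightarrow> complex"
  assumes "\<alpha> \<in> schwartz" "b \<in> schwartz"
    and "\<And>\<eta>. norm \<eta> \<ge> r \<Longrightarrow> \<alpha> \<eta> = 0" "\<And>\<xi>. norm (\<xi> - c) \<ge> R \<Longrightarrow> inv_fourier b \<xi> = 0"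
    and "norm (\<xi> - c) \<ge> R + r"
  shows "inv_fourier (\<lambda>x. fourier \<alpha> x * b x) \<xi> = 0"
proof -
  have "\<alpha> \<eta> * inv_fourier b (\<xi> - \<eta>) = 0" for \<eta>
  proof (cases "norm \<eta> \<ge> r")
    case False
    have "norm (\<xi> - c) \<le> norm (\<xi> - \<eta> - c) + norm \<eta>" using norm_triangle_ineq[of "\<xi> - \<eta> - c" \<eta>] by simp
    then have "norm (\<xi> - \<eta> - c) \<ge> R" using False assms(5) by linarith
    then show ?thesis using assms(4) by simp
  qed (use assms(3) in auto)
  then have "(\<lambda>\<eta>. \<alpha> \<eta> * inv_fourier b (\<xi> - \<eta>)) = (\<lambda>\<eta>. 0)" by blast
  then show ?thesis unfolding inv_fourier_mult_fourier[OF assms(1,2)] by simp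
qed

text \<open>The square of the transform of psi, which is real. It is nonnegative, rapidly
  decreasing, bounded below near 0, and has its spectrum in a ball of radius 4, so it localises in
  space while enlarging spectra by a bounded amount only.\<close>

definition spectral_weight :: "real ^ 'n \<Rightarrow> real" where "spectral_weight x = (Re (fourier psi x))\<^sup>2"

lemma spectral_weight_eq: "of_real (spectral_weight x) = fourier psi x * fourier psi x"
  using fourier_psi_real[of x] by (simp add: spectral_weight_def complex_eq_iff power2_eq_square)

lemma spectral_weight_schwartz: "(\<lambda>x. complex_of_real (spectral_weight (x - z))) \<in> schwartz"
  unfolding spectral_weight_eq by (intro schwartz_mult schwartz_translate' fourier_schwartz psi_schwartz)

lemma spectral_weight_nonneg: "spectral_weight x \<ge> 0" by (simp add: spectral_weight_def)

lemma spectral_weight_lower: obtains c \<delta> where "c > 0" "\<delta> > 0" "\<And>x. norm x < \<delta> \<Longrightarrow> spectral_weight x \<ge> c"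
proof -
  have cont: "continuous_on UNIV spectral_weight"
    unfolding spectral_weight_def by (intro continuous_intros schwartz_continuous fourier_schwartz psi_schwartz)
  have w0: "spectral_weight 0 > 0" using fourier_psi_0 by (simp add: spectral_weight_def)
  have "isCont spectral_weight 0" using cont continuous_on_eq_continuous_at open_UNIV by blast
  then obtain e where e: "e > 0" "\<And>x. dist x 0 < e \<Longrightarrow> dist (spectral_weight x) (spectral_weight 0) < spectral_weight 0 / 2"
    using w0 unfolding continuous_at_eps_delta by (meson half_gt_zero)
  have "spectral_weight x \<ge> spectral_weight 0 / 2" if "norm x < e" for x
    using e(2)[of x] that unfolding dist_real_def by (simp add: abs_if split: if_splits)
  then show ?thesis using w0 e(1) by (intro that[of "spectral_weight 0 / 2" e]) auto
qed

lemma spectral_weight_measurable [measurable]: "spectral_weight \<in> borel_measurable borel"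
  unfolding spectral_weight_def
  by (intro borel_measurable_continuous_onI continuous_intros schwartz_continuous fourier_schwartz psi_schwartz)

text \<open>Reproducing \<open>H'\<close> by \<open>\<chi>(\<xi> - c')\<close> reduces the claim to testing \<open>H\<close> against Schwartz functions
  whose spectrum is disjoint from that of \<open>H\<close>.\<close>

lemma multiplier_orthogonal:
  fixes u :: "'n functional"
  assumes u: "u \<in> tempered" and m: "m \<in> schwartz" and m': "m' \<in> schwartz"
    and supp: "\<And>\<xi>. norm (\<xi> - c) > CARD('n) \<Longrightarrow> m \<xi> = 0" "\<And>\<xi>. norm (\<xi> - c') > CARD('n) \<Longrightarrow> m' \<xi> = 0"
    and far: "norm (c - c') \<ge> 3 * real CARD('n) + 4"
  defines "H \<equiv> \<lambda>x. u (\<lambda>t. fourier m (t - x))" and "H' \<equiv> \<lambda>x. u (\<lambda>t. fourier m' (t - x))"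
  assumes bd: "\<And>x. norm (H x) \<le> b" "\<And>x. norm (H' x) \<le> b"
  shows "(LINT x|lborel. of_real (spectral_weight (x - z)) * H x * cnj (H' x)) = 0"
proof -
  define X where "X \<xi> = cutoff (\<xi> - c')" for \<xi>
  have X: "X \<in> schwartz" unfolding X_def by (rule schwartz_translate'[OF cutoff_schwartz])
  have mX: "m' \<xi> * X \<xi> = m' \<xi>" for \<xi>
    using supp(2)[of \<xi>] cutoff_props(1)[of "\<xi> - c'"] by (cases "norm (\<xi> - c') > CARD('n)") (auto simp: X_def)
  have rep: "inversion_const * H' x = (LINT y|lborel. H' y * fourier X (y - x))" for x
    unfolding H'_def multiplier_reproduce[OF u m' X] mX ..
  \<comment> \<open>The conjugate of the reproducing kernel, as a function of x, is again a
    transform, namely of a modulation of \<open>X\<close>, because \<open>X\<close> is real.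
    Multiplied by the weight it becomes the test function \<theta> y.\<close>
  define \<beta> where "\<beta> y \<xi> = unit_char (y \<bullet> \<xi>) * X \<xi>" for y \<xi>
  define \<theta> where "\<theta> y x = complex_of_real (spectral_weight (x - z)) * fourier (\<beta> y) x" for y x
  have \<beta>: "\<beta> y \<in> schwartz" for y unfolding \<beta>_def by (rule schwartz_modulate[OF X])
  have cnjX: "cnj (fourier X (y - x)) = fourier (\<beta> y) x" for x y
  proof -
    have "cnj (fourier X (y - x)) = (LINT \<xi>|lborel. cnj (unit_char (- (\<xi> \<bullet> (y - x))) * X \<xi>))"
      unfolding fourier_eq by (rule Bochner_Integration.integral_cnj[symmetric])
    also have "\<dots> = (LINT \<xi>|lborel. unit_char (- (\<xi> \<bullet> x)) * (unit_char (y \<bullet> \<xi>) * X \<xi>))"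
    proof (intro Bochner_Integration.integral_cong refl)
      fix \<xi>
      have "unit_char (\<xi> \<bullet> (y - x)) = unit_char (- (\<xi> \<bullet> x)) * unit_char (y \<bullet> \<xi>)"
        unfolding unit_char_add[symmetric] by (simp add: inner_diff_right inner_commute)
      then show "cnj (unit_char (- (\<xi> \<bullet> (y - x))) * X \<xi>) = unit_char (- (\<xi> \<bullet> x)) * (unit_char (y \<bullet> \<xi>) * X \<xi>)"
        by (simp add: X_def cutoff_props(3))
    qed
    finally show ?thesis by (simp add: fourier_eq \<beta>_def)
  qed
  define \<alpha> where "\<alpha> \<xi> = unit_char (z \<bullet> \<xi>) * psi \<xi>" for \<xi>
  have \<alpha>: "\<alpha> \<in> schwartz" unfolding \<alpha>_def by (rule schwartz_modulate[OF psi_schwartz])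
  have \<alpha>0: "norm \<eta> \<ge> 2 \<Longrightarrow> \<alpha> \<eta> = 0" for \<eta> by (simp add: \<alpha>_def psi_def psi_props(4))
  have \<theta>_eq: "\<theta> y = (\<lambda>x. fourier \<alpha> x * (fourier \<alpha> x * fourier (\<beta> y) x))" for y
    unfolding \<theta>_def spectral_weight_eq fourier_modulate[of z psi, symmetric] \<alpha>_def[abs_def] mult.assoc ..
  have \<theta>: "\<theta> y \<in> schwartz" for y
    unfolding \<theta>_eq by (intro schwartz_mult fourier_schwartz \<alpha> \<beta>)
  \<comment> \<open>Radius 2n comes from \<open>X\<close>, and 2 from each of the two factors of the
    weight. Together with the radius n of the spectrum of \<open>H\<close> this explains the
    separation 3n + 4.\<close>
  have inv0: "inv_fourier (\<theta> y) \<xi> = 0" if "norm (\<xi> - c') \<ge> 2 * real CARD('n) + 2 + 2" for y \<xi>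
    unfolding \<theta>_eq
  proof (rule inv_fourier_mult_support[OF \<alpha> _ \<alpha>0 _ that])
    show "(\<lambda>x. fourier \<alpha> x * fourier (\<beta> y) x) \<in> schwartz" by (intro schwartz_mult fourier_schwartz \<alpha> \<beta>)
    fix \<xi> assume far': "2 * real CARD('n) + 2 \<le> norm (\<xi> - c')"
    show "inv_fourier (\<lambda>x. fourier \<alpha> x * fourier (\<beta> y) x) \<xi> = 0"
    proof (rule inv_fourier_mult_support[OF \<alpha> fourier_schwartz[OF \<beta>] \<alpha>0 _ far'])
      fix \<xi> assume "2 * real CARD('n) \<le> norm (\<xi> - c')"
      then show "inv_fourier (fourier (\<beta> y)) \<xi> = 0"
        unfolding fourier_inversion[OF \<beta>] by (simp add: \<beta>_def X_def cutoff_props(2))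
    qed
  qed
  have inner0: "(LINT x|lborel. H x * \<theta> y x) = 0" for y
  proof -
    have "m \<xi> * inv_fourier (\<theta> y) \<xi> = 0" for \<xi>
    proof (cases "norm (\<xi> - c) > CARD('n)")
      case False
      have "norm (c - c') \<le> norm (\<xi> - c) + norm (\<xi> - c')"
        using norm_triangle_ineq4[of "\<xi> - c'" "\<xi> - c"] by simp
      then have "norm (\<xi> - c') \<ge> 2 * real CARD('n) + 2 + 2" using False far by linarith
      then show ?thesis using inv0 by simp
    qed (use supp in auto)
    then have "(\<lambda>\<xi>. m \<xi> * inv_fourier (\<theta> y) \<xi>) = (\<lambda>\<xi>. 0 * m \<xi>)" by auto
    then have "fourier (\<lambda>\<xi>. m \<xi> * inv_fourier (\<theta> y) \<xi>) = (\<lambda>t. 0 * m t)"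
      by (auto simp: fourier_eq)
    then show ?thesis
      using fourier_multiplier_integral[OF u m \<theta>, of y] fourier_multiplier_eq[OF u m \<theta>, of y] tempered_cmult[OF u m, of 0]
      by (simp add: H_def)
  qed
  have Hc: "continuous_on UNIV H" "continuous_on UNIV H'"
    unfolding H_def H'_def by (intro tempered_translate_continuous u fourier_schwartz m m')+
  note [measurable] = Hc[THEN borel_measurable_continuous_onI]
  \<comment> \<open>\<open>H'\<close> is merely bounded, and division by the polynomial
    \<open>q\<close> makes it integrable. The spectral weight has decay to spare for the
    compensating factor, and the decay of the kernel keeps the conjugated kernel bounded.\<close>
  define q where "q x = complex_of_real ((1 + norm x) ^ (2 * CARD('n)))" for x :: "real ^ 'n"
  have q0: "q x \<noteq> 0" for x
  proof -
    have "0 < (1 + norm x) ^ (2 * CARD('n))" by (intro zero_less_power add_pos_nonneg) auto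
    then show ?thesis unfolding q_def of_real_eq_0_iff by (rule less_imp_neq[symmetric])
  qed
  have qn: "norm (q x) = (1 + norm x) ^ (2 * CARD('n))" for x
    unfolding q_def by (simp del: of_real_power of_real_add)
  have qc: "continuous_on UNIV q" unfolding q_def by (intro continuous_intros)
  have [measurable]: "q \<in> borel_measurable borel" using qc by (rule borel_measurable_continuous_onI)
  have [measurable]: "(\<lambda>x. cnj (H' x)) \<in> borel_measurable borel"
    by (intro borel_measurable_continuous_onI continuous_intros Hc)
  obtain B where B: "B > 0" "\<And>x. norm (fourier X x) * (1 + norm x) ^ (2 * CARD('n)) \<le> B"
    using rapidD[OF schwartz_rapid[OF fourier_schwartz[OF X]]] by metis
  have "cnj inversion_const * (LINT x|lborel. of_real (spectral_weight (x - z)) * H x * cnj (H' x)) =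
     (LINT x|lborel. (of_real (spectral_weight (x - z)) * H x * q x) * (LINT y|lborel. (cnj (H' y) / q y) * (q y / q x * cnj (fourier X (y - x)))))"
  proof -
    have "cnj inversion_const * (of_real (spectral_weight (x - z)) * H x * cnj (H' x)) = (of_real (spectral_weight (x - z)) * H x * q x) * (LINT y|lborel. (cnj (H' y) / q y) * (q y / q x * cnj (fourier X (y - x))))" for x
    proof -
      have "(LINT y|lborel. (cnj (H' y) / q y) * (q y / q x * cnj (fourier X (y - x)))) = (LINT y|lborel. cnj (H' y * fourier X (y - x)) / q x)"
        using q0 by (intro Bochner_Integration.integral_cong) (auto simp: field_simps)
      also have "\<dots> = (LINT y|lborel. cnj (H' y * fourier X (y - x))) / q x" by (rule integral_divide_zero)
      also have "\<dots> = cnj (inversion_const * H' x) / q x" unfolding rep by (simp only: Bochner_Integration.integral_cnj)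
      finally show ?thesis using q0[of x] by (simp add: mult_ac)
    qed
    then show ?thesis by (simp only: integral_mult_right_zero[symmetric])
  qed
  also have "\<dots> = (LINT y|lborel. (cnj (H' y) / q y) * (LINT x|lborel. (of_real (spectral_weight (x - z)) * H x * q x) * (q y / q x * cnj (fourier X (y - x)))))"
  proof (rule Fubini_bounded_kernel[of _ _ "\<lambda>(x, y). q y / q x * cnj (fourier X (y - x))" B, unfolded prod.case])
    have "rapid (\<lambda>x. of_real (spectral_weight (x - z)) * H x * q x)"
    proof (rule rapid_mono[OF schwartz_rapid[OF spectral_weight_schwartz[of z]]])
      fix x
      show "norm (of_real (spectral_weight (x - z)) * H x * q x) \<le> b * (1 + norm x) ^ (2 * CARD('n)) * norm (complex_of_real (spectral_weight (x - z)))"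
        unfolding norm_mult qn using bd(1)[of x] spectral_weight_nonneg[of "x - z"] by (simp add: mult_ac mult_left_mono mult_right_mono)
    qed
    then show "integrable lborel (\<lambda>x. of_real (spectral_weight (x - z)) * H x * q x)"
      by (intro integrable_rapid) measurable
    show "integrable lborel (\<lambda>y. cnj (H' y) / q y)"
    proof (rule Bochner_Integration.integrable_bound[OF integrable_mult_right[OF integrable_inverse_power_norm[OF order_refl], of b]])
      show "AE y in lborel. norm (cnj (H' y) / q y) \<le> norm (b * inverse ((1 + norm y) ^ (2 * CARD('n))))"
      proof (rule AE_I2)
        fix y
        have "norm (cnj (H' y) / q y) = norm (H' y) * inverse ((1 + norm y) ^ (2 * CARD('n)))"
          by (simp only: divide_inverse norm_mult complex_mod_cnj norm_inverse qn)
        also have "\<dots> \<le> b * inverse ((1 + norm y) ^ (2 * CARD('n)))" by (intro mult_right_mono bd) auto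
        finally show "norm (cnj (H' y) / q y) \<le> norm (b * inverse ((1 + norm y) ^ (2 * CARD('n))))"
          using abs_ge_self order_trans unfolding real_norm_def by blast
      qed
    qed measurable
    have "continuous_on UNIV (\<lambda>p. q (snd p) / q (fst p) * cnj (fourier X (snd p - fst p)))"
      using q0 by (intro continuous_intros continuous_on_compose2[OF qc] continuous_on_compose2[OF schwartz_continuous[OF fourier_schwartz[OF X]]]) auto
    then show "(\<lambda>(x, y). q y / q x * cnj (fourier X (y - x))) \<in> borel_measurable borel"
      unfolding case_prod_beta' by (rule borel_measurable_continuous_onI)
    fix x y :: "real ^ 'n"
    have "(1 + norm y) ^ (2 * CARD('n)) \<le> ((1 + norm (y - x)) * (1 + norm x)) ^ (2 * CARD('n))"
      using one_plus_norm_mult[of "y - x" x] by (intro power_mono) auto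
    then have "norm (q y) / norm (q x) \<le> (1 + norm (y - x)) ^ (2 * CARD('n))"
      using q0[of x] unfolding qn power_mult_distrib by (simp add: divide_le_eq qn[symmetric])
    then have "norm (q y / q x * cnj (fourier X (y - x))) \<le> (1 + norm (y - x)) ^ (2 * CARD('n)) * norm (fourier X (y - x))"
      unfolding norm_mult norm_divide complex_mod_cnj by (intro mult_right_mono) auto
    also have "\<dots> \<le> B" using B(2)[of "y - x"] by (simp add: mult.commute)
    finally show "norm (q y / q x * cnj (fourier X (y - x))) \<le> B" .
  qed
  also have "\<dots> = (LINT y|lborel. (cnj (H' y) / q y) * (LINT x|lborel. q y * (H x * \<theta> y x)))"
  proof -
    have "(of_real (spectral_weight (x - z)) * H x * q x) * (q y / q x * cnj (fourier X (y - x))) = q y * (H x * \<theta> y x)" for x y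
      using q0[of x] by (simp add: cnjX \<theta>_def)
    then show ?thesis by (simp only:)
  qed
  also have "\<dots> = 0" by (simp add: inner0)
  finally show ?thesis using inversion_const_nonzero by simp
qed

end

section \<open>Box and dyadic pieces\<close>

locale amalgam = triebel \<psi> for \<psi> :: "real ^ 'n::finite \<Rightarrow> real" +
  fixes \<sigma> :: "real ^ 'n \<Rightarrow> complex"
  assumes wiener: "wiener_window \<sigma>"
begin

definition box_symbol :: "int ^ 'n \<Rightarrow> real ^ 'n \<Rightarrow> complex" where "box_symbol k \<xi> = \<sigma> (\<xi> - lattice_point k)"

lemma sigma_support:
  assumes "norm \<xi> > CARD('n)" shows "\<sigma> \<xi> = 0"
proof -
  have "\<exists>i. \<xi> $ i \<notin> {-3/4..3/4}"
  proof (rule ccontr)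
    assume "\<not> ?thesis"
    then have "\<bar>\<xi> $ i\<bar> \<le> 1" for i by (auto simp: abs_le_iff) (smt (verit) divide_le_eq_1)+
    then have "(\<Sum>i\<in>UNIV. \<bar>\<xi> $ i\<bar>) \<le> (\<Sum>i\<in>(UNIV::'n set). 1)" by (intro sum_mono)
    then show False using norm_le_l1_cart[of \<xi>] assms by simp
  qed
  then show ?thesis using wiener unfolding wiener_window_def by blast
qed

lemma box_symbol_support: "norm (\<xi> - lattice_point k) > CARD('n) \<Longrightarrow> box_symbol k \<xi> = 0"
  by (simp add: box_symbol_def sigma_support)

lemma box_symbol_schwartz: "box_symbol k \<in> schwartz"
proof -
  have "smooth \<sigma>" using wiener by (simp add: wiener_window_def)
  then have "\<sigma> \<in> schwartz" by (rule schwartz_compact_support) (rule sigma_support)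
  then show ?thesis unfolding box_symbol_def[abs_def] by (rule schwartz_translate')
qed

definition dyadic_symbol :: "nat \<Rightarrow> real ^ 'n \<Rightarrow> complex" where "dyadic_symbol j \<xi> = of_real (dyadic_piece \<psi> j \<xi>)"

text \<open>The series in the definition telescopes: its sum is the value of \<psi> at 0, which is
  1, minus \<psi>(\<xi>).\<close>

lemma dyadic_piece_0: "dyadic_piece \<psi> 0 \<xi> = \<psi> \<xi>"
proof -
  have lim: "(\<lambda>i. \<psi> ((1 / 2) ^ i *\<^sub>R \<xi>)) \<longlonglongrightarrow> \<psi> (0 *\<^sub>R \<xi>)"
    by (intro continuous_on_tendsto_compose[OF continuous_on_psi] tendsto_scaleR tendsto_const LIMSEQ_power_zero) auto
  have "(\<lambda>i. \<psi> ((1 / 2) ^ Suc i *\<^sub>R \<xi>) - \<psi> ((1 / 2) ^ i *\<^sub>R \<xi>)) sums (\<psi> (0 *\<^sub>R \<xi>) - \<psi> ((1 / 2) ^ 0 *\<^sub>R \<xi>))"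
    by (rule telescope_sums[OF lim])
  moreover have "dyadic_bump \<psi> ((1 / 2) ^ Suc i *\<^sub>R \<xi>) = \<psi> ((1 / 2) ^ Suc i *\<^sub>R \<xi>) - \<psi> ((1 / 2) ^ i *\<^sub>R \<xi>)" for i
    by (simp add: dyadic_bump_def)
  ultimately have "(\<Sum>i. dyadic_bump \<psi> ((1 / 2) ^ Suc i *\<^sub>R \<xi>)) = \<psi> (0 *\<^sub>R \<xi>) - \<psi> \<xi>"
    using sums_unique by fastforce
  then show ?thesis using psi_props(3)[of 0] by (simp add: dyadic_piece_def)
qed

lemma dyadic_symbol_0: "dyadic_symbol 0 \<xi> = psi \<xi>"
  by (simp add: dyadic_symbol_def dyadic_piece_0 psi_def)

lemma dyadic_piece_Suc: "dyadic_piece \<psi> (Suc j) \<xi> = \<psi> ((1 / 2) ^ Suc j *\<^sub>R \<xi>) - \<psi> ((1 / 2) ^ j *\<^sub>R \<xi>)"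
  by (simp add: dyadic_piece_def dyadic_bump_def)

definition annulus :: "real ^ 'n \<Rightarrow> complex" where "annulus \<xi> = psi \<xi> - psi (2 *\<^sub>R \<xi>)"

lemma annulus_schwartz: "annulus \<in> schwartz"
  unfolding annulus_def by (intro schwartz_diff schwartz_scale psi_schwartz) auto

lemma dyadic_symbol_pos: "j > 0 \<Longrightarrow> dyadic_symbol j \<xi> = annulus ((1 / 2) ^ j *\<^sub>R \<xi>)"
  by (cases j) (auto simp: dyadic_symbol_def annulus_def dyadic_piece_Suc psi_def)

lemma dyadic_symbol_schwartz: "dyadic_symbol j \<in> schwartz"
proof (cases "j = 0")
  case True
  then have "dyadic_symbol j = psi" by (auto simp: dyadic_symbol_0)
  then show ?thesis using psi_schwartz by simp
next
  case False
  then have "dyadic_symbol j = (\<lambda>\<xi>. annulus ((1 / 2) ^ j *\<^sub>R \<xi>))" by (auto simp: dyadic_symbol_pos)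
  then show ?thesis using schwartz_scale[OF annulus_schwartz] by simp
qed

lemma dyadic_piece_support:
  "norm \<xi> \<ge> 2 ^ Suc j \<Longrightarrow> dyadic_piece \<psi> j \<xi> = 0"
  "norm \<xi> * 2 \<le> 2 ^ j \<Longrightarrow> j > 0 \<Longrightarrow> dyadic_piece \<psi> j \<xi> = 0"
proof -
  assume a: "norm \<xi> \<ge> 2 ^ Suc j"
  show "dyadic_piece \<psi> j \<xi> = 0"
  proof (cases j)
    case 0 then show ?thesis using a by (simp add: dyadic_piece_0 psi_props(4))
  next
    case (Suc i)
    have "2 * 2 ^ i \<le> norm \<xi>"
      using a zero_le_power[of "2::real" i] unfolding Suc power_Suc by linarith
    then show ?thesis using a unfolding Suc dyadic_piece_Suc
      by (subst (1 2) psi_props(4)) (auto simp: power_divide field_simps)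
  qed
next
  assume a: "norm \<xi> * 2 \<le> 2 ^ j" "j > 0"
  then obtain i where Suc: "j = Suc i" by (cases j) auto
  have "norm \<xi> \<le> 2 * 2 ^ i"
    using a(1) zero_le_power[of "2::real" i] unfolding Suc power_Suc by linarith
  then show "dyadic_piece \<psi> j \<xi> = 0" using a Suc unfolding Suc dyadic_piece_Suc
    by (subst (1 2) psi_props(3)) (auto simp: power_divide field_simps)
qed

text \<open>Finitely many boxes meet a given dyadic piece, so decomposing that piece into boxes is a
  finite sum, to which the linearity of \<open>u\<close> applies directly.\<close>

definition meeting_boxes :: "nat \<Rightarrow> (int ^ 'n) set" where
  "meeting_boxes j = {k. \<exists>\<xi>. box_symbol k \<xi> \<noteq> 0 \<and> dyadic_piece \<psi> j \<xi> \<noteq> 0}"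

lemma finite_meeting_boxes: "finite (meeting_boxes j)"
proof (rule finite_subset[OF _ finite_lattice_ball[of "(2::real) ^ Suc j + real CARD('n)"]], safe)
  fix k assume "k \<in> meeting_boxes j"
  then obtain \<xi> where \<xi>: "box_symbol k \<xi> \<noteq> 0" "dyadic_piece \<psi> j \<xi> \<noteq> 0" by (auto simp: meeting_boxes_def)
  have "norm (\<xi> - lattice_point k) \<le> CARD('n)" using \<xi> box_symbol_support by force
  moreover have "norm \<xi> \<le> 2 ^ Suc j" using \<xi> dyadic_piece_support(1) by force
  ultimately show "norm (lattice_point k) \<le> 2 ^ Suc j + real CARD('n)"
    using norm_triangle_ineq4[of \<xi> "\<xi> - lattice_point k"] by simp
qed

text \<open>The support of a box symbol has diameter at most 2n, which is negligible against large
  dyadic scales: with i the least scale met by the box, no scale beyond both i + 2 and n + 3 is met.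
  Counting the scales up to n + 3 wholesale gives 3 + (n + 4) = n + 7.\<close>

lemma overlap: "finite {j. k \<in> meeting_boxes j}" "card {j. k \<in> meeting_boxes j} \<le> CARD('n) + 7"
proof -
  define J where "J = {j. k \<in> meeting_boxes j}"
  have "finite J \<and> card J \<le> CARD('n) + 7"
  proof (cases "J = {}")
    case False
    define i where "i = (LEAST j. j \<in> J)"
    have i: "i \<in> J" "\<And>j. j \<in> J \<Longrightarrow> i \<le> j"
      unfolding i_def using False by (auto intro: LeastI Least_le)
    have "J \<subseteq> {i..i+2} \<union> {..CARD('n) + 3}"
    proof
      fix j assume j: "j \<in> J"
      show "j \<in> {i..i+2} \<union> {..CARD('n) + 3}"
      proof (rule ccontr)
        assume "\<not> ?thesis"
        then have big: "j \<ge> i + 3" "j > CARD('n) + 3" using i(2)[OF j] by auto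
        obtain \<xi> where \<xi>: "box_symbol k \<xi> \<noteq> 0" "dyadic_piece \<psi> j \<xi> \<noteq> 0" using j by (auto simp: J_def meeting_boxes_def)
        obtain \<eta> where \<eta>: "box_symbol k \<eta> \<noteq> 0" "dyadic_piece \<psi> i \<eta> \<noteq> 0" using i(1) by (auto simp: J_def meeting_boxes_def)
        have 1: "norm (\<xi> - lattice_point k) \<le> CARD('n)" "norm (\<eta> - lattice_point k) \<le> CARD('n)" using \<xi> \<eta> box_symbol_support by force+
        have 2: "norm \<eta> \<le> 2 ^ Suc i" using \<eta> dyadic_piece_support(1) by force
        have 3: "norm \<xi> * 2 > 2 ^ j" using \<xi> dyadic_piece_support(2)[of \<xi> j] big by force
        have "norm (\<xi> - \<eta>) \<le> 2 * real CARD('n)"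
          using norm_triangle_ineq4[of "\<xi> - lattice_point k" "\<eta> - lattice_point k"] 1 by simp
        then have 4: "norm \<xi> \<le> 2 ^ Suc i + 2 * real CARD('n)"
          using norm_triangle_ineq[of \<eta> "\<xi> - \<eta>"] 2 by simp
        \<comment> \<open>As 2^j is 8 times 2^d, the annulus requires |\<xi>| to exceed 4 times 2^d,
          whereas scale i and the size of the box only allow twice 2^d plus 2n, which is
          less.\<close>
        obtain d where d: "j = d + 3" "d \<ge> i" "d \<ge> CARD('n)" using big that[of "j - 3"] by simp
        have 5: "(2::real) ^ Suc i \<le> 2 * 2 ^ d" using d(2) by simp
        have "CARD('n) < 2 ^ CARD('n)" by (rule less_exp)
        also have "(2::nat) ^ CARD('n) \<le> 2 ^ d" using d(3) by simp
        finally have "real CARD('n) < 2 ^ d" by (metis of_nat_less_iff of_nat_power of_nat_numeral)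
        moreover have "(2::real) ^ j = 8 * 2 ^ d" by (simp add: d(1) power_add)
        ultimately show False using 3 4 5 by linarith
      qed
    qed
    moreover have fin: "finite ({i..i+2} \<union> {..CARD('n) + 3})" by simp
    ultimately have "finite J" "card J \<le> card ({i..i+2} \<union> {..CARD('n) + 3})"
      by (auto intro: finite_subset card_mono)
    moreover have "card ({i..i+2} \<union> {..CARD('n) + 3}) \<le> card {i..i+2} + card {..CARD('n) + 3}" by (rule card_Un_le)
    ultimately show ?thesis by simp
  qed simp
  then show "finite {j. k \<in> meeting_boxes j}" "card {j. k \<in> meeting_boxes j} \<le> CARD('n) + 7" by (auto simp: J_def)
qed

section \<open>Pieces as functions and their pointwise bounds\<close>

definition box_fn :: "'n functional \<Rightarrow> int ^ 'n \<Rightarrow> real ^ 'n \<Rightarrow> complex" where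
  "box_fn u k x = u (\<lambda>y. fourier (box_symbol k) (y - x))"

definition dyadic_fn :: "'n functional \<Rightarrow> nat \<Rightarrow> real ^ 'n \<Rightarrow> complex" where
  "dyadic_fn u j x = u (\<lambda>y. fourier (dyadic_symbol j) (y - x))"

definition piece_fn :: "'n functional \<Rightarrow> nat \<Rightarrow> int ^ 'n \<Rightarrow> real ^ 'n \<Rightarrow> complex" where
  "piece_fn u j k x = u (\<lambda>y. fourier (\<lambda>\<xi>. box_symbol k \<xi> * dyadic_symbol j \<xi>) (y - x))"

lemma box_symbol_dyadic_symbol_schwartz: "(\<lambda>\<xi>. box_symbol k \<xi> * dyadic_symbol j \<xi>) \<in> schwartz"
  by (intro schwartz_mult box_symbol_schwartz dyadic_symbol_schwartz)

lemma dist_function_box: "u \<in> tempered \<Longrightarrow> dist_function (box_op \<sigma> k u) = box_fn u k"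
  unfolding box_op_def box_fn_def[abs_def] using dist_function_multiplier[OF _ box_symbol_schwartz, of u k]
  by (simp add: box_symbol_def[abs_def])

lemma dist_function_triangle: "u \<in> tempered \<Longrightarrow> dist_function (triangle_op \<psi> j u) = dyadic_fn u j"
  unfolding triangle_op_def dyadic_fn_def[abs_def] using dist_function_multiplier[OF _ dyadic_symbol_schwartz, of u j]
  by (simp add: dyadic_symbol_def[abs_def])

lemma continuous_box_fn: "u \<in> tempered \<Longrightarrow> continuous_on UNIV (box_fn u k)"
  unfolding box_fn_def[abs_def] by (intro tempered_translate_continuous fourier_schwartz box_symbol_schwartz)

lemma continuous_dyadic_fn: "u \<in> tempered \<Longrightarrow> continuous_on UNIV (dyadic_fn u j)"
  unfolding dyadic_fn_def[abs_def] by (intro tempered_translate_continuous fourier_schwartz dyadic_symbol_schwartz)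

lemma continuous_piece_fn: "u \<in> tempered \<Longrightarrow> continuous_on UNIV (piece_fn u j k)"
  unfolding piece_fn_def[abs_def] by (intro tempered_translate_continuous fourier_schwartz box_symbol_dyadic_symbol_schwartz)

text \<open>The box symbols sum to 1, and where the dyadic symbol is nonzero only the boxes meeting
  it contribute.\<close>

lemma dyadic_symbol_decompose: "dyadic_symbol j \<xi> = (\<Sum>k\<in>meeting_boxes j. box_symbol k \<xi> * dyadic_symbol j \<xi>)"
proof (cases "dyadic_symbol j \<xi> = 0")
  case False
  then have sub: "k \<in> meeting_boxes j" if "box_symbol k \<xi> \<noteq> 0" for k
    using that by (auto simp: meeting_boxes_def dyadic_symbol_def)
  have "((\<lambda>k. box_symbol k \<xi>) has_sum 1) UNIV"
    using wiener by (simp add: wiener_window_def box_symbol_def)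
  then have "((\<lambda>k. box_symbol k \<xi>) has_sum 1) (meeting_boxes j)"
    by (subst has_sum_cong_neutral[where T=UNIV and g="\<lambda>k. box_symbol k \<xi>"]) (use sub in auto)
  then have "(\<Sum>k\<in>meeting_boxes j. box_symbol k \<xi>) = 1"
    using has_sum_finite[OF finite_meeting_boxes] has_sum_unique by blast
  then show ?thesis by (simp flip: sum_distrib_right)
qed simp

lemma fourier_sum:
  assumes "\<And>i. i \<in> I \<Longrightarrow> m i \<in> schwartz"
  shows "fourier (\<lambda>\<xi>. \<Sum>i\<in>I. m i \<xi>) y = (\<Sum>i\<in>I. fourier (m i) y)"
  unfolding fourier_eq sum_distrib_left
  by (intro Bochner_Integration.integral_sum integrable_unit_char_mult schwartz_integrable assms) measurable

lemma dyadic_fn_decompose: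
  assumes "u \<in> tempered" shows "dyadic_fn u j x = (\<Sum>k\<in>meeting_boxes j. piece_fn u j k x)"
proof -
  have "dyadic_symbol j = (\<lambda>\<xi>. \<Sum>k\<in>meeting_boxes j. box_symbol k \<xi> * dyadic_symbol j \<xi>)" by (rule ext, rule dyadic_symbol_decompose)
  then have "dyadic_fn u j x = u (\<lambda>y. fourier (\<lambda>\<xi>. \<Sum>k\<in>meeting_boxes j. box_symbol k \<xi> * dyadic_symbol j \<xi>) (y - x))"
    unfolding dyadic_fn_def by (rule arg_cong)
  also have "\<dots> = u (\<lambda>y. \<Sum>k\<in>meeting_boxes j. 1 * fourier (\<lambda>\<xi>. box_symbol k \<xi> * dyadic_symbol j \<xi>) (y - x))"
    by (simp add: fourier_sum[OF box_symbol_dyadic_symbol_schwartz])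
  also have "\<dots> = (\<Sum>k\<in>meeting_boxes j. 1 * piece_fn u j k x)"
    unfolding piece_fn_def by (rule tempered_sum[OF assms]) (intro schwartz_translate' fourier_schwartz box_symbol_dyadic_symbol_schwartz)
  finally show ?thesis by simp
qed

lemma piece_fn_eq:
  assumes "u \<in> tempered"
  shows "inversion_const * piece_fn u j k x = (LINT y|lborel. box_fn u k y * fourier (dyadic_symbol j) (y - x))"
  unfolding piece_fn_def box_fn_def multiplier_reproduce[OF assms box_symbol_schwartz dyadic_symbol_schwartz] ..

lemma box_fn_reproduce:
  assumes "u \<in> tempered"
  shows "box_fn u k x = (LINT y|lborel. box_fn u k y * (fourier (\<lambda>\<xi>. cutoff (\<xi> - lattice_point k)) (y - x) / inversion_const))"
proof -
  have "box_symbol k \<xi> * cutoff (\<xi> - lattice_point k) = box_symbol k \<xi>" for \<xi>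
    using box_symbol_support[of \<xi> k] cutoff_props(1)[of "\<xi> - lattice_point k"] by (cases "norm (\<xi> - lattice_point k) > CARD('n)") auto
  then have "(\<lambda>\<xi>. box_symbol k \<xi> * cutoff (\<xi> - lattice_point k)) = box_symbol k" by blast
  then have "inversion_const * box_fn u k x = (LINT y|lborel. box_fn u k y * fourier (\<lambda>\<xi>. cutoff (\<xi> - lattice_point k)) (y - x))"
    using multiplier_reproduce[OF assms box_symbol_schwartz schwartz_translate'[OF cutoff_schwartz], of k "lattice_point k" x]
    by (simp add: box_fn_def)
  then show ?thesis using inversion_const_nonzero by (simp add: field_simps)
qed

text \<open>Uniform in k because a translation in frequency multiplies the kernel by a unimodular
  character only.\<close>

lemma cutoff_kernel_bound:
  obtains B where "B > 0" "\<And>k t. norm (fourier (\<lambda>\<xi>. cutoff (\<xi> - lattice_point k)) t / inversion_const) * (1 + norm t) ^ L \<le> B"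
proof -
  obtain B where B: "B > 0" "\<And>t. norm (fourier cutoff t) * (1 + norm t) ^ L \<le> B"
    using rapidD[OF schwartz_rapid[OF fourier_schwartz[OF cutoff_schwartz]]] by metis
  have "norm (fourier (\<lambda>\<xi>. cutoff (\<xi> - lattice_point k)) t / inversion_const) * (1 + norm t) ^ L \<le> B / norm inversion_const" for k t
  proof -
    have "norm (fourier (\<lambda>\<xi>. cutoff (\<xi> + (- lattice_point k))) t) = norm (fourier cutoff t)"
      unfolding fourier_translate by (simp add: norm_mult)
    then show ?thesis using B(2)[of t] inversion_const_nonzero by (simp add: norm_divide divide_right_mono)
  qed
  then show ?thesis using B(1) inversion_const_nonzero by (intro that[of "B / norm inversion_const"]) auto
qed

text \<open>The kernels of the dyadic pieces are \<open>L\<^sup>1\<close>-normalised dilates with scale at most 1.\<close>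

lemma dyadic_symbol_kernel_bound:
  obtains C where "C > 0" "\<And>j. integrable lborel (\<lambda>y. norm (fourier (dyadic_symbol j) y) * (1 + norm y) ^ L)"
    "\<And>j. (LINT y|lborel. norm (fourier (dyadic_symbol j) y) * (1 + norm y) ^ L) \<le> C"
proof -
  define w where "w m = (\<lambda>y. norm (fourier m y) * (1 + norm y) ^ L)" for m :: "real ^ 'n \<Rightarrow> complex"
  have int: "integrable lborel (w m)" if "m \<in> schwartz" for m
  proof -
    have "integrable lborel (\<lambda>y. complex_of_real ((1 + norm y) ^ L) * fourier m y)"
      by (rule integrable_poly_growth[OF fourier_schwartz[OF that], of _ 1 L])
        (auto simp del: of_real_power of_real_add)
    then have "integrable lborel (\<lambda>y. norm (complex_of_real ((1 + norm y) ^ L) * fourier m y))"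
      by (rule integrable_norm)
    then show ?thesis unfolding w_def by (simp add: norm_mult mult.commute del: of_real_power of_real_add)
  qed
  have w0: "w m y \<ge> 0" for m y by (simp add: w_def)
  have le: "(LINT y|lborel. w (dyadic_symbol j) y) \<le> (LINT y|lborel. w annulus y)" if "j > 0" for j
  proof -
    \<comment> \<open>Since \<open>c\<close> is at least 1, rescaling to the fixed annulus evaluates
      the weight at y / c, where it is no larger than at y.\<close>
    define c where "c = (2::real) ^ j"
    have c: "c \<ge> 1" by (simp add: c_def)
    have "dyadic_symbol j = (\<lambda>\<xi>. annulus ((1 / c) *\<^sub>R \<xi>))" using dyadic_symbol_pos[OF that] by (auto simp: c_def power_divide)
    then have P: "fourier (dyadic_symbol j) y = of_real (c ^ CARD('n)) * fourier annulus (c *\<^sub>R y)" for y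
      using fourier_scale[of "1 / c" annulus y] c by simp
    have "(LINT y|lborel. w (dyadic_symbol j) y) = \<bar>1 / c\<bar> ^ DIM(real ^ 'n) *\<^sub>R (LINT y|lborel. w (dyadic_symbol j) (0 + (1 / c) *\<^sub>R y))"
      using c by (intro lborel_integral_affine) auto
    also have "\<dots> = (LINT y|lborel. (1 / c) ^ CARD('n) * w (dyadic_symbol j) ((1 / c) *\<^sub>R y))" using c by simp
    also have "\<dots> \<le> (LINT y|lborel. w annulus y)"
    proof (rule integral_mono)
      show "integrable lborel (\<lambda>y. (1 / c) ^ CARD('n) * w (dyadic_symbol j) ((1 / c) *\<^sub>R y))"
        using lborel_integrable_affine[OF int[OF dyadic_symbol_schwartz[of j]], of "1 / c" 0] c by simp
      fix y
      have "(1 / c) ^ CARD('n) * w (dyadic_symbol j) ((1 / c) *\<^sub>R y) = norm (fourier annulus y) * (1 + norm ((1 / c) *\<^sub>R y)) ^ L"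
        unfolding w_def P using c by (simp add: norm_mult norm_power power_divide)
      also have "\<dots> \<le> w annulus y"
        unfolding w_def using c by (intro mult_left_mono power_mono) (auto simp: divide_le_eq mult_le_cancel_left1)
      finally show "(1 / c) ^ CARD('n) * w (dyadic_symbol j) ((1 / c) *\<^sub>R y) \<le> w annulus y" .
    qed (rule int[OF annulus_schwartz])
    finally show ?thesis .
  qed
  define C where "C = 1 + (LINT y|lborel. w annulus y) + (LINT y|lborel. w (dyadic_symbol 0) y)"
  have nn: "(LINT y|lborel. w m y) \<ge> 0" for m by (intro integral_nonneg_AE) (simp add: w0)
  have "(LINT y|lborel. w (dyadic_symbol j) y) \<le> C" for j
    using le[of j] nn[of annulus] nn[of "dyadic_symbol 0"] by (cases "j = 0") (auto simp: C_def)
  moreover have "C > 0" using nn[of annulus] nn[of "dyadic_symbol 0"] by (simp add: C_def)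
  ultimately show ?thesis using int[OF dyadic_symbol_schwartz] that unfolding w_def by blast
qed

text \<open>A growth bound about z survives convolution with a dyadic kernel, since the weight is
  submultiplicative and the kernel is integrable against it. The scale j enters only through the
  uniform kernel bound \<open>C\<close>.\<close>

lemma piece_fn_pointwise:
  assumes u: "u \<in> tempered" and M: "\<And>y. norm (box_fn u k y) \<le> M * (1 + norm (y - z)) ^ L"
    and C: "integrable lborel (\<lambda>y. norm (fourier (dyadic_symbol j) y) * (1 + norm y) ^ L)"
      "(LINT y|lborel. norm (fourier (dyadic_symbol j) y) * (1 + norm y) ^ L) \<le> C"
  shows "norm (piece_fn u j k x) \<le> (C / norm inversion_const) * M * (1 + norm (x - z)) ^ L"
proof -
  have M0: "M \<ge> 0" using order_trans[OF norm_ge_zero M[of z]] by simp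
  have "norm (inversion_const * piece_fn u j k x) \<le> (LINT y|lborel. M * (1 + norm (x - z)) ^ L * (norm (fourier (dyadic_symbol j) (y - x)) * (1 + norm (y - x)) ^ L))"
    unfolding piece_fn_eq[OF u]
  proof (rule norm_lebesgue_integral_le)
    show "integrable lborel (\<lambda>y. M * (1 + norm (x - z)) ^ L * (norm (fourier (dyadic_symbol j) (y - x)) * (1 + norm (y - x)) ^ L))"
      using lborel_integrable_translate[OF C(1), of "- x"] by (intro integrable_mult_right) simp
    fix y
    have "norm (box_fn u k y) \<le> M * ((1 + norm (y - x)) * (1 + norm (x - z))) ^ L"
      by (rule order_trans[OF M]) (intro mult_left_mono power_mono one_plus_norm_diff M0, auto)
    then have "norm (box_fn u k y) * norm (fourier (dyadic_symbol j) (y - x)) \<le> (M * ((1 + norm (y - x)) * (1 + norm (x - z))) ^ L) * norm (fourier (dyadic_symbol j) (y - x))"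
      by (rule mult_right_mono) simp
    then show "norm (box_fn u k y * fourier (dyadic_symbol j) (y - x)) \<le> M * (1 + norm (x - z)) ^ L * (norm (fourier (dyadic_symbol j) (y - x)) * (1 + norm (y - x)) ^ L)"
      by (simp only: norm_mult power_mult_distrib mult_ac)
  qed
  also have "\<dots> = M * (1 + norm (x - z)) ^ L * (LINT y|lborel. norm (fourier (dyadic_symbol j) (y - x)) * (1 + norm (y - x)) ^ L)"
    by (rule integral_mult_right_zero)
  also have "(LINT y|lborel. norm (fourier (dyadic_symbol j) (y - x)) * (1 + norm (y - x)) ^ L) = (LINT y|lborel. norm (fourier (dyadic_symbol j) y) * (1 + norm y) ^ L)"
    using lborel_integral_translate[of "\<lambda>y. norm (fourier (dyadic_symbol j) y) * (1 + norm y) ^ L" "- x"] by simp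
  also have "M * (1 + norm (x - z)) ^ L * (LINT y|lborel. norm (fourier (dyadic_symbol j) y) * (1 + norm y) ^ L) \<le> M * (1 + norm (x - z)) ^ L * C"
    using M0 by (intro mult_left_mono C) auto
  finally have "norm inversion_const * norm (piece_fn u j k x) \<le> M * (1 + norm (x - z)) ^ L * C" by (simp add: norm_mult)
  then show ?thesis using inversion_const_nonzero by (simp add: field_simps)
qed

text \<open>The quantity M_k(z) of the overview. The root 1 / a is not taken, which keeps it linear
  in the a-th power of the box piece and thus accessible to Tonelli and Minkowski.\<close>

definition local_mean :: "'n functional \<Rightarrow> real \<Rightarrow> nat \<Rightarrow> int ^ 'n \<Rightarrow> real ^ 'n \<Rightarrow> real" where
  "local_mean u a L k z = (LINT y|lborel. norm (box_fn u k y) powr a * (1 + norm (y - z)) powr (- (L * a)))"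

lemma local_mean_nonneg: "local_mean u a L k z \<ge> 0"
  unfolding local_mean_def by (intro integral_nonneg_AE) auto

lemma local_mean_integrable:
  assumes u: "u \<in> tempered" and bd: "\<And>x. norm (box_fn u k x) \<le> b" and a: "a > 0" and La: "L * a \<ge> 2 * real CARD('n)"
  shows "integrable lborel (\<lambda>y. norm (box_fn u k y) powr a * (1 + norm (y - z)) powr (- (L * a)))"
proof (rule Bochner_Integration.integrable_bound[OF integrable_mult_right[OF integrable_powr_weight[OF La], of "b powr a"]])
  have [measurable]: "box_fn u k \<in> borel_measurable borel" by (rule borel_measurable_continuous_onI[OF continuous_box_fn[OF u]])
  show "(\<lambda>y. norm (box_fn u k y) powr a * (1 + norm (y - z)) powr (- (L * a))) \<in> borel_measurable lborel" by measurable
  show "AE y in lborel. norm (norm (box_fn u k y) powr a * (1 + norm (y - z)) powr (- (L * a))) \<le> norm (b powr a * (1 + norm (y - z)) powr (- (L * a)))"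
    using a bd by (auto simp: abs_mult intro!: mult_right_mono powr_mono2)
qed

text \<open>Boundedness provides the growth hypothesis of the Plancherel-Polya inequality for the
  prescribed order \<open>L\<close>. The bound \<open>b\<close> itself stays out of the result, so
  \<open>B\<close> is uniform in \<open>u\<close> and \<open>k\<close>.\<close>

lemma box_fn_pointwise:
  assumes a: "0 < a" "a \<le> 1" and La: "L * a \<ge> 2 * real CARD('n)"
  obtains B where "B > 0" "\<And>u k x z b. u \<in> tempered \<Longrightarrow> (\<And>x. norm (box_fn u k x) \<le> b) \<Longrightarrow>
    norm (box_fn u k x) \<le> B * local_mean u a L k z powr (1 / a) * (1 + norm (x - z)) ^ L"
proof -
  obtain B where B: "B > 0" "\<And>k t. norm (fourier (\<lambda>\<xi>. cutoff (\<xi> - lattice_point k)) t / inversion_const) * (1 + norm t) ^ L \<le> B"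
    using cutoff_kernel_bound by metis
  have *: "norm (box_fn u k x) \<le> B powr (1 / a) * local_mean u a L k z powr (1 / a) * (1 + norm (x - z)) ^ L"
    if u: "u \<in> tempered" and bd: "\<And>x. norm (box_fn u k x) \<le> b" for u k x z b
  proof -
    have "b \<ge> 0" using order_trans[OF norm_ge_zero bd] .
    have pp: "norm (box_fn u k x) powr a \<le> B * local_mean u a L k z * (1 + norm (x - z)) powr (L * a)"
      unfolding local_mean_def
    proof (rule plancherel_polya[OF a box_fn_reproduce[OF u] B(2)])
      show "norm (box_fn u k x) \<le> b * (1 + norm x) ^ L" for x
        using bd[of x] \<open>b \<ge> 0\<close> mult_left_mono[of 1 "(1 + norm x) ^ L" b] by (simp add: one_le_power)
    qed (rule local_mean_integrable[OF u bd a(1) La])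
    have "norm (box_fn u k x) = (norm (box_fn u k x) powr a) powr (1 / a)"
      using a by (simp add: powr_powr)
    also have "\<dots> \<le> (B * local_mean u a L k z * (1 + norm (x - z)) powr (L * a)) powr (1 / a)"
      using a by (intro powr_mono2 pp) auto
    also have "\<dots> = B powr (1 / a) * local_mean u a L k z powr (1 / a) * (1 + norm (x - z)) powr real L"
      using a B(1) local_mean_nonneg[of u a L k z] by (simp add: powr_mult powr_powr)
    also have "(1 + norm (x - z)) powr real L = (1 + norm (x - z)) ^ L"
      by (intro powr_realpow) (auto intro: add_pos_nonneg)
    finally show ?thesis .
  qed
  show ?thesis
  proof (rule that[of "B powr (1 / a)"])
    show "B powr (1 / a) > 0" using B(1) by simp
  qed (rule *)
qed

text \<open>Here the exponent \<open>L\<close> depends on \<open>u\<close>, so this only gives a qualitative bound.\<close>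

lemma box_fn_bounded:
  assumes u: "u \<in> tempered" and p: "0 < p" "p \<le> 1" and int: "integrable lborel (\<lambda>y. norm (box_fn u k y) powr p)"
  shows "\<exists>b. \<forall>x. norm (box_fn u k x) \<le> b"
proof -
  obtain A' L where L: "\<And>x. norm (box_fn u k x) \<le> A' * (1 + norm x) ^ L"
    using tempered_translate_bounds[OF u fourier_schwartz[OF box_symbol_schwartz]] unfolding box_fn_def by metis
  obtain B where B: "B > 0" "\<And>t. norm (fourier (\<lambda>\<xi>. cutoff (\<xi> - lattice_point k)) t / inversion_const) * (1 + norm t) ^ L \<le> B"
    using cutoff_kernel_bound by metis
  have [measurable]: "box_fn u k \<in> borel_measurable borel" by (rule borel_measurable_continuous_onI[OF continuous_box_fn[OF u]])
  have w1: "(1 + norm v) powr (- (L * p)) \<le> 1" for v :: "real ^ 'n"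
  proof -
    have "(1 + norm v) powr (- (L * p)) \<le> (1 + norm v) powr 0" using p by (intro powr_mono) auto
    also have "\<dots> \<le> 1" by (simp add: powr_zero_eq_one)
    finally show ?thesis .
  qed
  define I where "I = (LINT y|lborel. norm (box_fn u k y) powr p)"
  have "norm (box_fn u k x) \<le> (B * I) powr (1 / p)" for x
  proof -
    have int2: "integrable lborel (\<lambda>y. norm (box_fn u k y) powr p * (1 + norm (y - x)) powr (- (L * p)))"
      by (rule Bochner_Integration.integrable_bound[OF int]) (auto simp: abs_mult intro!: mult_left_le w1)
    \<comment> \<open>The centre is the evaluation point itself, so the growth factor is 1; bounding
      the weight by 1 under the integral then leaves the full L^p integral.\<close>
    have "norm (box_fn u k x) powr p \<le> B * (LINT y|lborel. norm (box_fn u k y) powr p * (1 + norm (y - x)) powr (- (L * p))) * (1 + norm (x - x)) powr (L * p)"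
      by (rule plancherel_polya[OF p box_fn_reproduce[OF u] B(2) L int2])
    also have "\<dots> \<le> B * I"
      using B(1) int int2 unfolding I_def by (auto intro!: mult_left_mono integral_mono mult_left_le w1)
    finally have "(norm (box_fn u k x) powr p) powr (1 / p) \<le> (B * I) powr (1 / p)"
      using p by (intro powr_mono2) auto
    then show ?thesis using p by (simp add: powr_powr)
  qed
  then show ?thesis by blast
qed

abbreviation near :: "int ^ 'n \<Rightarrow> int ^ 'n \<Rightarrow> bool" where
  "near k l \<equiv> norm (lattice_point k - lattice_point l) \<le> 3 * real CARD('n) + 4"

text \<open>Subtraction from k maps the near indices injectively into a fixed lattice ball, so the
  count is bounded independently of k.\<close>

lemma near_card: "card {k' \<in> (K :: (int ^ 'n) set). norm (lattice_point k - lattice_point k') \<le> R} \<le> card {d :: int ^ 'n. norm (lattice_point d) \<le> R}"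
proof (rule card_inj_on_le[OF _ _ finite_lattice_ball])
  show "inj_on (\<lambda>k'. k - k') {k' \<in> K. norm (lattice_point k - lattice_point k') \<le> R}" by (auto simp: inj_on_def)
qed (auto simp: lattice_point_diff)

text \<open>The squared modulus of the finite sum is expanded. Cross terms of distant boxes vanish,
  those of near boxes are at most half the sum of the two diagonal terms, and every box has at most
  \<open>N0\<close> near ones.\<close>

lemma local_L2_orthogonality:
  fixes u :: "'n functional"
  defines "N0 \<equiv> real (card {d :: int ^ 'n. norm (lattice_point d) \<le> 3 * real CARD('n) + 4})"
  assumes u: "u \<in> tempered" and bd: "\<And>k. \<exists>b. \<forall>x. norm (piece_fn u j k x) \<le> b"
  shows "(LINT x|lborel. spectral_weight (x - z) * (norm (dyadic_fn u j x))\<^sup>2) \<le> N0 * (\<Sum>k\<in>meeting_boxes j. LINT x|lborel. spectral_weight (x - z) * (norm (piece_fn u j k x))\<^sup>2)"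
    and "integrable lborel (\<lambda>x. spectral_weight (x - z) * (norm (dyadic_fn u j x))\<^sup>2)"
proof -
  note [measurable] = borel_measurable_continuous_onI[OF continuous_piece_fn[OF u]]
  have [measurable]: "(\<lambda>x. cnj (piece_fn u j k x)) \<in> borel_measurable borel" for k
    by (intro borel_measurable_continuous_onI continuous_intros continuous_piece_fn u)
  obtain b where b: "\<And>k x. norm (piece_fn u j k x) \<le> b k" using bd by metis
  have b0: "0 \<le> b k" for k using order_trans[OF norm_ge_zero b] .
  define F where "F k l x = of_real (spectral_weight (x - z)) * piece_fn u j k x * cnj (piece_fn u j l x)" for k l x
  have wint: "integrable lborel (\<lambda>x. spectral_weight (x - z))"
    using integrable_Re[OF schwartz_integrable[OF spectral_weight_schwartz[of z]]] by simp
  have Fint: "integrable lborel (F k l)" for k l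
  proof (rule Bochner_Integration.integrable_bound[OF integrable_mult_right[OF wint, of "b k * b l"]])
    show "F k l \<in> borel_measurable lborel" unfolding F_def by measurable
    show "AE x in lborel. norm (F k l x) \<le> norm (b k * b l * spectral_weight (x - z))"
    proof (rule AE_I2)
      fix x
      have "norm (F k l x) = spectral_weight (x - z) * (norm (piece_fn u j k x) * norm (piece_fn u j l x))" by (simp add: F_def norm_mult spectral_weight_nonneg)
      also have "\<dots> \<le> spectral_weight (x - z) * (b k * b l)" by (intro mult_left_mono mult_mono b spectral_weight_nonneg b0) auto
      finally show "norm (F k l x) \<le> norm (b k * b l * spectral_weight (x - z))"
        using b0 spectral_weight_nonneg by (simp add: abs_mult mult_ac)
    qed
  qed
  define I where "I k = (LINT x|lborel. spectral_weight (x - z) * (norm (piece_fn u j k x))\<^sup>2)" for k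
  have Fkk: "F k k x = of_real (spectral_weight (x - z) * (norm (piece_fn u j k x))\<^sup>2)" for k x
    unfolding F_def by (simp add: mult.assoc complex_norm_square del: of_real_power) 
  have Iint: "integrable lborel (\<lambda>x. spectral_weight (x - z) * (norm (piece_fn u j k x))\<^sup>2)" for k
    using integrable_Re[OF Fint[of k k]] unfolding Fkk by simp
  have I0: "I k \<ge> 0" for k unfolding I_def by (intro integral_nonneg_AE) (simp add: spectral_weight_nonneg)
  have far: "integral\<^sup>L lborel (F k l) = 0" if "\<not> near k l" for k l
    unfolding F_def piece_fn_def
  proof (rule multiplier_orthogonal[OF u box_symbol_dyadic_symbol_schwartz box_symbol_dyadic_symbol_schwartz, where c="lattice_point k" and c'="lattice_point l" and b="b k + b l"])
    show "norm (u (\<lambda>t. fourier (\<lambda>\<xi>. box_symbol k \<xi> * dyadic_symbol j \<xi>) (t - x))) \<le> b k + b l" for x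
      using b[of k x] b0[of l] unfolding piece_fn_def by linarith
    show "norm (u (\<lambda>t. fourier (\<lambda>\<xi>. box_symbol l \<xi> * dyadic_symbol j \<xi>) (t - x))) \<le> b k + b l" for x
      using b[of l x] b0[of k] unfolding piece_fn_def by linarith
  qed (use that box_symbol_support in auto)
  have near: "norm (integral\<^sup>L lborel (F k l)) \<le> (I k + I l) / 2" for k l
  proof -
    have "norm (integral\<^sup>L lborel (F k l)) \<le> (LINT x|lborel. (spectral_weight (x - z) * (norm (piece_fn u j k x))\<^sup>2 + spectral_weight (x - z) * (norm (piece_fn u j l x))\<^sup>2) / 2)"
    proof (rule norm_lebesgue_integral_le)
      fix x
      have "norm (F k l x) = spectral_weight (x - z) * (norm (piece_fn u j k x) * norm (piece_fn u j l x))" by (simp add: F_def norm_mult spectral_weight_nonneg)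
      also have "\<dots> \<le> spectral_weight (x - z) * (((norm (piece_fn u j k x))\<^sup>2 + (norm (piece_fn u j l x))\<^sup>2) / 2)"
        using sum_squares_bound[of "norm (piece_fn u j k x)" "norm (piece_fn u j l x)"]
        by (intro mult_left_mono spectral_weight_nonneg) auto
      finally show "norm (F k l x) \<le> (spectral_weight (x - z) * (norm (piece_fn u j k x))\<^sup>2 + spectral_weight (x - z) * (norm (piece_fn u j l x))\<^sup>2) / 2"
        by (simp add: algebra_simps)
    qed (use Iint in auto)
    then show ?thesis using Iint unfolding I_def by simp
  qed
  have G: "complex_of_real (spectral_weight (x - z) * (norm (dyadic_fn u j x))\<^sup>2) = (\<Sum>k\<in>meeting_boxes j. \<Sum>l\<in>meeting_boxes j. F k l x)" for x
  proof -
    have "complex_of_real (spectral_weight (x - z) * (norm (dyadic_fn u j x))\<^sup>2) = of_real (spectral_weight (x - z)) * (dyadic_fn u j x * cnj (dyadic_fn u j x))"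
      by (simp add: complex_norm_square del: of_real_power)
    also have "dyadic_fn u j x * cnj (dyadic_fn u j x) = (\<Sum>k\<in>meeting_boxes j. \<Sum>l\<in>meeting_boxes j. piece_fn u j k x * cnj (piece_fn u j l x))"
      by (simp only: dyadic_fn_decompose[OF u] cnj_sum sum_product)
    finally show ?thesis
      by (simp only: F_def sum_distrib_left mult.assoc)
  qed
  have Gint: "integrable lborel (\<lambda>x. complex_of_real (spectral_weight (x - z) * (norm (dyadic_fn u j x))\<^sup>2))"
    unfolding G by (intro Bochner_Integration.integrable_sum Fint)
  then show "integrable lborel (\<lambda>x. spectral_weight (x - z) * (norm (dyadic_fn u j x))\<^sup>2)"
    using integrable_Re by fastforce
  have "complex_of_real (LINT x|lborel. spectral_weight (x - z) * (norm (dyadic_fn u j x))\<^sup>2) = (LINT x|lborel. complex_of_real (spectral_weight (x - z) * (norm (dyadic_fn u j x))\<^sup>2))"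
    by (rule integral_complex_of_real[symmetric])
  also have "\<dots> = (\<Sum>k\<in>meeting_boxes j. \<Sum>l\<in>meeting_boxes j. integral\<^sup>L lborel (F k l))"
    unfolding G by (simp add: Bochner_Integration.integral_sum Fint)
  finally have eq: "complex_of_real (LINT x|lborel. spectral_weight (x - z) * (norm (dyadic_fn u j x))\<^sup>2) = (\<Sum>k\<in>meeting_boxes j. \<Sum>l\<in>meeting_boxes j. integral\<^sup>L lborel (F k l))" .
  have "(LINT x|lborel. spectral_weight (x - z) * (norm (dyadic_fn u j x))\<^sup>2) \<le> norm (\<Sum>k\<in>meeting_boxes j. \<Sum>l\<in>meeting_boxes j. integral\<^sup>L lborel (F k l))"
    unfolding eq[symmetric] norm_of_real by (rule abs_ge_self)
  also have "\<dots> \<le> (\<Sum>k\<in>meeting_boxes j. \<Sum>l\<in>meeting_boxes j. norm (integral\<^sup>L lborel (F k l)))"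
    by (intro sum_norm_le) simp
  also have "\<dots> \<le> (\<Sum>k\<in>meeting_boxes j. \<Sum>l\<in>meeting_boxes j. if near k l then (I k + I l) / 2 else 0)"
    using near far by (intro sum_mono) auto
  also have "\<dots> = (\<Sum>k\<in>meeting_boxes j. \<Sum>l\<in>meeting_boxes j. (if near k l then I k / 2 else 0)) +
     (\<Sum>k\<in>meeting_boxes j. \<Sum>l\<in>meeting_boxes j. (if near k l then I l / 2 else 0))"
    unfolding sum.distrib[symmetric] by (intro sum.cong) (auto simp: add_divide_distrib)
  also have "(\<Sum>k\<in>meeting_boxes j. \<Sum>l\<in>meeting_boxes j. (if near k l then I l / 2 else 0)) =
     (\<Sum>k\<in>meeting_boxes j. \<Sum>l\<in>meeting_boxes j. (if near k l then I k / 2 else 0))"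
    by (subst sum.swap, intro sum.cong refl, subst norm_minus_commute, rule refl)
  finally have le: "(LINT x|lborel. spectral_weight (x - z) * (norm (dyadic_fn u j x))\<^sup>2) \<le>
     (\<Sum>k\<in>meeting_boxes j. \<Sum>l\<in>meeting_boxes j. (if near k l then I k / 2 else 0)) +
     (\<Sum>k\<in>meeting_boxes j. \<Sum>l\<in>meeting_boxes j. (if near k l then I k / 2 else 0))" .
  have half: "(\<Sum>k\<in>meeting_boxes j. \<Sum>l\<in>meeting_boxes j. (if near k l then I k / 2 else 0)) \<le> (\<Sum>k\<in>meeting_boxes j. N0 * (I k / 2))"
  proof (intro sum_mono)
    fix k
    have "(\<Sum>l\<in>meeting_boxes j. (if near k l then I k / 2 else 0)) =
       real (card {l \<in> meeting_boxes j. near k l}) * (I k / 2)"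
      by (simp add: sum.inter_filter[OF finite_meeting_boxes, symmetric])
    also have "\<dots> \<le> N0 * (I k / 2)"
      unfolding N0_def using I0 by (intro mult_right_mono of_nat_mono near_card) auto
    finally show "(\<Sum>l\<in>meeting_boxes j. (if near k l then I k / 2 else 0)) \<le> N0 * (I k / 2)" .
  qed
  have "(\<Sum>k\<in>meeting_boxes j. N0 * (I k / 2)) + (\<Sum>k\<in>meeting_boxes j. N0 * (I k / 2)) = N0 * (\<Sum>k\<in>meeting_boxes j. I k)"
    by (simp add: sum_distrib_left flip: sum.distrib)
  then show "(LINT x|lborel. spectral_weight (x - z) * (norm (dyadic_fn u j x))\<^sup>2) \<le> N0 * (\<Sum>k\<in>meeting_boxes j. LINT x|lborel. spectral_weight (x - z) * (norm (piece_fn u j k x))\<^sup>2)"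
    using le half unfolding I_def by linarith
qed

end

section \<open>Sufficiency\<close>

lemma ennpowr_ennreal: "0 \<le> t \<Longrightarrow> ennpowr (ennreal t) a = ennreal (t powr a)"
  by (simp add: ennpowr_def)

lemma ennpowr_top [simp]: "ennpowr top a = top"
  by (simp add: ennpowr_def)

lemma ennpowr_0 [simp]: "ennpowr 0 a = 0"
  by (simp add: ennpowr_def)

lemma ennpowr_1 [simp]: "ennpowr x 1 = x"
  by (cases x) (auto simp: ennpowr_def)

lemma ennpowr_mono: "x \<le> y \<Longrightarrow> 0 \<le> a \<Longrightarrow> ennpowr x a \<le> ennpowr y a"
  by (cases x; cases y) (auto simp: ennpowr_ennreal top_unique intro!: ennreal_leI powr_mono2)

lemma ennpowr_mult: "ennpowr (x * y) a = ennpowr x a * ennpowr y a"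
proof (cases "x = 0 \<or> y = 0")
  case False
  then have pos: "ennpowr x a \<noteq> 0" "ennpowr y a \<noteq> 0"
    by (cases x; cases y; auto simp: ennpowr_ennreal)+
  show ?thesis
  proof (cases "x = top \<or> y = top")
    case True
    then show ?thesis using False pos by (auto simp: ennreal_mult_top ennreal_top_mult)
  next
    case False
    then obtain r s where "x = ennreal r" "r \<ge> 0" "y = ennreal s" "s \<ge> 0" by (metis ennreal_cases top.not_eq_extremum)
    then show ?thesis by (simp add: ennpowr_ennreal powr_mult flip: ennreal_mult)
  qed
qed auto

lemma ennpowr_ennpowr: "ennpowr (ennpowr x a) b = ennpowr x (a * b)"
  by (cases x) (auto simp: ennpowr_ennreal powr_powr)

lemma ennpowr_inverse: "a > 0 \<Longrightarrow> ennpowr (ennpowr x (1 / a)) a = x" "a > 0 \<Longrightarrow> ennpowr (ennpowr x a) (1 / a) = x"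
  by (simp_all add: ennpowr_ennpowr)

lemma ennpowr_measurable [measurable (raw)]:
  assumes [measurable]: "f \<in> borel_measurable M" shows "(\<lambda>x. ennpowr (f x) a) \<in> borel_measurable M"
  unfolding ennpowr_def by measurable

text \<open>A share z / (x + y) in [0, 1] is at most its own t-th power; apply this to the shares of
  x and y and add.\<close>

lemma powr_add_le: "0 \<le> x \<Longrightarrow> 0 \<le> y \<Longrightarrow> 0 < t \<Longrightarrow> t \<le> 1 \<Longrightarrow> (x + y) powr t \<le> x powr t + y powr (t::real)"
proof (cases "x + y = 0")
  case False
  assume a: "0 \<le> x" "0 \<le> y" "0 < t" "t \<le> 1"
  have "x + y > 0" using a False by linarith
  have le: "(x + y) powr t * (z / (x + y)) \<le> z powr t" if "0 \<le> z" "z \<le> x + y" for z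
  proof -
    have "z / (x + y) = (z / (x + y)) powr 1" using that \<open>x + y > 0\<close> by simp
    also have "\<dots> \<le> (z / (x + y)) powr t"
      using a that \<open>x + y > 0\<close> by (intro powr_mono') (auto simp: divide_le_eq)
    finally have "z / (x + y) \<le> z powr t / (x + y) powr t" using that a by (simp add: powr_divide)
    then show ?thesis using \<open>x + y > 0\<close> by (simp add: field_simps)
  qed
  have "(x + y) powr t = (x + y) powr t * (x / (x + y)) + (x + y) powr t * (y / (x + y))"
    using \<open>x + y > 0\<close> by (simp flip: distrib_left add_divide_distrib)
  also have "\<dots> \<le> x powr t + y powr t" using a by (intro add_mono le) auto
  finally show ?thesis .
qed (auto intro: add_nonneg_nonneg)

lemma powr_sum_le:
  assumes "0 < t" "t \<le> 1" "\<And>i. i \<in> I \<Longrightarrow> 0 \<le> x i"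
  shows "(\<Sum>i\<in>I. x i) powr t \<le> (\<Sum>i\<in>I. x i powr (t::real))"
  using assms(3)
proof (induction I rule: infinite_finite_induct)
  case (insert i I)
  have "(\<Sum>i\<in>insert i I. x i) powr t \<le> x i powr t + (\<Sum>i\<in>I. x i) powr t"
    using insert assms by (auto intro!: powr_add_le sum_nonneg)
  also have "\<dots> \<le> x i powr t + (\<Sum>i\<in>I. x i powr t)" using insert by auto
  finally show ?case using insert by simp
qed auto

text \<open>A counting integral over a countable type as a series over the naturals. Its purpose is
  measurability in a parameter and the reduction to finite partial sums.\<close>

lemma nn_integral_count_space_countable:
  fixes f :: "'k::countable \<Rightarrow> ennreal"
  shows "(\<integral>\<^sup>+k. f k \<partial>count_space UNIV) = (\<Sum>n. if n \<in> range (to_nat :: 'k \<Rightarrow> nat) then f (from_nat n) else 0)"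
proof -
  have "bij_betw (to_nat :: 'k \<Rightarrow> nat) UNIV (range (to_nat :: 'k \<Rightarrow> nat))" by (simp add: bij_betw_def)
  then have "(\<integral>\<^sup>+k. f (from_nat (to_nat (k :: 'k))) \<partial>count_space UNIV) = (\<integral>\<^sup>+n. f (from_nat n) \<partial>count_space (range (to_nat :: 'k \<Rightarrow> nat)))"
    by (rule nn_integral_bij_count_space)
  also have "\<dots> = (\<integral>\<^sup>+n. f (from_nat n) * indicator (range (to_nat :: 'k \<Rightarrow> nat)) n \<partial>count_space UNIV)"
    by (rule nn_integral_count_space_indicator) simp
  also have "\<dots> = (\<Sum>n. f (from_nat n) * indicator (range (to_nat :: 'k \<Rightarrow> nat)) n)"
    by (rule nn_integral_count_space_nat)
  also have "\<dots> = (\<Sum>n. if n \<in> range (to_nat :: 'k \<Rightarrow> nat) then f (from_nat n) else 0)"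
    by (intro suminf_cong) auto
  finally show ?thesis by simp
qed

lemma borel_measurable_nn_integral_count_space [measurable (raw)]:
  fixes f :: "'k::countable \<Rightarrow> 'a \<Rightarrow> ennreal"
  assumes [measurable]: "\<And>k. f k \<in> borel_measurable M"
  shows "(\<lambda>x. \<integral>\<^sup>+k. f k x \<partial>count_space UNIV) \<in> borel_measurable M"
  unfolding nn_integral_count_space_countable by measurable

lemma nn_integral_count_space_le_finite:
  fixes f :: "'k::countable \<Rightarrow> ennreal"
  assumes "\<And>K. finite K \<Longrightarrow> (\<Sum>k\<in>K. f k) \<le> B"
  shows "(\<integral>\<^sup>+k. f k \<partial>count_space UNIV) \<le> B"
  unfolding nn_integral_count_space_countable suminf_eq_SUP
proof (rule SUP_least)
  fix N
  define K where "K = {k :: 'k. to_nat k < N}"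
  have fin: "finite K"
    by (rule finite_subset[OF _ finite_imageI[of "{..<N}" from_nat]]) (auto simp: K_def, metis from_nat_to_nat imageI lessThan_iff)
  have "(\<Sum>n<N. if n \<in> range (to_nat :: 'k \<Rightarrow> nat) then f (from_nat n) else 0) = (\<Sum>n\<in>to_nat ` K. f (from_nat n))"
    by (intro sum.mono_neutral_cong_right) (auto simp: K_def)
  also have "\<dots> = (\<Sum>k\<in>K. f k)" by (subst sum.reindex) auto
  also have "\<dots> \<le> B" by (rule assms[OF fin])
  finally show "(\<Sum>n<N. if n \<in> range (to_nat :: 'k \<Rightarrow> nat) then f (from_nat n) else 0) \<le> B" .
qed

text \<open>A crude substitute for Jensen's inequality: split at the level of the mean,
  \<open>h powr t \<le> \<lambda> powr t + \<lambda> powr (t - 1) * h\<close>.\<close>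

lemma nn_integral_powr_le:
  assumes [measurable]: "w \<in> borel_measurable M" "h \<in> borel_measurable M" and t: "0 < t" "t \<le> 1"
    and V: "(\<integral>\<^sup>+x. w x \<partial>M) \<le> ennreal V" "V \<ge> 0"
  shows "(\<integral>\<^sup>+x. w x * ennpowr (h x) t \<partial>M) \<le> ennreal (V + 1) * ennpowr (\<integral>\<^sup>+x. w x * h x \<partial>M) t"
proof (cases "\<integral>\<^sup>+x. w x * h x \<partial>M")
  case top
  then show ?thesis using V(2) by (simp add: ennreal_mult_top)
next
  case (real l)
  show ?thesis
  proof (cases "l = 0")
    case True
    then have "(\<integral>\<^sup>+x. w x * h x \<partial>M) = 0" using real by simp
    then have "AE x in M. w x * h x = 0" by (subst (asm) nn_integral_0_iff_AE) auto
    then have "AE x in M. w x * ennpowr (h x) t = 0" by (auto elim!: eventually_mono)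
    then have "(\<integral>\<^sup>+x. w x * ennpowr (h x) t \<partial>M) = 0" by (subst nn_integral_0_iff_AE) auto
    then show ?thesis by simp
  next
    case False
    then have l: "l > 0" using real by simp
    have pt: "ennpowr y t \<le> ennreal (l powr t) + ennreal (l powr (t - 1)) * y" for y
    proof (cases y)
      case top then show ?thesis using l by (simp add: ennreal_mult_top)
    next
      case (real r)
      have "r powr t \<le> l powr t + l powr (t - 1) * r"
      proof (cases "r \<le> l")
        case True
        then have "r powr t \<le> l powr t" using real t by (intro powr_mono2) auto
        then show ?thesis using l real by (smt (verit) mult_nonneg_nonneg powr_ge_zero)
      next
        case False
        then have "r > 0" using l by simp
        then have "r powr t = r powr (t - 1) * r" by (simp add: powr_diff)
        also have "\<dots> \<le> l powr (t - 1) * r" using False l t \<open>r > 0\<close> by (intro mult_right_mono powr_mono2') auto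
        finally show ?thesis by (simp add: add_increasing)
      qed
      then show ?thesis using real by (simp add: ennpowr_ennreal flip: ennreal_mult ennreal_plus)
    qed
    have "(\<integral>\<^sup>+x. w x * ennpowr (h x) t \<partial>M) \<le> (\<integral>\<^sup>+x. ennreal (l powr t) * w x + ennreal (l powr (t - 1)) * (w x * h x) \<partial>M)"
    proof (rule nn_integral_mono)
      fix x
      have "w x * ennpowr (h x) t \<le> w x * (ennreal (l powr t) + ennreal (l powr (t - 1)) * h x)"
        by (intro mult_left_mono pt) auto
      then show "w x * ennpowr (h x) t \<le> ennreal (l powr t) * w x + ennreal (l powr (t - 1)) * (w x * h x)"
        by (simp add: distrib_left mult_ac)
    qed
    also have "\<dots> = ennreal (l powr t) * (\<integral>\<^sup>+x. w x \<partial>M) + ennreal (l powr (t - 1)) * ennreal l"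
      using real by (subst nn_integral_add) (auto simp: nn_integral_cmult)
    also have "\<dots> \<le> ennreal (l powr t) * ennreal V + ennreal (l powr (t - 1)) * ennreal l"
      by (intro add_mono mult_left_mono V) auto
    \<comment> \<open>The two parts of the split contribute V and 1 times l^t.\<close>
    also have "\<dots> = ennreal ((V + 1) * l powr t)"
      using l V(2) by (simp add: powr_diff algebra_simps flip: ennreal_mult ennreal_plus)
    also have "\<dots> = ennreal (V + 1) * ennpowr (ennreal l) t"
      using l V(2) by (simp add: ennpowr_ennreal ennreal_mult)
    finally show ?thesis using real by simp
  qed
qed

text \<open>Duality: pairing the vector \<open>B\<close> of integrals with its normalised extremal
  vector \<open>l\<close> recovers the l^t norm \<open>s\<close>, and under the integral the same
  pairing is at most the l^t norm of the integrand. The right-hand side may be infinite, hence the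
  nonnegative integral.\<close>

lemma Minkowski_nn_integral:
  fixes a :: "'k \<Rightarrow> 'a \<Rightarrow> real"
  assumes fin: "finite K" and t: "t \<ge> 1" and a0: "\<And>k x. a k x \<ge> 0"
    and int: "\<And>k. k \<in> K \<Longrightarrow> integrable M (\<lambda>x. a k x * w x)" and w: "\<And>x. w x \<ge> 0"
  shows "ennreal ((\<Sum>k\<in>K. (LINT x|M. a k x * w x) powr t) powr (1 / t)) \<le>
    (\<integral>\<^sup>+x. ennreal ((\<Sum>k\<in>K. a k x powr t) powr (1 / t) * w x) \<partial>M)"
proof -
  define B where "B k = (LINT x|M. a k x * w x)" for k
  have B0: "B k \<ge> 0" for k unfolding B_def using a0 w by (intro integral_nonneg_AE) auto
  define S where "S = (\<Sum>k\<in>K. B k powr t)"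
  have "S \<ge> 0" unfolding S_def by (intro sum_nonneg) auto
  show ?thesis
  proof (cases "S = 0")
    case True then show ?thesis by (simp add: S_def B_def)
  next
    case False
    then have S: "S > 0" using \<open>S \<ge> 0\<close> by simp
    define s where "s = S powr (1 / t)"
    have s: "s > 0" "s powr t = S" using S t by (auto simp: s_def powr_powr)
    \<comment> \<open>The extremal vector of l^t duality, normalised by \<open>s\<close>.\<close>
    define l where "l k = (B k / s) powr (t - 1)" for k
    have l0: "l k \<ge> 0" for k by (simp add: l_def)
    have sumb: "(\<Sum>k\<in>K. (B k / s) powr t) = 1"
      using s S B0 by (simp add: powr_divide S_def flip: sum_divide_distrib)
    \<comment> \<open>Young's inequality for the exponents t and t / (t - 1), written with the
      weights 1 / t and 1 - 1 / t so that t = 1 is included.\<close>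
    have young: "b powr (t - 1) * c \<le> c powr t / t + (1 - 1 / t) * b powr t" if "b \<ge> 0" "c \<ge> 0" for b c
    proof (cases "b = 0 \<or> c = 0")
      case False
      have "(c powr t) powr (1 / t) * (b powr t) powr (1 - 1 / t) \<le> (1 / t) * c powr t + (1 - 1 / t) * b powr t"
        using False t that by (intro Youngs_inequality_0) auto
      moreover have "t * (1 - 1 / t) = t - 1" using t by (simp add: field_simps)
      ultimately show ?thesis using False t that by (simp add: powr_powr mult.commute)
    qed (use t in auto)
    have pw: "(\<Sum>k\<in>K. l k * a k x) \<le> (\<Sum>k\<in>K. a k x powr t) powr (1 / t)" for x
    proof -
      define T where "T = (\<Sum>k\<in>K. a k x powr t) powr (1 / t)"
      have T: "T powr t = (\<Sum>k\<in>K. a k x powr t)" using t by (simp add: T_def powr_powr sum_nonneg)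
      show ?thesis
      proof (cases "T = 0")
        case True
        then have "(\<Sum>k\<in>K. a k x powr t) = 0" using T by simp
        then have "\<forall>k\<in>K. a k x = 0" using fin by (simp add: sum_nonneg_eq_0_iff)
        then show ?thesis by (simp add: sum_nonneg)
      next
        case False
        then have T0: "T > 0" by (simp add: T_def)
        have "(\<Sum>k\<in>K. l k * (a k x / T)) \<le> (\<Sum>k\<in>K. (a k x / T) powr t / t + (1 - 1 / t) * (B k / s) powr t)"
          unfolding l_def using B0 a0 s T0 by (intro sum_mono young) auto
        also have "\<dots> = (\<Sum>k\<in>K. (a k x / T) powr t) / t + (1 - 1 / t) * (\<Sum>k\<in>K. (B k / s) powr t)"
          by (simp add: sum.distrib sum_divide_distrib sum_distrib_left)
        also have "(\<Sum>k\<in>K. (a k x / T) powr t) = (\<Sum>k\<in>K. a k x powr t) / T powr t"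
          using a0 T0 by (simp add: powr_divide sum_divide_distrib)
        also have "\<dots> = 1" using T0 by (simp flip: T)
        finally have "(\<Sum>k\<in>K. l k * (a k x / T)) \<le> 1" unfolding sumb by simp
        then have "(\<Sum>k\<in>K. l k * a k x) / T \<le> 1" by (simp add: sum_divide_distrib)
        then show ?thesis using T0 by (simp add: T_def[symmetric] divide_le_eq)
      qed
    qed
    have "(\<Sum>k\<in>K. l k * B k) = s"
    proof -
      have "l k * B k = s * (B k / s) powr t" for k
        using s B0[of k] by (cases "B k = 0") (auto simp: l_def powr_diff field_simps)
      then show ?thesis using sumb by (simp flip: sum_distrib_left)
    qed
    then have "s = (LINT x|M. (\<Sum>k\<in>K. l k * (a k x * w x)))"
      using int by (simp add: B_def)
    then have "ennreal s = (\<integral>\<^sup>+x. ennreal (\<Sum>k\<in>K. l k * (a k x * w x)) \<partial>M)"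
      using int a0 w l0 by (subst nn_integral_eq_integral) (auto intro!: sum_nonneg)
    also have "\<dots> \<le> (\<integral>\<^sup>+x. ennreal ((\<Sum>k\<in>K. a k x powr t) powr (1 / t) * w x) \<partial>M)"
    proof (intro nn_integral_mono ennreal_leI)
      fix x
      have "(\<Sum>k\<in>K. l k * (a k x * w x)) = (\<Sum>k\<in>K. l k * a k x) * w x" by (simp add: sum_distrib_right mult.assoc)
      also have "\<dots> \<le> (\<Sum>k\<in>K. a k x powr t) powr (1 / t) * w x" by (intro mult_right_mono pw w)
      finally show "(\<Sum>k\<in>K. l k * (a k x * w x)) \<le> (\<Sum>k\<in>K. a k x powr t) powr (1 / t) * w x" .
    qed
    finally show ?thesis by (simp add: s_def S_def B_def)
  qed
qed

section \<open>Power sums and the two regimes of exponents\<close>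

context amalgam
begin

text \<open>The Q-th power of the inner norm, left without its root so that sums over k and
  integrals can be interchanged. The exponent P / Q in \<open>box_integral\<close> then yields the
  P-th power of the Wiener norm.\<close>

definition box_power_sum :: "real \<Rightarrow> 'n functional \<Rightarrow> real ^ 'n \<Rightarrow> ennreal" where
  "box_power_sum Q u x = (\<integral>\<^sup>+k. ennreal (norm (box_fn u k x) powr Q) \<partial>count_space UNIV)"

definition dyadic_power_sum :: "real \<Rightarrow> 'n functional \<Rightarrow> real ^ 'n \<Rightarrow> ennreal" where
  "dyadic_power_sum Q u x = (\<integral>\<^sup>+j. ennreal (norm (dyadic_fn u j x) powr Q) \<partial>count_space UNIV)"

abbreviation box_integral :: "real \<Rightarrow> real \<Rightarrow> 'n functional \<Rightarrow> ennreal" where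
  "box_integral P Q u \<equiv> \<integral>\<^sup>+x. ennpowr (box_power_sum Q u x) (P / Q) \<partial>lborel"

abbreviation dyadic_integral :: "real \<Rightarrow> real \<Rightarrow> 'n functional \<Rightarrow> ennreal" where
  "dyadic_integral P Q u \<equiv> \<integral>\<^sup>+x. ennpowr (dyadic_power_sum Q u x) (P / Q) \<partial>lborel"

abbreviation tail :: "real \<Rightarrow> real ^ 'n \<Rightarrow> ennreal" where
  "tail b y \<equiv> ennreal ((1 + norm y) powr (- b))"

lemma box_fn_measurable: "u \<in> tempered \<Longrightarrow> box_fn u k \<in> borel_measurable borel"
  by (intro borel_measurable_continuous_onI continuous_box_fn)

lemma dyadic_fn_measurable: "u \<in> tempered \<Longrightarrow> dyadic_fn u j \<in> borel_measurable borel"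
  by (intro borel_measurable_continuous_onI continuous_dyadic_fn)

lemma box_power_sum_measurable: "u \<in> tempered \<Longrightarrow> box_power_sum Q u \<in> borel_measurable borel"
  unfolding box_power_sum_def[abs_def] using box_fn_measurable[measurable] by measurable

lemma dyadic_power_sum_measurable: "u \<in> tempered \<Longrightarrow> dyadic_power_sum Q u \<in> borel_measurable borel"
  unfolding dyadic_power_sum_def[abs_def] using dyadic_fn_measurable[measurable] by measurable

lemma box_fn_le_box_power_sum: "Q > 0 \<Longrightarrow> T > 0 \<Longrightarrow> ennreal (norm (box_fn u k x) powr T) \<le> ennpowr (box_power_sum Q u x) (T / Q)"
proof -
  assume "Q > 0" "T > 0"
  have "ennreal (norm (box_fn u k x) powr Q) \<le> box_power_sum Q u x" unfolding box_power_sum_def by (rule nn_integral_ge_point) simp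
  then have "ennpowr (ennreal (norm (box_fn u k x) powr Q)) (T / Q) \<le> ennpowr (box_power_sum Q u x) (T / Q)"
    using \<open>Q > 0\<close> \<open>T > 0\<close> by (intro ennpowr_mono) auto
  then show ?thesis using \<open>Q > 0\<close> by (simp add: ennpowr_ennreal powr_powr)
qed

text \<open>A single box is dominated by the power sum, so it lies in L^P, and band limitation turns
  this into boundedness. This supplies the qualitative hypothesis of the uniform estimates.\<close>

lemma box_fn_bounded_of_finite:
  assumes u: "u \<in> tempered" and P: "0 < P" "P \<le> 1" and Q: "0 < Q"
    and fin: "box_integral P Q u < \<infinity>"
  shows "\<exists>b. \<forall>x. norm (box_fn u k x) \<le> b"
proof (rule box_fn_bounded[OF u P])
  note [measurable] = box_fn_measurable[OF u]
  show "integrable lborel (\<lambda>y. norm (box_fn u k y) powr P)"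
  proof (rule integrableI_bounded)
    have "(\<integral>\<^sup>+y. ennreal (norm (norm (box_fn u k y) powr P)) \<partial>lborel) \<le> box_integral P Q u"
      using box_fn_le_box_power_sum[OF Q P(1)] by (intro nn_integral_mono) simp
    then show "(\<integral>\<^sup>+y. ennreal (norm (norm (box_fn u k y) powr P)) \<partial>lborel) < \<infinity>" using fin by (simp add: le_less_trans)
  qed measurable
qed

lemma piece_fn_bounded:
  assumes u: "u \<in> tempered" and b: "\<And>x. norm (box_fn u k x) \<le> b"
  shows "\<exists>b. \<forall>x. norm (piece_fn u j k x) \<le> b"
proof -
  obtain C where C: "C > 0" "\<And>j. integrable lborel (\<lambda>y. norm (fourier (dyadic_symbol j) y) * (1 + norm y) ^ 0)"
    "\<And>j. (LINT y|lborel. norm (fourier (dyadic_symbol j) y) * (1 + norm y) ^ 0) \<le> C"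
    using dyadic_symbol_kernel_bound[of 0] by metis
  have "norm (piece_fn u j k x) \<le> (C / norm inversion_const) * b * (1 + norm (x - 0)) ^ 0" for x
    by (rule piece_fn_pointwise[OF u _ C(2) C(3)]) (use b in simp)
  then show ?thesis by auto
qed

text \<open>Interchanging the sums leaves, for each box, the number of dyadic scales that it
  meets.\<close>

lemma overlap_sum:
  fixes d :: "int ^ 'n \<Rightarrow> ennreal"
  shows "(\<integral>\<^sup>+j. (\<Sum>k\<in>meeting_boxes j. d k) \<partial>count_space UNIV) \<le> ennreal (CARD('n) + 7) * (\<integral>\<^sup>+k. d k \<partial>count_space UNIV)"
proof -
  have "(\<Sum>k\<in>meeting_boxes j. d k) = (\<integral>\<^sup>+k. d k * indicator (meeting_boxes j) k \<partial>count_space UNIV)" for j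
    by (subst nn_integral_count_space'[of "meeting_boxes j"]) (auto simp: finite_meeting_boxes)
  then have "(\<integral>\<^sup>+j. (\<Sum>k\<in>meeting_boxes j. d k) \<partial>count_space UNIV) = (\<integral>\<^sup>+j. \<integral>\<^sup>+k. d k * indicator (meeting_boxes j) k \<partial>count_space UNIV \<partial>count_space UNIV)" by simp
  also have "\<dots> = (\<integral>\<^sup>+k. \<integral>\<^sup>+j. d k * indicator (meeting_boxes j) k \<partial>count_space UNIV \<partial>count_space UNIV)"
    by (rule nn_integral_count_space_nn_integral) auto
  also have "\<dots> \<le> (\<integral>\<^sup>+k. ennreal (CARD('n) + 7) * d k \<partial>count_space UNIV)"
  proof (rule nn_integral_mono)
    fix k
    have "(\<integral>\<^sup>+j. d k * indicator (meeting_boxes j) k \<partial>count_space UNIV) = (\<Sum>j | k \<in> meeting_boxes j. d k * indicator (meeting_boxes j) k)"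
      by (intro nn_integral_count_space') (auto simp: overlap)
    also have "\<dots> = of_nat (card {j. k \<in> meeting_boxes j}) * d k" by simp
    also have "\<dots> \<le> ennreal (CARD('n) + 7) * d k"
    proof (rule mult_right_mono)
      show "of_nat (card {j. k \<in> meeting_boxes j}) \<le> ennreal (CARD('n) + 7)"
        unfolding ennreal_of_nat_eq_real_of_nat by (intro ennreal_leI of_nat_mono overlap)
    qed simp
    finally show "(\<integral>\<^sup>+j. d k * indicator (meeting_boxes j) k \<partial>count_space UNIV) \<le> ennreal (CARD('n) + 7) * d k" .
  qed
  also have "\<dots> = ennreal (CARD('n) + 7) * (\<integral>\<^sup>+k. d k \<partial>count_space UNIV)" by (rule nn_integral_cmult) simp
  finally show ?thesis .
qed

text \<open>The weight is integrated over its centre z first; by reflection and translation the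
  result is the same for every y.\<close>

lemma weight_Tonelli:
  assumes [measurable]: "H \<in> borel_measurable borel" and b: "b \<ge> 2 * real CARD('n)"
  shows "(\<integral>\<^sup>+z. \<integral>\<^sup>+y. H y * tail b (y - z) \<partial>lborel \<partial>lborel) =
    ennreal (LINT y::real^'n|lborel. (1 + norm y) powr (- b)) * (\<integral>\<^sup>+y. H (y :: real ^ 'n) \<partial>lborel)"
proof -
  have "(\<integral>\<^sup>+z. \<integral>\<^sup>+y. H y * tail b (y - z) \<partial>lborel \<partial>lborel) =
     (\<integral>\<^sup>+y. \<integral>\<^sup>+z. H y * tail b (y - z) \<partial>lborel \<partial>lborel)"
    by (rule lborel_pair.Fubini') measurable
  also have "\<dots> = (\<integral>\<^sup>+y. ennreal (LINT y::real^'n|lborel. (1 + norm y) powr (- b)) * H y \<partial>lborel)"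
  proof (rule nn_integral_cong)
    fix y :: "real ^ 'n"
    have "(\<integral>\<^sup>+z. H y * tail b (y - z) \<partial>lborel) = H y * (\<integral>\<^sup>+z. tail b (y - z) \<partial>lborel)"
      by (rule nn_integral_cmult) measurable
    also have "(\<integral>\<^sup>+z. tail b (y - z) \<partial>lborel) = (\<integral>\<^sup>+(z::real^'n). tail b z \<partial>lborel)"
      using nn_integral_lborel_reflect[of "\<lambda>z::real^'n. tail b z" y] by simp
    also have "\<dots> = ennreal (LINT y::real^'n|lborel. (1 + norm y) powr (- b))"
      using integrable_powr_weight[OF b, of 0] by (intro nn_integral_eq_integral) auto
    finally show "(\<integral>\<^sup>+z. H y * tail b (y - z) \<partial>lborel) = ennreal (LINT y::real^'n|lborel. (1 + norm y) powr (- b)) * H y"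
      by (simp add: mult.commute)
  qed
  also have "\<dots> = ennreal (LINT y::real^'n|lborel. (1 + norm y) powr (- b)) * (\<integral>\<^sup>+y. H y \<partial>lborel)"
    by (rule nn_integral_cmult) measurable
  finally show ?thesis .
qed

lemma local_mean_nn_integral:
  assumes u: "u \<in> tempered" and bd: "\<And>x. norm (box_fn u k x) \<le> b" and a: "a > 0" and La: "L * a \<ge> 2 * real CARD('n)"
  shows "ennreal (local_mean u a L k z) = (\<integral>\<^sup>+y. ennreal (norm (box_fn u k y) powr a) * ennreal ((1 + norm (y - z)) powr (- (L * a))) \<partial>lborel)"
  unfolding local_mean_def ennreal_mult'[symmetric, OF powr_ge_zero]
  by (rule nn_integral_eq_integral[symmetric, OF local_mean_integrable[OF assms]]) auto

text \<open>The Plancherel-Polya bound of a box is passed through the dyadic kernel with the same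
  centre and order, so the constant is independent of \<open>u\<close>, \<open>j\<close> and
  \<open>k\<close>.\<close>

lemma hD_pointwise:
  assumes a: "0 < a" "a \<le> 1" and La: "L * a \<ge> 2 * real CARD('n)"
  obtains C where "C > 0" "\<And>u j k x z b. u \<in> tempered \<Longrightarrow> (\<And>x. norm (box_fn u k x) \<le> b) \<Longrightarrow>
    norm (piece_fn u j k x) \<le> C * local_mean u a L k z powr (1 / a) * (1 + norm (x - z)) ^ L"
proof -
  obtain B where B: "B > 0" "\<And>u k x z b. u \<in> tempered \<Longrightarrow> (\<And>x. norm (box_fn u k x) \<le> b) \<Longrightarrow>
    norm (box_fn u k x) \<le> B * local_mean u a L k z powr (1 / a) * (1 + norm (x - z)) ^ L"
    using box_fn_pointwise[OF assms] by metis
  obtain C where C: "C > 0" "\<And>j. integrable lborel (\<lambda>y. norm (fourier (dyadic_symbol j) y) * (1 + norm y) ^ L)"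
    "\<And>j. (LINT y|lborel. norm (fourier (dyadic_symbol j) y) * (1 + norm y) ^ L) \<le> C"
    using dyadic_symbol_kernel_bound[of L] by metis
  have *: "norm (piece_fn u j k x) \<le> (C / norm inversion_const * B) * local_mean u a L k z powr (1 / a) * (1 + norm (x - z)) ^ L"
    if u: "u \<in> tempered" and bd: "\<And>x. norm (box_fn u k x) \<le> b" for u j k x z b
    using piece_fn_pointwise[OF u B(2)[OF u bd] C(2) C(3), of j x] by (simp add: mult_ac)
  show ?thesis
  proof (rule that[of "C / norm inversion_const * B"])
    show "C / norm inversion_const * B > 0" using B(1) C(1) inversion_const_nonzero by simp
  qed (rule *)
qed

text \<open>As Q \<le> 1, the Q-th power is subadditive over boxes, and the power means with a = Q
  are summed over k by Tonelli. It remains to raise a weighted integral to the power P / Q \<ge> 1: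
  the substitute for Jensen is applied with exponent Q / P to the (P / Q)-th power of the
  integrand.\<close>

lemma sufficiency_large_p:
  assumes Q: "0 < Q" "Q \<le> P" and P: "P \<le> 1"
  shows "\<exists>C::real. C \<ge> 0 \<and> (\<forall>u\<in>tempered. box_integral P Q u < \<infinity> \<longrightarrow>
    dyadic_integral P Q u \<le> ennreal C * box_integral P Q u)"
proof -
  \<comment> \<open>\<open>L\<close> is large enough for the weight of exponent L Q to be
    integrable.\<close>
  obtain L :: nat where "2 * real CARD('n) / Q \<le> L" using real_arch_simple by blast
  then have La: "L * Q \<ge> 2 * real CARD('n)" using Q by (simp add: field_simps)
  have "Q \<le> 1" using Q P by simp
  obtain C where C: "C > 0" "\<And>u j k x z b. u \<in> tempered \<Longrightarrow> (\<And>x. norm (box_fn u k x) \<le> b) \<Longrightarrow>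
    norm (piece_fn u j k x) \<le> C * local_mean u Q L k z powr (1 / Q) * (1 + norm (x - z)) ^ L"
    using hD_pointwise[OF Q(1) \<open>Q \<le> 1\<close> La] by metis
  define V where "V = (LINT y::real^'n|lborel. (1 + norm y) powr (- (L * Q)))"
  have V0: "V \<ge> 0" unfolding V_def by (intro integral_nonneg_AE) auto
  define m where "m = real (CARD('n) + 7)"
  define K where "K = (C powr Q * m) powr (P / Q) * (V + 1) powr (P / Q) * V"
  show ?thesis
  proof (intro exI[of _ K] conjI ballI impI)
    show "K \<ge> 0" unfolding K_def using V0 by simp
    fix u :: "'n functional" assume u: "u \<in> tempered" and fin: "box_integral P Q u < \<infinity>"
    note [measurable] = box_fn_measurable[OF u] box_power_sum_measurable[OF u]
    have "0 < P" using Q by simp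
    obtain b where b: "\<And>k x. norm (box_fn u k x) \<le> b k"
      using box_fn_bounded_of_finite[OF u \<open>0 < P\<close> P Q(1) fin] by metis
    define DD where "DD x = (\<integral>\<^sup>+y. box_power_sum Q u y * tail (L * Q) (y - x) \<partial>lborel)" for x
    have DD: "(\<integral>\<^sup>+k. ennreal (local_mean u Q L k x) \<partial>count_space UNIV) = DD x" for x
    proof -
      have "(\<integral>\<^sup>+k. ennreal (local_mean u Q L k x) \<partial>count_space UNIV) = (\<integral>\<^sup>+k. \<integral>\<^sup>+y. ennreal (norm (box_fn u k y) powr Q) * tail (L * Q) (y - x) \<partial>lborel \<partial>count_space UNIV)"
        by (simp add: local_mean_nn_integral[OF u b Q(1) La])
      also have "\<dots> = (\<integral>\<^sup>+y. \<integral>\<^sup>+k. ennreal (norm (box_fn u k y) powr Q) * tail (L * Q) (y - x) \<partial>count_space UNIV \<partial>lborel)"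
        by (rule nn_integral_count_space_nn_integral[symmetric]) auto
      also have "\<dots> = DD x" unfolding DD_def box_power_sum_def by (intro nn_integral_cong nn_integral_multc) simp
      finally show ?thesis .
    qed
    have G: "dyadic_power_sum Q u x \<le> ennreal (C powr Q * m) * DD x" for x
    proof -
      have "ennreal (norm (dyadic_fn u j x) powr Q) \<le> ennreal (C powr Q) * (\<Sum>k\<in>meeting_boxes j. ennreal (local_mean u Q L k x))" for j
      proof -
        have "norm (dyadic_fn u j x) powr Q \<le> (\<Sum>k\<in>meeting_boxes j. norm (piece_fn u j k x)) powr Q"
          unfolding dyadic_fn_decompose[OF u] using Q by (intro powr_mono2 norm_sum) auto
        also have "\<dots> \<le> (\<Sum>k\<in>meeting_boxes j. norm (piece_fn u j k x) powr Q)"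
          using Q(1) \<open>Q \<le> 1\<close> by (intro powr_sum_le) auto
        also have "\<dots> \<le> (\<Sum>k\<in>meeting_boxes j. C powr Q * local_mean u Q L k x)"
        proof (rule sum_mono)
          fix k
          \<comment> \<open>The centre is taken at x itself, so the growth factor of the pointwise
            bound is 1.\<close>
          have "norm (piece_fn u j k x) powr Q \<le> (C * local_mean u Q L k x powr (1 / Q)) powr Q"
            using C(2)[OF u b, of j k x x] Q by (intro powr_mono2) auto
          then show "norm (piece_fn u j k x) powr Q \<le> C powr Q * local_mean u Q L k x"
            using C(1) Q local_mean_nonneg[of u Q L k x] by (simp add: powr_mult powr_powr)
        qed
        finally have "norm (dyadic_fn u j x) powr Q \<le> C powr Q * (\<Sum>k\<in>meeting_boxes j. local_mean u Q L k x)" by (simp flip: sum_distrib_left)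
        then have "ennreal (norm (dyadic_fn u j x) powr Q) \<le> ennreal (C powr Q * (\<Sum>k\<in>meeting_boxes j. local_mean u Q L k x))" by (rule ennreal_leI)
        also have "\<dots> = ennreal (C powr Q) * ennreal (\<Sum>k\<in>meeting_boxes j. local_mean u Q L k x)" by (simp add: ennreal_mult')
        also have "ennreal (\<Sum>k\<in>meeting_boxes j. local_mean u Q L k x) = (\<Sum>k\<in>meeting_boxes j. ennreal (local_mean u Q L k x))"
          by (rule sum_ennreal[symmetric]) (rule local_mean_nonneg)
        finally show ?thesis .
      qed
      then have "dyadic_power_sum Q u x \<le> (\<integral>\<^sup>+j. ennreal (C powr Q) * (\<Sum>k\<in>meeting_boxes j. ennreal (local_mean u Q L k x)) \<partial>count_space UNIV)"
        unfolding dyadic_power_sum_def by (intro nn_integral_mono) auto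
      also have "\<dots> = ennreal (C powr Q) * (\<integral>\<^sup>+j. (\<Sum>k\<in>meeting_boxes j. ennreal (local_mean u Q L k x)) \<partial>count_space UNIV)"
        by (rule nn_integral_cmult) simp
      also have "\<dots> \<le> ennreal (C powr Q) * (ennreal m * (\<integral>\<^sup>+k. ennreal (local_mean u Q L k x) \<partial>count_space UNIV))"
        unfolding m_def by (intro mult_left_mono overlap_sum) auto
      finally show ?thesis by (simp add: DD ennreal_mult' mult.assoc m_def)
    qed
    have DP: "ennpowr (DD x) (P / Q) \<le> ennreal ((V + 1) powr (P / Q)) * (\<integral>\<^sup>+y. ennpowr (box_power_sum Q u y) (P / Q) * tail (L * Q) (y - x) \<partial>lborel)" for x
    proof -
      define w where "w y = tail (L * Q) (y - x)" for y
      have [measurable]: "w \<in> borel_measurable borel" unfolding w_def by measurable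
      have wV: "(\<integral>\<^sup>+y. w y \<partial>lborel) \<le> ennreal V"
      proof -
        have "(\<integral>\<^sup>+y. w y \<partial>lborel) = ennreal (LINT y|lborel. (1 + norm (y - x)) powr (- (L * Q)))"
          unfolding w_def using integrable_powr_weight[OF La] by (intro nn_integral_eq_integral) auto
        also have "(LINT y|lborel. (1 + norm (y - x)) powr (- (L * Q))) = V"
          unfolding V_def using lborel_integral_translate[of "\<lambda>y. (1 + norm y) powr (- (L * Q))" "- x"] by simp
        finally show ?thesis by simp
      qed
      have "DD x = (\<integral>\<^sup>+y. w y * ennpowr (ennpowr (box_power_sum Q u y) (P / Q)) (Q / P) \<partial>lborel)"
        using Q \<open>0 < P\<close> by (simp add: DD_def w_def ennpowr_ennpowr mult.commute)
      also have "\<dots> \<le> ennreal (V + 1) * ennpowr (\<integral>\<^sup>+y. w y * ennpowr (box_power_sum Q u y) (P / Q) \<partial>lborel) (Q / P)"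
        using Q \<open>0 < P\<close> by (intro nn_integral_powr_le wV V0) auto
      finally have "ennpowr (DD x) (P / Q) \<le> ennpowr (ennreal (V + 1) * ennpowr (\<integral>\<^sup>+y. w y * ennpowr (box_power_sum Q u y) (P / Q) \<partial>lborel) (Q / P)) (P / Q)"
        using Q \<open>0 < P\<close> by (intro ennpowr_mono) auto
      also have "\<dots> = ennreal ((V + 1) powr (P / Q)) * (\<integral>\<^sup>+y. w y * ennpowr (box_power_sum Q u y) (P / Q) \<partial>lborel)"
        using Q V0 \<open>0 < P\<close> by (simp add: ennpowr_mult ennpowr_ennpowr ennpowr_ennreal del: ennreal_plus)
      finally show ?thesis by (simp add: w_def mult.commute)
    qed
    have "dyadic_integral P Q u \<le> (\<integral>\<^sup>+x. ennreal ((C powr Q * m) powr (P / Q) * (V + 1) powr (P / Q)) *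
       (\<integral>\<^sup>+y. ennpowr (box_power_sum Q u y) (P / Q) * tail (L * Q) (y - x) \<partial>lborel) \<partial>lborel)"
    proof (rule nn_integral_mono)
      fix x
      have "ennpowr (dyadic_power_sum Q u x) (P / Q) \<le> ennpowr (ennreal (C powr Q * m) * DD x) (P / Q)"
        using Q \<open>0 < P\<close> by (intro ennpowr_mono G) auto
      also have "\<dots> = ennreal ((C powr Q * m) powr (P / Q)) * ennpowr (DD x) (P / Q)"
        by (simp add: ennpowr_mult ennpowr_ennreal m_def)
      also have "\<dots> \<le> ennreal ((C powr Q * m) powr (P / Q)) * (ennreal ((V + 1) powr (P / Q)) * (\<integral>\<^sup>+y. ennpowr (box_power_sum Q u y) (P / Q) * tail (L * Q) (y - x) \<partial>lborel))"
        by (intro mult_left_mono DP) auto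
      finally show "ennpowr (dyadic_power_sum Q u x) (P / Q) \<le> ennreal ((C powr Q * m) powr (P / Q) * (V + 1) powr (P / Q)) *
       (\<integral>\<^sup>+y. ennpowr (box_power_sum Q u y) (P / Q) * tail (L * Q) (y - x) \<partial>lborel)"
        by (simp add: ennreal_mult' mult.assoc)
    qed
    also have "\<dots> = ennreal ((C powr Q * m) powr (P / Q) * (V + 1) powr (P / Q)) *
       (\<integral>\<^sup>+x. (\<integral>\<^sup>+y. ennpowr (box_power_sum Q u y) (P / Q) * tail (L * Q) (y - x) \<partial>lborel) \<partial>lborel)"
      by (rule nn_integral_cmult) measurable
    also have "\<dots> = ennreal ((C powr Q * m) powr (P / Q) * (V + 1) powr (P / Q)) * (ennreal V * box_integral P Q u)"
      unfolding V_def by (subst weight_Tonelli) (use La in auto)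
    also have "\<dots> = ennreal K * box_integral P Q u"
      unfolding K_def using V0 by (simp add: ennreal_mult' mult.assoc)
    finally show "dyadic_integral P Q u \<le> ennreal K * box_integral P Q u" .
  qed
qed

end

context amalgam
begin

text \<open>On the ball of radius \<delta> the spectral weight is at least \<open>c\<close>, so the
  weighted orthogonality estimate controls the plain local L^2 norm. Each box piece is then replaced
  by its pointwise bound centred at z, whose polynomial growth is integrable against the spectral
  weight.\<close>

lemma local_power_bound:
  assumes P: "0 < P" "P \<le> 1" and La: "L * P \<ge> 2 * real CARD('n)"
  obtains \<delta> K where "\<delta> > 0" "K \<ge> 0"
    "\<forall>u\<in>tempered. \<forall>j z b. (\<forall>k x. norm (box_fn u k x) \<le> b k) \<longrightarrow>
      (\<integral>\<^sup>+x. (if dist z x < \<delta> then 1 else 0) * ennreal ((norm (dyadic_fn u j x))\<^sup>2) \<partial>lborel) \<le> ennreal (K * (\<Sum>k\<in>meeting_boxes j. local_mean u P L k z powr (2 / P)))"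
proof -
  obtain C where C: "C > 0" "\<And>u j k x z b. u \<in> tempered \<Longrightarrow> (\<And>x. norm (box_fn u k x) \<le> b) \<Longrightarrow>
    norm (piece_fn u j k x) \<le> C * local_mean u P L k z powr (1 / P) * (1 + norm (x - z)) ^ L"
    using hD_pointwise[OF P La] by metis
  obtain c \<delta> where c: "c > 0" "\<delta> > 0" "\<And>x. norm x < \<delta> \<Longrightarrow> spectral_weight x \<ge> c" using spectral_weight_lower by metis
  define N0 where "N0 = real (card {d :: int ^ 'n. norm (lattice_point d) \<le> 3 * real CARD('n) + 4})"
  have Wint: "integrable lborel (\<lambda>x. spectral_weight x * ((1 + norm x) ^ L)\<^sup>2)"
  proof -
    have "integrable lborel (\<lambda>x. complex_of_real ((1 + norm x) ^ (2 * L)) * complex_of_real (spectral_weight (x - 0)))"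
      by (rule integrable_poly_growth[OF spectral_weight_schwartz, of _ 1 "2 * L"]) (auto simp del: of_real_power of_real_add)
    then have "integrable lborel (\<lambda>x. Re (complex_of_real ((1 + norm x) ^ (2 * L) * spectral_weight x)))"
      by (intro integrable_Re) (simp del: of_real_power of_real_add)
    then show ?thesis by (simp add: mult.commute power_mult[symmetric] del: of_real_power of_real_add)
  qed
  define W where "W = (LINT x|lborel. spectral_weight x * ((1 + norm x) ^ L)\<^sup>2)"
  have W0: "W \<ge> 0" unfolding W_def by (intro integral_nonneg_AE) (auto simp: spectral_weight_nonneg)
  \<comment> \<open>\<open>N0\<close> comes from orthogonality, the square of \<open>C\<close> from
    the pointwise bound, \<open>W\<close> from its growth against the spectral weight, and
    \<open>c\<close> from the lower bound on the ball.\<close>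
  define K where "K = N0 * (C\<^sup>2 * W) / c"
  show ?thesis
  proof (rule that[of \<delta> K], goal_cases)
    case 2
    show "K \<ge> 0" unfolding K_def N0_def using c W0 by simp
  next
    case 3
    show ?case
    proof (intro ballI allI impI)
      fix u :: "'n functional" and j z b assume u: "u \<in> tempered" and b': "\<forall>k x. norm (box_fn u k x) \<le> b k"
      then have b: "\<And>k x. norm (box_fn u k x) \<le> b k" by blast
      note [measurable] = box_fn_measurable[OF u] dyadic_fn_measurable[OF u]
      note ortho = local_L2_orthogonality[OF u piece_fn_bounded[OF u b], where j=j and z=z, folded N0_def]
      have hk: "(LINT x|lborel. spectral_weight (x - z) * (norm (piece_fn u j k x))\<^sup>2) \<le> C\<^sup>2 * W * local_mean u P L k z powr (2 / P)" for k
      proof -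
        have "norm (LINT x|lborel. spectral_weight (x - z) * (norm (piece_fn u j k x))\<^sup>2) \<le> (LINT x|lborel. (C\<^sup>2 * local_mean u P L k z powr (2 / P)) * (spectral_weight (x - z) * ((1 + norm (x - z)) ^ L)\<^sup>2))"
        proof (rule norm_lebesgue_integral_le)
          show "integrable lborel (\<lambda>x. (C\<^sup>2 * local_mean u P L k z powr (2 / P)) * (spectral_weight (x - z) * ((1 + norm (x - z)) ^ L)\<^sup>2))"
            using lborel_integrable_translate[OF Wint, of "- z"] by (intro integrable_mult_right) simp
          fix x
          have sq: "(local_mean u P L k z powr (1 / P))\<^sup>2 = local_mean u P L k z powr (2 / P)"
            by (simp add: power2_eq_square flip: powr_add)
          have "(norm (piece_fn u j k x))\<^sup>2 \<le> (C * local_mean u P L k z powr (1 / P) * (1 + norm (x - z)) ^ L)\<^sup>2"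
            by (intro power_mono C(2)[OF u b]) auto
          also have "\<dots> = C\<^sup>2 * local_mean u P L k z powr (2 / P) * ((1 + norm (x - z)) ^ L)\<^sup>2"
            by (simp only: power_mult_distrib sq)
          finally have "spectral_weight (x - z) * (norm (piece_fn u j k x))\<^sup>2 \<le> spectral_weight (x - z) * (C\<^sup>2 * local_mean u P L k z powr (2 / P) * ((1 + norm (x - z)) ^ L)\<^sup>2)"
            by (intro mult_left_mono spectral_weight_nonneg)
          then show "norm (spectral_weight (x - z) * (norm (piece_fn u j k x))\<^sup>2) \<le> (C\<^sup>2 * local_mean u P L k z powr (2 / P)) * (spectral_weight (x - z) * ((1 + norm (x - z)) ^ L)\<^sup>2)"
            using spectral_weight_nonneg[of "x - z"] by (simp add: abs_mult mult_ac)
        qed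
        also have "\<dots> = (C\<^sup>2 * local_mean u P L k z powr (2 / P)) * (LINT x|lborel. spectral_weight (x - z) * ((1 + norm (x - z)) ^ L)\<^sup>2)"
          by (rule integral_mult_right_zero)
        also have "(LINT x|lborel. spectral_weight (x - z) * ((1 + norm (x - z)) ^ L)\<^sup>2) = W"
          unfolding W_def using lborel_integral_translate[of "\<lambda>x. spectral_weight x * ((1 + norm x) ^ L)\<^sup>2" "- z"] by simp
        finally show ?thesis by (simp add: mult_ac)
      qed
      have "(\<integral>\<^sup>+x. (if dist z x < \<delta> then 1 else 0) * ennreal ((norm (dyadic_fn u j x))\<^sup>2) \<partial>lborel) \<le> (\<integral>\<^sup>+x. ennreal ((spectral_weight (x - z) * (norm (dyadic_fn u j x))\<^sup>2) / c) \<partial>lborel)"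
      proof (rule nn_integral_mono)
        fix x
        show "(if dist z x < \<delta> then 1 else 0) * ennreal ((norm (dyadic_fn u j x))\<^sup>2) \<le> ennreal ((spectral_weight (x - z) * (norm (dyadic_fn u j x))\<^sup>2) / c)"
        proof (cases "dist z x < \<delta>")
          case True
          then have "c \<le> spectral_weight (x - z)" using c(3)[of "x - z"] by (simp add: dist_norm norm_minus_commute)
          then have "c * (norm (dyadic_fn u j x))\<^sup>2 \<le> spectral_weight (x - z) * (norm (dyadic_fn u j x))\<^sup>2"
            by (rule mult_right_mono) simp
          then have "(norm (dyadic_fn u j x))\<^sup>2 \<le> (spectral_weight (x - z) * (norm (dyadic_fn u j x))\<^sup>2) / c"
            using c(1) by (simp add: le_divide_eq mult.commute)
          then show ?thesis using True by (simp add: ennreal_leI)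
        qed simp
      qed
      also have "\<dots> = ennreal (LINT x|lborel. (spectral_weight (x - z) * (norm (dyadic_fn u j x))\<^sup>2) / c)"
        using ortho(2) c(1) by (intro nn_integral_eq_integral) (auto simp: spectral_weight_nonneg)
      also have "\<dots> = ennreal ((LINT x|lborel. spectral_weight (x - z) * (norm (dyadic_fn u j x))\<^sup>2) / c)" by simp
      also have "\<dots> \<le> ennreal (K * (\<Sum>k\<in>meeting_boxes j. local_mean u P L k z powr (2 / P)))"
      proof (rule ennreal_leI)
        have "(LINT x|lborel. spectral_weight (x - z) * (norm (dyadic_fn u j x))\<^sup>2) \<le> N0 * (\<Sum>k\<in>meeting_boxes j. C\<^sup>2 * W * local_mean u P L k z powr (2 / P))"
          by (rule order_trans[OF ortho(1)]) (intro mult_left_mono sum_mono hk, simp add: N0_def)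
        also have "\<dots> = N0 * (C\<^sup>2 * W) * (\<Sum>k\<in>meeting_boxes j. local_mean u P L k z powr (2 / P))" by (simp add: sum_distrib_left mult_ac)
        finally show "(LINT x|lborel. spectral_weight (x - z) * (norm (dyadic_fn u j x))\<^sup>2) / c \<le> K * (\<Sum>k\<in>meeting_boxes j. local_mean u P L k z powr (2 / P))"
          using c(1) by (simp add: K_def divide_right_mono)
      qed
      finally show "(\<integral>\<^sup>+x. (if dist z x < \<delta> then 1 else 0) * ennreal ((norm (dyadic_fn u j x))\<^sup>2) \<partial>lborel) \<le> ennreal (K * (\<Sum>k\<in>meeting_boxes j. local_mean u P L k z powr (2 / P)))" .
    qed
  qed (use c in auto)
qed

text \<open>All local means integrate the P-th power of a box against the same weight, so Minkowski
  with exponent Q / P \<ge> 1 moves the norm over the boxes inside that integral. The version for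
  finite sets suffices, since a counting integral is bounded by any common bound of its finite
  partial sums.\<close>

lemma local_mean_Minkowski:
  assumes u: "u \<in> tempered" and b: "\<And>k x. norm (box_fn u k x) \<le> b k"
    and P: "0 < P" "P \<le> Q" and La: "L * P \<ge> 2 * real CARD('n)"
  shows "ennpowr (\<integral>\<^sup>+k. ennreal (local_mean u P L k z powr (Q / P)) \<partial>count_space UNIV) (P / Q)
    \<le> (\<integral>\<^sup>+y. ennpowr (box_power_sum Q u y) (P / Q) * tail (L * P) (y - z) \<partial>lborel)"
proof -
  define R where "R = (\<integral>\<^sup>+y. ennpowr (box_power_sum Q u y) (P / Q) * tail (L * P) (y - z) \<partial>lborel)"
  define t where "t = Q / P"
  have t: "t \<ge> 1" "1 / t = P / Q" "P * t = Q" using P by (auto simp: t_def)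
  have "(\<integral>\<^sup>+k. ennreal (local_mean u P L k z powr t) \<partial>count_space UNIV) \<le> ennpowr R t"
  proof (rule nn_integral_count_space_le_finite)
    fix K :: "(int ^ 'n) set" assume K: "finite K"
    have local_mean0: "(\<Sum>k\<in>K. local_mean u P L k z powr t) \<ge> 0" by (intro sum_nonneg) auto
    have "ennreal ((\<Sum>k\<in>K. local_mean u P L k z powr t) powr (1 / t)) \<le>
      (\<integral>\<^sup>+y. ennreal ((\<Sum>k\<in>K. (norm (box_fn u k y) powr P) powr t) powr (1 / t) * (1 + norm (y - z)) powr (- (L * P))) \<partial>lborel)"
      unfolding local_mean_def by (intro Minkowski_nn_integral K t local_mean_integrable[OF u b P(1) La]) auto
    also have "\<dots> \<le> R"
      unfolding R_def
    proof (rule nn_integral_mono)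
      fix y
      have "(\<Sum>k\<in>K. ennreal (norm (box_fn u k y) powr Q)) \<le> box_power_sum Q u y"
      proof -
        have "(\<Sum>k\<in>K. ennreal (norm (box_fn u k y) powr Q)) = (\<integral>\<^sup>+k. ennreal (norm (box_fn u k y) powr Q) * indicator K k \<partial>count_space UNIV)"
          using K by (subst nn_integral_count_space'[of K]) auto
        also have "\<dots> \<le> box_power_sum Q u y" unfolding box_power_sum_def by (intro nn_integral_mono) (auto simp: indicator_def)
        finally show ?thesis .
      qed
      then have "ennpowr (\<Sum>k\<in>K. ennreal (norm (box_fn u k y) powr Q)) (P / Q) \<le> ennpowr (box_power_sum Q u y) (P / Q)"
        using P by (intro ennpowr_mono) auto
      moreover have "ennreal ((\<Sum>k\<in>K. (norm (box_fn u k y) powr P) powr t) powr (1 / t)) = ennpowr (\<Sum>k\<in>K. ennreal (norm (box_fn u k y) powr Q)) (P / Q)"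
        by (simp add: powr_powr t ennpowr_ennreal sum_nonneg)
      ultimately show "ennreal ((\<Sum>k\<in>K. (norm (box_fn u k y) powr P) powr t) powr (1 / t) * (1 + norm (y - z)) powr (- (L * P)))
         \<le> ennpowr (box_power_sum Q u y) (P / Q) * tail (L * P) (y - z)"
        by (simp add: ennreal_mult' mult_right_mono)
    qed
    finally have "ennpowr (ennreal ((\<Sum>k\<in>K. local_mean u P L k z powr t) powr (1 / t))) t \<le> ennpowr R t"
      using t by (intro ennpowr_mono) auto
    then show "(\<Sum>k\<in>K. ennreal (local_mean u P L k z powr t)) \<le> ennpowr R t"
      using t(1) local_mean0 by (simp add: ennpowr_ennreal powr_powr)
  qed
  then have "ennpowr (\<integral>\<^sup>+k. ennreal (local_mean u P L k z powr t) \<partial>count_space UNIV) (P / Q) \<le> ennpowr (ennpowr R t) (P / Q)"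
    using P by (intro ennpowr_mono) auto
  also have "\<dots> = R" using P by (simp add: ennpowr_ennpowr t_def)
  finally show ?thesis by (simp add: R_def t_def)
qed

text \<open>A point x lies in the ball around z exactly when z lies in the ball around x, so
  integrating local integrals over all centres returns the global integral times the volume.\<close>

lemma ball_average:
  assumes [measurable]: "H \<in> borel_measurable borel" and d: "\<delta> > 0"
  shows "(\<integral>\<^sup>+z. \<integral>\<^sup>+x. (if dist z x < \<delta> then 1 else 0) * H x \<partial>lborel \<partial>lborel) =
    ennreal (unit_ball_vol (real CARD('n)) * \<delta> ^ CARD('n)) * (\<integral>\<^sup>+x. H (x :: real ^ 'n) \<partial>lborel)"
proof -
  have "(\<integral>\<^sup>+z. \<integral>\<^sup>+x. (if dist z x < \<delta> then 1 else 0) * H x \<partial>lborel \<partial>lborel) =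
    (\<integral>\<^sup>+x. \<integral>\<^sup>+z. (if dist z x < \<delta> then 1 else 0) * H x \<partial>lborel \<partial>lborel)"
    by (rule lborel_pair.Fubini') measurable
  also have "\<dots> = (\<integral>\<^sup>+x. ennreal (unit_ball_vol (real CARD('n)) * \<delta> ^ CARD('n)) * H x \<partial>lborel)"
  proof (rule nn_integral_cong)
    fix x :: "real ^ 'n"
    have "(\<integral>\<^sup>+z. (if dist z x < \<delta> then 1 else 0) * H x \<partial>lborel) = (\<integral>\<^sup>+z. H x * indicator (ball x \<delta>) z \<partial>lborel)"
      by (intro nn_integral_cong) (auto simp: indicator_def dist_commute)
    also have "\<dots> = H x * emeasure lborel (ball x \<delta>)"
      by (rule nn_integral_cmult_indicator) simp
    finally show "(\<integral>\<^sup>+z. (if dist z x < \<delta> then 1 else 0) * H x \<partial>lborel) = ennreal (unit_ball_vol (real CARD('n)) * \<delta> ^ CARD('n)) * H x"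
      using d by (simp add: emeasure_ball mult.commute)
  qed
  also have "\<dots> = ennreal (unit_ball_vol (real CARD('n)) * \<delta> ^ CARD('n)) * (\<integral>\<^sup>+x. H x \<partial>lborel)"
    by (rule nn_integral_cmult) measurable
  finally show ?thesis .
qed

text \<open>All estimates are local to a ball around z until the final averaging over z. On a ball,
  lowering an exponent costs only a constant: from 2 to Q at each scale, which is where Q \<le> 2
  enters, and from Q to P after summing over the scales.\<close>

lemma sufficiency_small_p:
  assumes P: "0 < P" "P \<le> 1" and Q: "P \<le> Q" "Q \<le> 2"
  shows "\<exists>C::real. C \<ge> 0 \<and> (\<forall>u\<in>tempered. box_integral P Q u < \<infinity> \<longrightarrow>
    dyadic_integral P Q u \<le> ennreal C * box_integral P Q u)"
proof -
  have Q0: "0 < Q" using P Q by simp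
  obtain L :: nat where "2 * real CARD('n) / P \<le> L" using real_arch_simple by blast
  then have La: "L * P \<ge> 2 * real CARD('n)" using P by (simp add: field_simps)
  obtain \<delta> K where K: "\<delta> > 0" "K \<ge> 0"
    "\<forall>u\<in>tempered. \<forall>j z b. (\<forall>k x. norm (box_fn u k x) \<le> b k) \<longrightarrow>
      (\<integral>\<^sup>+x. (if dist z x < \<delta> then 1 else 0) * ennreal ((norm (dyadic_fn u j x))\<^sup>2) \<partial>lborel) \<le> ennreal (K * (\<Sum>k\<in>meeting_boxes j. local_mean u P L k z powr (2 / P)))"
    using local_power_bound[OF P La] by blast
  define B where "B = unit_ball_vol (real CARD('n)) * \<delta> ^ CARD('n)"
  have B: "B > 0" using K(1) by (simp add: B_def)
  define V where "V = (LINT y::real^'n|lborel. (1 + norm y) powr (- (L * P)))"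
  have V0: "V \<ge> 0" unfolding V_def by (intro integral_nonneg_AE) auto
  define m where "m = real (CARD('n) + 7)"
  \<comment> \<open>\<open>B + 1\<close> is the price of lowering an exponent on a ball of volume
    \<open>B\<close>, and \<open>m\<close> the overlap between boxes and scales.\<close>
  define K1 where "K1 = (B + 1) * K powr (Q / 2)"
  define K2 where "K2 = (B + 1) * (K1 * m) powr (P / Q)"
  have K1: "K1 \<ge> 0" and K2: "K2 \<ge> 0" using B by (auto simp: K1_def K2_def)
  show ?thesis
  proof (intro exI[of _ "K2 * V / B"] conjI ballI impI)
    show "K2 * V / B \<ge> 0" using V0 B K2 by simp
    fix u :: "'n functional" assume u: "u \<in> tempered" and fin: "box_integral P Q u < \<infinity>"
    note [measurable] = box_fn_measurable[OF u] dyadic_fn_measurable[OF u] box_power_sum_measurable[OF u] dyadic_power_sum_measurable[OF u]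
    obtain b where b: "\<And>k x. norm (box_fn u k x) \<le> b k"
      using box_fn_bounded_of_finite[OF u P Q0 fin] by metis
    define w where "w z x = (if dist z x < \<delta> then 1 else 0 :: ennreal)" for z x :: "real ^ 'n"
    have [measurable]: "w z \<in> borel_measurable borel" for z unfolding w_def by measurable
    have wB: "(\<integral>\<^sup>+x. w z x \<partial>lborel) \<le> ennreal B" for z
    proof -
      have "(\<integral>\<^sup>+x. w z x \<partial>lborel) = (\<integral>\<^sup>+x. indicator (ball z \<delta>) x \<partial>lborel)"
        by (intro nn_integral_cong) (auto simp: w_def indicator_def)
      then show ?thesis using K(1) by (simp add: emeasure_ball B_def)
    qed
    have gQ: "(\<integral>\<^sup>+x. w z x * ennreal (norm (dyadic_fn u j x) powr Q) \<partial>lborel) \<le> ennreal K1 * (\<Sum>k\<in>meeting_boxes j. ennreal (local_mean u P L k z powr (Q / P)))" for j z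
    proof -
      have "(\<integral>\<^sup>+x. w z x * ennreal (norm (dyadic_fn u j x) powr Q) \<partial>lborel) = (\<integral>\<^sup>+x. w z x * ennpowr (ennreal ((norm (dyadic_fn u j x))\<^sup>2)) (Q / 2) \<partial>lborel)"
      proof (intro nn_integral_cong arg_cong2[where f="(*)"] refl)
        fix x
        have "((norm (dyadic_fn u j x))\<^sup>2) powr (Q / 2) = norm (dyadic_fn u j x) powr Q"
          by (cases "dyadic_fn u j x = 0") (auto simp: powr_powr simp flip: powr_numeral)
        then show "ennreal (norm (dyadic_fn u j x) powr Q) = ennpowr (ennreal ((norm (dyadic_fn u j x))\<^sup>2)) (Q / 2)"
          by (simp add: ennpowr_ennreal)
      qed
      also have "\<dots> \<le> ennreal (B + 1) * ennpowr (\<integral>\<^sup>+x. w z x * ennreal ((norm (dyadic_fn u j x))\<^sup>2) \<partial>lborel) (Q / 2)"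
        using B Q Q0 by (intro nn_integral_powr_le wB) auto
      also have "\<dots> \<le> ennreal (B + 1) * ennpowr (ennreal (K * (\<Sum>k\<in>meeting_boxes j. local_mean u P L k z powr (2 / P)))) (Q / 2)"
        using K(3) u b Q0 unfolding w_def by (intro mult_left_mono ennpowr_mono) auto
      also have "\<dots> = ennreal ((B + 1) * (K * (\<Sum>k\<in>meeting_boxes j. local_mean u P L k z powr (2 / P))) powr (Q / 2))"
        using K(2) B by (subst ennpowr_ennreal) (auto simp: sum_nonneg ennreal_mult' simp del: ennreal_plus)
      also have "\<dots> \<le> ennreal (K1 * (\<Sum>k\<in>meeting_boxes j. local_mean u P L k z powr (Q / P)))"
      proof (rule ennreal_leI)
        \<comment> \<open>Subadditivity of the power Q / 2 \<le> 1 is the passage from the l^2 norm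
          over the boxes to the l^Q norm.\<close>
        have "(\<Sum>k\<in>meeting_boxes j. local_mean u P L k z powr (2 / P)) powr (Q / 2) \<le> (\<Sum>k\<in>meeting_boxes j. (local_mean u P L k z powr (2 / P)) powr (Q / 2))"
          using Q Q0 by (intro powr_sum_le) auto
        also have "\<dots> = (\<Sum>k\<in>meeting_boxes j. local_mean u P L k z powr (Q / P))" by (simp add: powr_powr)
        finally have "K powr (Q / 2) * (\<Sum>k\<in>meeting_boxes j. local_mean u P L k z powr (2 / P)) powr (Q / 2) \<le> K powr (Q / 2) * (\<Sum>k\<in>meeting_boxes j. local_mean u P L k z powr (Q / P))"
          by (rule mult_left_mono) simp
        then show "(B + 1) * (K * (\<Sum>k\<in>meeting_boxes j. local_mean u P L k z powr (2 / P))) powr (Q / 2) \<le> K1 * (\<Sum>k\<in>meeting_boxes j. local_mean u P L k z powr (Q / P))"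
          using K(2) B by (simp add: K1_def powr_mult sum_nonneg mult.assoc)
      qed
      also have "\<dots> = ennreal K1 * (\<Sum>k\<in>meeting_boxes j. ennreal (local_mean u P L k z powr (Q / P)))"
        using K1 by (simp add: ennreal_mult')
      finally show ?thesis .
    qed
    have wG: "(\<integral>\<^sup>+x. w z x * dyadic_power_sum Q u x \<partial>lborel) \<le> ennreal (K1 * m) * (\<integral>\<^sup>+k. ennreal (local_mean u P L k z powr (Q / P)) \<partial>count_space UNIV)" for z
    proof -
      have "(\<integral>\<^sup>+x. w z x * dyadic_power_sum Q u x \<partial>lborel) = (\<integral>\<^sup>+x. \<integral>\<^sup>+j. w z x * ennreal (norm (dyadic_fn u j x) powr Q) \<partial>count_space UNIV \<partial>lborel)"
        unfolding dyadic_power_sum_def by (intro nn_integral_cong nn_integral_cmult[symmetric]) simp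
      also have "\<dots> = (\<integral>\<^sup>+j. \<integral>\<^sup>+x. w z x * ennreal (norm (dyadic_fn u j x) powr Q) \<partial>lborel \<partial>count_space UNIV)"
        by (rule nn_integral_count_space_nn_integral) auto
      also have "\<dots> \<le> (\<integral>\<^sup>+j. ennreal K1 * (\<Sum>k\<in>meeting_boxes j. ennreal (local_mean u P L k z powr (Q / P))) \<partial>count_space UNIV)"
        by (intro nn_integral_mono gQ)
      also have "\<dots> = ennreal K1 * (\<integral>\<^sup>+j. (\<Sum>k\<in>meeting_boxes j. ennreal (local_mean u P L k z powr (Q / P))) \<partial>count_space UNIV)"
        by (rule nn_integral_cmult) simp
      also have "\<dots> \<le> ennreal K1 * (ennreal m * (\<integral>\<^sup>+k. ennreal (local_mean u P L k z powr (Q / P)) \<partial>count_space UNIV))"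
        unfolding m_def by (intro mult_left_mono overlap_sum) auto
      finally show ?thesis using K1 by (simp add: ennreal_mult' mult.assoc)
    qed
    have inner: "(\<integral>\<^sup>+x. w z x * ennpowr (dyadic_power_sum Q u x) (P / Q) \<partial>lborel) \<le>
       ennreal K2 * (\<integral>\<^sup>+y. ennpowr (box_power_sum Q u y) (P / Q) * tail (L * P) (y - z) \<partial>lborel)" for z
    proof -
      have "(\<integral>\<^sup>+x. w z x * ennpowr (dyadic_power_sum Q u x) (P / Q) \<partial>lborel) \<le> ennreal (B + 1) * ennpowr (\<integral>\<^sup>+x. w z x * dyadic_power_sum Q u x \<partial>lborel) (P / Q)"
        using B P Q Q0 by (intro nn_integral_powr_le wB) auto
      also have "\<dots> \<le> ennreal (B + 1) * ennpowr (ennreal (K1 * m) * (\<integral>\<^sup>+k. ennreal (local_mean u P L k z powr (Q / P)) \<partial>count_space UNIV)) (P / Q)"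
        using P Q0 by (intro mult_left_mono ennpowr_mono wG) auto
      also have "\<dots> = ennreal K2 * ennpowr (\<integral>\<^sup>+k. ennreal (local_mean u P L k z powr (Q / P)) \<partial>count_space UNIV) (P / Q)"
      proof -
        have "0 \<le> K1 * m" using K1 by (simp add: m_def)
        moreover have "ennreal K2 = ennreal (B + 1) * ennreal ((K1 * m) powr (P / Q))"
          unfolding K2_def using B by (intro ennreal_mult) auto
        ultimately show ?thesis by (simp only: ennpowr_mult[of "ennreal (K1 * m)"] ennpowr_ennreal mult.assoc)
      qed
      also have "\<dots> \<le> ennreal K2 * (\<integral>\<^sup>+y. ennpowr (box_power_sum Q u y) (P / Q) * tail (L * P) (y - z) \<partial>lborel)"
        by (intro mult_left_mono local_mean_Minkowski[OF u b P(1) Q(1) La]) auto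
      finally show ?thesis .
    qed
    have "ennreal B * dyadic_integral P Q u = (\<integral>\<^sup>+z. \<integral>\<^sup>+x. w z x * ennpowr (dyadic_power_sum Q u x) (P / Q) \<partial>lborel \<partial>lborel)"
      unfolding w_def B_def using K(1) by (intro ball_average[symmetric]) auto
    also have "\<dots> \<le> (\<integral>\<^sup>+z. ennreal K2 * (\<integral>\<^sup>+y. ennpowr (box_power_sum Q u y) (P / Q) * tail (L * P) (y - z) \<partial>lborel) \<partial>lborel)"
      by (intro nn_integral_mono inner)
    also have "\<dots> = ennreal K2 * (\<integral>\<^sup>+z. (\<integral>\<^sup>+y. ennpowr (box_power_sum Q u y) (P / Q) * tail (L * P) (y - z) \<partial>lborel) \<partial>lborel)"
      by (rule nn_integral_cmult) measurable
    also have "\<dots> = ennreal K2 * (ennreal V * box_integral P Q u)"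
      unfolding V_def by (subst weight_Tonelli) (use La in auto)
    finally have le: "ennreal B * dyadic_integral P Q u \<le> ennreal K2 * (ennreal V * box_integral P Q u)" .
    have "dyadic_integral P Q u = ennreal (1 / B) * (ennreal B * dyadic_integral P Q u)"
      using B by (simp add: mult.assoc[symmetric] flip: ennreal_mult)
    also have "\<dots> \<le> ennreal (1 / B) * (ennreal K2 * (ennreal V * box_integral P Q u))"
      by (intro mult_left_mono le) auto
    also have "\<dots> = ennreal (K2 * V / B) * box_integral P Q u"
      using B V0 K2 by (simp add: mult.assoc[symmetric] flip: ennreal_mult)
    finally show "dyadic_integral P Q u \<le> ennreal (K2 * V / B) * box_integral P Q u" .
  qed
qed

end

text \<open>Every a_j is at most the l^Q norm. If s < 0, the weights then form a convergent
  geometric series. Otherwise Q \<le> r, and for finite r = R the R-th power is split into exponents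
  Q and R - Q, the second factor being bounded by the norm. For infinite r the first remark
  suffices.\<close>

lemma weighted_lp_bound:
  fixes s Q :: real and r :: ennreal
  assumes Q: "Q > 0" and r: "0 < r" and s: "s \<le> 0" and cond: "ennreal Q \<le> r \<or> s < 0"
  shows "\<exists>C::real. C \<ge> 0 \<and> (\<forall>a :: nat \<Rightarrow> real. (\<forall>j. a j \<ge> 0) \<longrightarrow>
    lp_norm r (\<lambda>j. ennreal (2 powr (real j * s) * a j)) \<le> ennreal C * ennpowr (\<integral>\<^sup>+j. ennreal (a j powr Q) \<partial>count_space UNIV) (1 / Q))"
proof -
  define N where "N a = ennpowr (\<integral>\<^sup>+j. ennreal (a j powr Q) \<partial>count_space UNIV) (1 / Q)" for a :: "nat \<Rightarrow> real"
  have aN: "ennreal (a j) \<le> N a" if "\<And>j. a j \<ge> 0" for a j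
  proof -
    have "ennreal (a j powr Q) \<le> (\<integral>\<^sup>+j. ennreal (a j powr Q) \<partial>count_space UNIV)" by (rule nn_integral_ge_point) simp
    then have "ennpowr (ennreal (a j powr Q)) (1 / Q) \<le> N a"
      unfolding N_def using Q by (intro ennpowr_mono) auto
    then show ?thesis using Q that[of j] by (simp add: ennpowr_ennreal powr_powr)
  qed
  have p1: "2 powr (real j * s) \<le> 1" for j
  proof -
    have "2 powr (real j * s) \<le> 2 powr (0::real)" using s by (intro powr_mono) (auto simp: mult_nonneg_nonpos)
    then show ?thesis by simp
  qed
  have le_a: "2 powr (real j * s) * a j \<le> a j" if "a j \<ge> 0" for a j
    using mult_right_mono[OF p1[of j] that] by simp
  show ?thesis
  proof (cases "r = \<infinity>")
    case True
    have "lp_norm r (\<lambda>j. ennreal (2 powr (real j * s) * a j)) \<le> ennreal 1 * N a" if a: "\<And>j. a j \<ge> 0" for a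
    proof -
      have "esssup (count_space UNIV) (\<lambda>j. ennreal (2 powr (real j * s) * a j)) \<le> N a"
        by (rule esssup_I) (auto simp: AE_count_space intro!: order_trans[OF ennreal_leI[OF le_a] aN] a)
      then show ?thesis using True by (simp add: Lp_norm_def)
    qed
    then show ?thesis unfolding N_def by (intro exI[of _ 1]) auto
  next
    case False
    define R where "R = enn2real r"
    have R: "r = ennreal R" "R > 0" using r False by (auto simp: R_def enn2real_positive_iff less_top)
    have lp: "lp_norm r (\<lambda>j. ennreal (2 powr (real j * s) * a j)) = ennpowr (\<integral>\<^sup>+j. ennreal ((2 powr (real j * s) * a j) powr R) \<partial>count_space UNIV) (1 / R)"
      if a: "\<And>j. a j \<ge> 0" for a
      using False a by (simp add: Lp_norm_def R_def[symmetric] ennpowr_ennreal)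
    \<comment> \<open>The common last step: a bound for the R-th power with constant
      \<open>C\<close> gives the norm bound with constant \<open>C powr (1 / R)\<close>.\<close>
    have red: "lp_norm r (\<lambda>j. ennreal (2 powr (real j * s) * a j)) \<le> ennreal (C powr (1 / R)) * N a"
      if "\<And>j. a j \<ge> 0" "C \<ge> 0" "(\<integral>\<^sup>+j. ennreal ((2 powr (real j * s) * a j) powr R) \<partial>count_space UNIV) \<le> ennreal C * ennpowr (N a) R" for C a
    proof -
      have "lp_norm r (\<lambda>j. ennreal (2 powr (real j * s) * a j)) \<le> ennpowr (ennreal C * ennpowr (N a) R) (1 / R)"
        unfolding lp[OF that(1)] using R that(3) by (intro ennpowr_mono) auto
      also have "\<dots> = ennreal (C powr (1 / R)) * N a"
        using R that(2) by (simp add: ennpowr_mult ennpowr_ennpowr ennpowr_ennreal)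
      finally show ?thesis .
    qed
    show ?thesis
    proof (cases "s < 0")
      case True
      define x where "x = 2 powr (s * R)"
      have x: "0 < x" "x < 1" using True R using powr_less_mono[of "s * R" 0 2] by (auto simp: x_def mult_neg_pos)
      have geo: "2 powr (real j * s * R) = x ^ j" for j
        by (simp add: x_def powr_power mult_ac)
      have sumx: "(\<integral>\<^sup>+j. ennreal (x ^ j) \<partial>count_space UNIV) = ennreal (1 / (1 - x))"
        unfolding nn_integral_count_space_nat
        using x geometric_sums[of x] by (subst suminf_ennreal2) (auto simp: sums_iff)
      have "lp_norm r (\<lambda>j. ennreal (2 powr (real j * s) * a j)) \<le> ennreal ((1 / (1 - x)) powr (1 / R)) * N a" if a: "\<And>j. a j \<ge> 0" for a
      proof (rule red[OF a])
        show "0 \<le> 1 / (1 - x)" using x by simp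
        have "(\<integral>\<^sup>+j. ennreal ((2 powr (real j * s) * a j) powr R) \<partial>count_space UNIV) \<le> (\<integral>\<^sup>+j. ennreal (x ^ j) * ennpowr (N a) R \<partial>count_space UNIV)"
        proof (rule nn_integral_mono)
          fix j
          have "ennreal ((2 powr (real j * s) * a j) powr R) = ennreal (x ^ j) * ennpowr (ennreal (a j)) R"
            using a[of j] x by (simp add: powr_mult powr_powr geo ennpowr_ennreal ennreal_mult')
          also have "\<dots> \<le> ennreal (x ^ j) * ennpowr (N a) R"
            using R by (intro mult_left_mono ennpowr_mono aN a) auto
          finally show "ennreal ((2 powr (real j * s) * a j) powr R) \<le> ennreal (x ^ j) * ennpowr (N a) R" .
        qed
        also have "\<dots> = ennreal (1 / (1 - x)) * ennpowr (N a) R"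
          by (subst nn_integral_multc) (auto simp: sumx)
        finally show "(\<integral>\<^sup>+j. ennreal ((2 powr (real j * s) * a j) powr R) \<partial>count_space UNIV) \<le> ennreal (1 / (1 - x)) * ennpowr (N a) R" .
      qed
      then show ?thesis unfolding N_def by (intro exI[of _ "(1 / (1 - x)) powr (1 / R)"]) auto
    next
      case False
      then have QR: "Q \<le> R" using cond R by (simp add: ennreal_le_iff)
      have "lp_norm r (\<lambda>j. ennreal (2 powr (real j * s) * a j)) \<le> ennreal (1 powr (1 / R)) * N a" if a: "\<And>j. a j \<ge> 0" for a
      proof (rule red[OF a])
        have eq: "t powr R = t powr Q * t powr (R - Q)" if "t \<ge> 0" for t :: real
          by (simp flip: powr_add)
        have "(\<integral>\<^sup>+j. ennreal ((2 powr (real j * s) * a j) powr R) \<partial>count_space UNIV) \<le> (\<integral>\<^sup>+j. ennreal (a j powr Q) * ennpowr (N a) (R - Q) \<partial>count_space UNIV)"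
        proof (rule nn_integral_mono)
          fix j
          have "ennreal ((2 powr (real j * s) * a j) powr R) \<le> ennreal (a j powr R)"
            using a[of j] R by (intro ennreal_leI powr_mono2 le_a) auto
          also have "\<dots> = ennreal (a j powr Q) * ennpowr (ennreal (a j)) (R - Q)"
            using a[of j] by (simp add: eq ennpowr_ennreal ennreal_mult')
          also have "\<dots> \<le> ennreal (a j powr Q) * ennpowr (N a) (R - Q)"
            using QR by (intro mult_left_mono ennpowr_mono aN a) auto
          finally show "ennreal ((2 powr (real j * s) * a j) powr R) \<le> ennreal (a j powr Q) * ennpowr (N a) (R - Q)" .
        qed
        also have "\<dots> = ennpowr (N a) Q * ennpowr (N a) (R - Q)"
          by (subst nn_integral_multc) (use Q in \<open>auto simp: N_def ennpowr_inverse\<close>)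
        also have "\<dots> = ennreal 1 * ennpowr (N a) R"
          using Q by (cases "N a") (auto simp: ennpowr_ennreal eq ennreal_top_mult simp flip: ennreal_mult)
        finally show "(\<integral>\<^sup>+j. ennreal ((2 powr (real j * s) * a j) powr R) \<partial>count_space UNIV) \<le> ennreal 1 * ennpowr (N a) R" .
      qed simp
      then show ?thesis unfolding N_def by (intro exI[of _ 1]) auto
    qed
  qed
qed

section \<open>The norms in terms of power sums, and the embedding\<close>

context amalgam
begin

abbreviation weighted_norm :: "ennreal \<Rightarrow> real \<Rightarrow> 'n functional \<Rightarrow> real ^ 'n \<Rightarrow> ennreal" where
  "weighted_norm r s u x \<equiv> lp_norm r (\<lambda>j. ennreal (2 powr (real j * s) * norm (dyadic_fn u j x)))"

lemma wiener_norm_eq: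
  assumes "u \<in> tempered" "P > 0" "Q > 0"
  shows "wiener_norm \<sigma> (ennreal P) (ennreal Q) u = ennpowr (box_integral P Q u) (1 / P)"
  using assms by (simp add: wiener_norm_def dist_function_box Lp_norm_def ennpowr_ennreal ennpowr_ennpowr box_power_sum_def)

lemma triebel_norm_eq:
  assumes "u \<in> tempered" "P > 0"
  shows "triebel_norm \<psi> s (ennreal P) r u = ennpowr (\<integral>\<^sup>+x. ennpowr (weighted_norm r s u x) P \<partial>lborel) (1 / P)"
  using assms by (simp add: triebel_norm_def dist_function_triangle Lp_norm_def[of lborel])

lemma sufficiency:
  fixes r :: ennreal and s P Q :: real
  assumes P: "0 < P" "P \<le> 1" and Q: "0 < Q" "Q \<le> 2" and r: "0 < r"
    and s: "s \<le> 0" and cond: "ennreal Q \<le> r \<or> s < 0"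
  shows "embeds (wiener_norm \<sigma> (ennreal P) (ennreal Q)) (triebel_norm \<psi> s (ennreal P) r)"
proof -
  have "\<exists>C::real. C \<ge> 0 \<and> (\<forall>u\<in>tempered. box_integral P Q u < \<infinity> \<longrightarrow>
    dyadic_integral P Q u \<le> ennreal C * box_integral P Q u)"
  proof (cases "Q \<le> P")
    case True then show ?thesis by (intro sufficiency_large_p P Q)
  next
    case False then show ?thesis by (intro sufficiency_small_p P Q) simp
  qed
  then obtain C :: real where C: "C \<ge> 0" "\<And>u. u \<in> tempered \<Longrightarrow> box_integral P Q u < \<infinity> \<Longrightarrow>
    dyadic_integral P Q u \<le> ennreal C * box_integral P Q u"
    by blast
  obtain K :: real where K: "K \<ge> 0" "\<And>a :: nat \<Rightarrow> real. (\<And>j. a j \<ge> 0) \<Longrightarrow>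
    lp_norm r (\<lambda>j. ennreal (2 powr (real j * s) * a j)) \<le> ennreal K * ennpowr (\<integral>\<^sup>+j. ennreal (a j powr Q) \<partial>count_space UNIV) (1 / Q)"
    using weighted_lp_bound[OF Q(1) r s cond] by auto
  define M where "M = K * C powr (1 / P)"
  have bound: "triebel_norm \<psi> s (ennreal P) r u \<le> ennreal M * wiener_norm \<sigma> (ennreal P) (ennreal Q) u"
    if u: "u \<in> tempered" and fin: "wiener_norm \<sigma> (ennreal P) (ennreal Q) u < \<infinity>" for u
  proof -
    note [measurable] = dyadic_power_sum_measurable[OF u]
    define S where "S = box_integral P Q u"
    have W: "wiener_norm \<sigma> (ennreal P) (ennreal Q) u = ennpowr S (1 / P)"
      unfolding S_def by (rule wiener_norm_eq[OF u P(1) Q(1)])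
    have "S < \<infinity>"
      using fin P unfolding W by (cases S) auto
    have "(\<integral>\<^sup>+x. ennpowr (weighted_norm r s u x) P \<partial>lborel) \<le>
      (\<integral>\<^sup>+x. ennreal (K powr P) * ennpowr (dyadic_power_sum Q u x) (P / Q) \<partial>lborel)"
    proof (rule nn_integral_mono)
      fix x
      have "ennpowr (weighted_norm r s u x) P \<le> ennpowr (ennreal K * ennpowr (dyadic_power_sum Q u x) (1 / Q)) P"
        unfolding dyadic_power_sum_def using P by (intro ennpowr_mono K(2)) auto
      then show "ennpowr (weighted_norm r s u x) P \<le> ennreal (K powr P) * ennpowr (dyadic_power_sum Q u x) (P / Q)"
        using K(1) by (simp add: ennpowr_mult ennpowr_ennpowr ennpowr_ennreal)
    qed
    also have "\<dots> = ennreal (K powr P) * dyadic_integral P Q u"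
      by (rule nn_integral_cmult) measurable
    also have "\<dots> \<le> ennreal (K powr P) * (ennreal C * S)"
      using C(2)[OF u] \<open>S < \<infinity>\<close> unfolding S_def by (intro mult_left_mono) auto
    finally have "triebel_norm \<psi> s (ennreal P) r u \<le> ennpowr (ennreal (K powr P) * (ennreal C * S)) (1 / P)"
      unfolding triebel_norm_eq[OF u P(1)] using P by (intro ennpowr_mono) auto
    also have "\<dots> = ennreal M * ennpowr S (1 / P)"
      using K(1) C(1) P by (simp add: ennpowr_mult ennpowr_ennreal powr_powr M_def ennreal_mult' mult.assoc)
    finally show ?thesis unfolding W .
  qed
  show ?thesis
    unfolding embeds_def space_of_def
  proof (intro conjI exI[of _ M] ballI subsetI)
    fix u assume "u \<in> {u \<in> tempered. wiener_norm \<sigma> (ennreal P) (ennreal Q) u < \<infinity>}"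
    then have u: "u \<in> tempered" "wiener_norm \<sigma> (ennreal P) (ennreal Q) u < \<infinity>" by auto
    show "triebel_norm \<psi> s (ennreal P) r u \<le> ennreal M * wiener_norm \<sigma> (ennreal P) (ennreal Q) u" by (rule bound[OF u])
    also have "\<dots> < \<infinity>" using u(2) by (simp add: ennreal_mult_less_top)
    finally show "u \<in> {u \<in> tempered. triebel_norm \<psi> s (ennreal P) r u < \<infinity>}" using u by simp
  qed
qed

end

section \<open>Necessity\<close>

context triebel
begin

lemma fourier_inv_fourier:
  fixes b :: "real ^ 'n \<Rightarrow> complex"
  assumes "b \<in> schwartz" shows "fourier (inv_fourier b) \<xi> = inversion_const * b \<xi>"
proof -
  have "fourier (inv_fourier b) \<xi> = (LINT x|lborel. unit_char (- ((0 - x) \<bullet> \<xi>)) * inv_fourier b (0 - x))"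
    unfolding fourier_eq[of "inv_fourier b"] by (rule lborel_integral_reflect[symmetric])
  also have "\<dots> = inv_fourier (fourier b) \<xi>"
    by (simp add: inv_fourier_eq[of "fourier b"] inv_fourier_fourier[of b] inner_commute)
  finally show ?thesis by (simp add: fourier_inversion[OF assms])
qed

text \<open>Extended by 0 outside the Schwartz space, as the encoding of tempered distributions
  demands.\<close>

definition of_function :: "(real ^ 'n \<Rightarrow> complex) \<Rightarrow> 'n functional" where
  "of_function G \<phi> = (if \<phi> \<in> schwartz then LINT x|lborel. G x * \<phi> x else 0)"

lemma of_function_tempered:
  assumes G: "G \<in> schwartz" shows "of_function G \<in> tempered"
proof -
  have int: "integrable lborel (\<lambda>x. G x * \<phi> x)" if "\<phi> \<in> schwartz" for \<phi>
    by (intro schwartz_integrable schwartz_mult G that)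
  have "of_function G (\<lambda>x. a * \<phi> x + b * \<theta> x) = a * of_function G \<phi> + b * of_function G \<theta>"
    if "\<phi> \<in> schwartz" "\<theta> \<in> schwartz" for \<phi> \<theta> a b
  proof -
    have "G x * (a * \<phi> x + b * \<theta> x) = a * (G x * \<phi> x) + b * (G x * \<theta> x)" for x by (simp add: algebra_simps)
    then show ?thesis
      using that int[OF that(1)] int[OF that(2)] schwartz_add[OF schwartz_cmult schwartz_cmult, OF that, of a b]
      by (simp add: of_function_def)
  qed
  moreover have "norm (of_function G \<phi>) \<le> (LINT x|lborel. norm (G x)) * schwartz_seminorm 0 \<phi>" if \<phi>: "\<phi> \<in> schwartz" for \<phi>
  proof -
    obtain B where "\<And>x. norm (\<phi> x) \<le> B" using schwartz_bounded[OF \<phi>] by metis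
    then have bdd: "bdd_above ((\<lambda>(is, x). (1 + norm x) ^ 0 * norm (partial_derivs is \<phi> x)) ` ({is. length is \<le> 0} \<times> UNIV))"
      by (intro bdd_aboveI[of _ B]) auto
    have le: "norm (\<phi> x) \<le> schwartz_seminorm 0 \<phi>" for x
      unfolding schwartz_seminorm_def by (rule cSUP_upper2[OF bdd, of "([], x)"]) auto
    have "norm (LINT x|lborel. G x * \<phi> x) \<le> (LINT x|lborel. norm (G x) * schwartz_seminorm 0 \<phi>)"
      by (rule norm_lebesgue_integral_le)
        (auto simp: norm_mult intro!: mult_left_mono le integrable_mult_left integrable_norm schwartz_integrable G)
    then show ?thesis using \<phi> by (simp add: of_function_def)
  qed
  ultimately show ?thesis
    unfolding tempered_def by (auto simp: of_function_def intro!: exI[of _ 0] exI[of _ "LINT x|lborel. norm (G x)"])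
qed

text \<open>The multiplication formula moves the transform back onto the prescribed
  \<open>B\<close>, so the pieces are inverse transforms of products of symbols; the factor is the
  unnormalised constant of inversion.\<close>

lemma of_function_multiplier:
  assumes B: "B \<in> schwartz" and m: "m \<in> schwartz"
  shows "of_function (inv_fourier B) (\<lambda>y. fourier m (y - x)) = inversion_const * inv_fourier (\<lambda>\<xi>. m \<xi> * B \<xi>) x"
proof -
  have mm: "(\<lambda>\<xi>. unit_char (x \<bullet> \<xi>) * m \<xi>) \<in> schwartz" by (rule schwartz_modulate[OF m])
  have "of_function (inv_fourier B) (\<lambda>y. fourier m (y - x)) = (LINT y|lborel. fourier (\<lambda>\<xi>. unit_char (x \<bullet> \<xi>) * m \<xi>) y * inv_fourier B y)"
    using schwartz_translate'[OF fourier_schwartz[OF m]]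
    by (simp only: of_function_def if_True fourier_modulate mult.commute[of "inv_fourier B _"])
  also have "\<dots> = (LINT \<xi>|lborel. (unit_char (x \<bullet> \<xi>) * m \<xi>) * fourier (inv_fourier B) \<xi>)"
    by (intro fourier_multiplication schwartz_integrable mm inv_fourier_schwartz B)
  also have "\<dots> = (LINT \<xi>|lborel. inversion_const * (unit_char (x \<bullet> \<xi>) * (m \<xi> * B \<xi>)))"
    by (simp add: fourier_inv_fourier[OF B] mult_ac)
  also have "\<dots> = inversion_const * inv_fourier (\<lambda>\<xi>. m \<xi> * B \<xi>) x"
    unfolding inv_fourier_eq by (rule integral_mult_right_zero)
  finally show ?thesis .
qed

lemma inv_fourier_translate: "inv_fourier (\<lambda>\<xi>. F (\<xi> - p)) x = unit_char (x \<bullet> p) * inv_fourier F x"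
proof -
  have "inv_fourier (\<lambda>\<xi>. F (\<xi> - p)) x = (LINT \<xi>|lborel. unit_char (x \<bullet> (\<xi> + p)) * F (\<xi> + p - p))"
    unfolding inv_fourier_eq by (rule lborel_integral_translate[symmetric])
  also have "\<dots> = (LINT \<xi>|lborel. unit_char (x \<bullet> p) * (unit_char (x \<bullet> \<xi>) * F \<xi>))"
    by (simp add: inner_add_right unit_char_add mult_ac)
  also have "\<dots> = unit_char (x \<bullet> p) * inv_fourier F x" unfolding inv_fourier_eq by (rule integral_mult_right_zero)
  finally show ?thesis .
qed

text \<open>The dilation by 8 brings the support radius 2 of \<psi> down to 1/4. Since a box symbol
  reaches only 3/4 in every coordinate, such a bump at a lattice point meets one box only.\<close>

definition small_bump :: "real ^ 'n \<Rightarrow> real" where "small_bump \<xi> = \<psi> (8 *\<^sub>R \<xi>)"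

lemma small_bump_props: "small_bump \<xi> \<ge> 0" "norm \<xi> \<ge> 1 / 4 \<Longrightarrow> small_bump \<xi> = 0" "small_bump 0 = 1"
  using psi_props(1,3,4) by (auto simp: small_bump_def)

lemma small_bump_schwartz: "(\<lambda>\<xi>. complex_of_real (small_bump \<xi>)) \<in> schwartz"
  using schwartz_scale[OF psi_schwartz, of 8] by (simp add: psi_def small_bump_def)

lemma small_bump_integrable: "integrable lborel small_bump"
  using integrable_Re[OF schwartz_integrable[OF small_bump_schwartz]] by simp

lemma small_bump_integral_pos: "(LINT \<xi>|lborel. small_bump \<xi>) > 0"
proof (rule integral_pos_continuous[of _ 0])
  show "continuous_on UNIV small_bump"
    unfolding small_bump_def by (intro continuous_on_compose2[OF continuous_on_psi] continuous_intros) auto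
qed (use small_bump_props small_bump_integrable in auto)

lemma continuous_dyadic_piece: "continuous_on UNIV (\<lambda>\<xi>. \<psi> \<xi> - \<psi> (2 *\<^sub>R \<xi>))"
  by (intro continuous_intros continuous_on_compose2[OF continuous_on_psi]) auto

end

lemma cos_ge_half: "\<bar>t\<bar> \<le> 1 / 6 \<Longrightarrow> Re (unit_char t) \<ge> 1 / 2"
proof -
  assume "\<bar>t\<bar> \<le> 1 / 6"
  then have "\<bar>2 * pi * t\<bar> \<le> pi / 3" by (auto simp: abs_mult field_simps)
  then have "cos (pi / 3) \<le> cos \<bar>2 * pi * t\<bar>" by (intro cos_monotone_0_pi_le) auto
  then show ?thesis by (simp add: unit_char_def cos_60)
qed

section \<open>Test distributions with frequencies at powers of two\<close>

context amalgam
begin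

text \<open>\<open>undefined\<close> serves as an arbitrary fixed index.\<close>

definition some_coord :: 'n where "some_coord = undefined"

text \<open>A lattice point of norm 2^j. For j > 0 the dyadic symbol of index j equals 1 there,
  since a unit vector e has \<psi>(e) = 1 and \<psi>(2e) = 0.\<close>

definition dyadic_site :: "nat \<Rightarrow> int ^ 'n" where "dyadic_site j = axis some_coord (2 ^ j)"

definition unit_some_coord :: "real ^ 'n" where "unit_some_coord = axis some_coord 1"

lemma lattice_dyadic_site: "lattice_point (dyadic_site j) = 2 ^ j *\<^sub>R unit_some_coord"
  by (auto simp: lattice_point_def dyadic_site_def unit_some_coord_def axis_def vec_eq_iff)

lemma norm_unit_some_coord: "norm unit_some_coord = 1"
  by (simp add: unit_some_coord_def norm_axis_1)

lemma norm_lattice_dyadic_site: "norm (lattice_point (dyadic_site j)) = 2 ^ j"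
  by (simp add: lattice_dyadic_site norm_unit_some_coord)

lemma inj_dyadic_site: "inj dyadic_site"
proof
  fix i j assume "dyadic_site i = dyadic_site j"
  then have "norm (lattice_point (dyadic_site i)) = norm (lattice_point (dyadic_site j))" by simp
  then show "i = j" by (simp add: norm_lattice_dyadic_site)
qed

definition bump :: "nat \<Rightarrow> real ^ 'n \<Rightarrow> complex" where
  "bump j \<xi> = of_real (small_bump (\<xi> - lattice_point (dyadic_site j)))"

lemma bump_schwartz: "bump j \<in> schwartz"
  using schwartz_translate'[OF small_bump_schwartz] by (simp add: bump_def[abs_def])

text \<open>In each coordinate the distances add up to less than 1/4 + 3/4 = 1, so only the lattice
  point at the centre of the bump can have a box symbol that is nonzero on it. The partition of
  unity then forces that symbol to be 1 there.\<close>

lemma box_symbol_bump: "box_symbol k \<xi> * bump j \<xi> = (if k = dyadic_site j then bump j \<xi> else 0)"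
proof (cases "bump j \<xi> = 0")
  case False
  then have small: "norm (\<xi> - lattice_point (dyadic_site j)) < 1 / 4"
    using small_bump_props(2) unfolding bump_def by (metis not_le of_real_0)
  have zero: "box_symbol l \<xi> = 0" if "l \<noteq> dyadic_site j" for l
  proof (rule ccontr)
    assume "box_symbol l \<xi> \<noteq> 0"
    then have c: "(\<xi> - lattice_point l) $ i \<in> {-3/4..3/4}" for i
      using wiener unfolding wiener_window_def box_symbol_def by blast
    have "l $ i = dyadic_site j $ i" for i
    proof -
      have "\<bar>(\<xi> - lattice_point (dyadic_site j)) $ i\<bar> < 1 / 4"
        using component_le_norm_cart[of "\<xi> - lattice_point (dyadic_site j)" i] small by linarith
      then have "\<bar>\<xi> $ i - real_of_int (dyadic_site j $ i)\<bar> < 1 / 4" by (simp add: lattice_point_def)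
      moreover have "- 3 / 4 \<le> \<xi> $ i - real_of_int (l $ i)" "\<xi> $ i - real_of_int (l $ i) \<le> 3 / 4"
        using c[of i] by (simp_all add: lattice_point_def)
      ultimately have "\<bar>real_of_int (l $ i) - real_of_int (dyadic_site j $ i)\<bar> < 1" by linarith
      then show ?thesis by linarith
    qed
    then show False using that by (simp add: vec_eq_iff)
  qed
  have "((\<lambda>k. box_symbol k \<xi>) has_sum 1) UNIV"
    using wiener by (simp add: wiener_window_def box_symbol_def)
  then have "((\<lambda>k. box_symbol k \<xi>) has_sum 1) {dyadic_site j}"
    by (subst has_sum_cong_neutral[where T=UNIV and g="\<lambda>k. box_symbol k \<xi>"]) (use zero in auto)
  then have "box_symbol (dyadic_site j) \<xi> = 1"
    using has_sum_finite[of "{dyadic_site j}" "\<lambda>k. box_symbol k \<xi>"] has_sum_unique by fastforce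
  then show ?thesis using zero by auto
qed simp

definition bump_sum :: "nat set \<Rightarrow> real ^ 'n \<Rightarrow> complex" where "bump_sum J \<xi> = (\<Sum>j\<in>J. bump j \<xi>)"

lemma bump_sum_schwartz: "bump_sum J \<in> schwartz"
  unfolding bump_sum_def[abs_def] by (intro schwartz_sum bump_schwartz)

definition test_dist :: "nat set \<Rightarrow> 'n functional" where "test_dist J = of_function (inv_fourier (bump_sum J))"

lemma test_dist_tempered: "test_dist J \<in> tempered"
  unfolding test_dist_def by (intro of_function_tempered inv_fourier_schwartz bump_sum_schwartz)

text \<open>The common modulus of the box pieces of a test distribution at its sites: shifting a
  bump in frequency changes only the phase.\<close>

definition profile :: "real ^ 'n \<Rightarrow> real" where "profile x = norm (inversion_const * inv_fourier (\<lambda>\<xi>. complex_of_real (small_bump \<xi>)) x)"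

lemma box_fn_test_dist:
  assumes "finite J"
  shows "norm (box_fn (test_dist J) k x) = (if k \<in> dyadic_site ` J then profile x else 0)"
proof -
  have box_fn: "box_fn (test_dist J) k x = inversion_const * inv_fourier (\<lambda>\<xi>. box_symbol k \<xi> * bump_sum J \<xi>) x"
    unfolding box_fn_def test_dist_def by (rule of_function_multiplier[OF bump_sum_schwartz box_symbol_schwartz])
  have s: "box_symbol k \<xi> * bump_sum J \<xi> = (\<Sum>j\<in>J. if k = dyadic_site j then bump j \<xi> else 0)" for \<xi>
    unfolding bump_sum_def sum_distrib_left box_symbol_bump ..
  show ?thesis
  proof (cases "k \<in> dyadic_site ` J")
    case True
    then obtain i where i: "i \<in> J" "k = dyadic_site i" by blast
    have "(\<Sum>j\<in>J. if k = dyadic_site j then bump j \<xi> else 0) = (\<Sum>j\<in>J. if j = i then bump j \<xi> else 0)" for \<xi>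
      using i inj_dyadic_site by (intro sum.cong) (auto simp: inj_eq)
    then have "(\<lambda>\<xi>. box_symbol k \<xi> * bump_sum J \<xi>) = (\<lambda>\<xi>. complex_of_real (small_bump (\<xi> - lattice_point (dyadic_site i))))"
      using s i assms by (simp add: bump_def)
    then show ?thesis
      unfolding box_fn using True inv_fourier_translate[of "\<lambda>\<xi>. complex_of_real (small_bump \<xi>)" "lattice_point (dyadic_site i)" x]
      by (simp add: profile_def norm_mult)
  next
    case False
    then have "(\<lambda>\<xi>. box_symbol k \<xi> * bump_sum J \<xi>) = (\<lambda>\<xi>. 0)" by (auto simp: s fun_eq_iff intro!: sum.neutral)
    then show ?thesis unfolding box_fn using False by (simp add: inv_fourier_eq)
  qed
qed

text \<open>Each site contributes the same profile, so the number of sites factors out; this is the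
  source of the growth N^(1/Q) of the Wiener norm.\<close>

lemma box_power_sum_test_dist:
  assumes "finite J" "Q > 0"
  shows "box_power_sum Q (test_dist J) x = ennreal (real (card J) * profile x powr Q)"
proof -
  have "box_power_sum Q (test_dist J) x = (\<Sum>k\<in>dyadic_site ` J. ennreal (norm (box_fn (test_dist J) k x) powr Q))"
    unfolding box_power_sum_def by (rule nn_integral_count_space') (use assms in \<open>auto simp: box_fn_test_dist\<close>)
  also have "\<dots> = (\<Sum>k\<in>dyadic_site ` J. ennreal (profile x powr Q))"
    by (intro sum.cong refl) (auto simp: box_fn_test_dist[OF assms(1)])
  also have "\<dots> = of_nat (card J) * ennreal (profile x powr Q)"
    using inj_dyadic_site by (simp add: card_image inj_on_subset)
  finally show ?thesis by (simp add: ennreal_of_nat_eq_real_of_nat ennreal_mult')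
qed

lemma profile_integral_finite:
  assumes P: "P > 0" shows "(\<integral>\<^sup>+x. ennreal (profile x powr P) \<partial>lborel) < \<infinity>"
proof -
  obtain L :: nat where "2 * real CARD('n) / P \<le> L" using real_arch_simple by blast
  then have La: "L * P \<ge> 2 * real CARD('n)" using P by (simp add: field_simps)
  have S: "(\<lambda>x. inversion_const * inv_fourier (\<lambda>\<xi>. complex_of_real (small_bump \<xi>)) x) \<in> schwartz"
    by (intro schwartz_cmult inv_fourier_schwartz small_bump_schwartz)
  obtain B where B: "B > 0" "\<And>x. profile x * (1 + norm x) ^ L \<le> B"
    using rapidD[OF schwartz_rapid[OF S], of L] unfolding profile_def by metis
  have "(\<integral>\<^sup>+x. ennreal (profile x powr P) \<partial>lborel) \<le> (\<integral>\<^sup>+(x::real^'n). ennreal (B powr P * (1 + norm (x - 0)) powr (- (L * P))) \<partial>lborel)"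
  proof (intro nn_integral_mono ennreal_leI)
    fix x :: "real ^ 'n"
    have pos: "0 < 1 + norm x" by (auto intro: add_pos_nonneg)
    have "profile x \<le> B * (1 + norm x) powr (- real L)"
      using B(2)[of x] pos by (simp add: powr_minus powr_realpow field_simps)
    then have "profile x powr P \<le> (B * (1 + norm x) powr (- real L)) powr P"
      using P by (intro powr_mono2) (auto simp: profile_def)
    then show "profile x powr P \<le> B powr P * (1 + norm (x - 0)) powr (- (L * P))"
      using B(1) pos by (simp add: powr_mult powr_powr)
  qed
  also have "\<dots> = ennreal (LINT x|lborel. B powr P * (1 + norm (x - 0 :: real ^ 'n)) powr (- (L * P)))"
    using integrable_powr_weight[OF La, of 0] by (intro nn_integral_eq_integral integrable_mult_right) auto
  finally show ?thesis by (simp add: le_less_trans)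
qed

lemma wiener_test_dist:
  assumes P: "P > 0" and Q: "Q > 0"
  obtains K :: real where "K \<ge> 0" "\<And>J. finite J \<Longrightarrow> wiener_norm \<sigma> (ennreal P) (ennreal Q) (test_dist J) = ennreal (real (card J) powr (1 / Q) * K)"
proof -
  obtain I where I: "I \<ge> 0" "(\<integral>\<^sup>+x. ennreal (profile x powr P) \<partial>lborel) = ennreal I"
    using profile_integral_finite[OF P] by (cases "\<integral>\<^sup>+x. ennreal (profile x powr P) \<partial>lborel") auto
  have profile_0: "profile x \<ge> 0" for x by (simp add: profile_def)
  have S: "(\<lambda>x. inversion_const * inv_fourier (\<lambda>\<xi>. complex_of_real (small_bump \<xi>)) x) \<in> schwartz"
    by (intro schwartz_cmult inv_fourier_schwartz small_bump_schwartz)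
  have [measurable]: "profile \<in> borel_measurable borel"
    unfolding profile_def[abs_def] using schwartz_measurable[OF S] by measurable
  have "wiener_norm \<sigma> (ennreal P) (ennreal Q) (test_dist J) = ennreal (real (card J) powr (1 / Q) * I powr (1 / P))" if J: "finite J" for J
  proof -
    have "ennpowr (box_power_sum Q (test_dist J) x) (P / Q) = ennreal (real (card J) powr (P / Q)) * ennreal (profile x powr P)" for x
      using P Q profile_0[of x] by (simp add: box_power_sum_test_dist[OF J Q] ennpowr_ennreal powr_mult powr_powr flip: ennreal_mult)
    then have "(\<integral>\<^sup>+x. ennpowr (box_power_sum Q (test_dist J) x) (P / Q) \<partial>lborel) = ennreal (real (card J) powr (P / Q)) * ennreal I"
      by (simp add: nn_integral_cmult I)
    then show ?thesis
      using P Q I(1) by (simp add: wiener_norm_eq[OF test_dist_tempered P Q] ennpowr_ennreal powr_mult powr_powr flip: ennreal_mult)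
  qed
  then show ?thesis using that[of "I powr (1 / P)"] by simp
qed

definition spread :: "nat set \<Rightarrow> bool" where
  "spread J \<longleftrightarrow> finite J \<and> (\<forall>i\<in>J. \<forall>j\<in>J. i < j \<longrightarrow> i + 2 \<le> j)"

text \<open>The bump lives at radii within 1/4 of 2^i, the dyadic symbol strictly between 2^(j-1)
  and 2^(j+1). Indices two apart leave a factor 2 between these ranges, more than the 1/4 can
  bridge. Positivity of j rules out the symbol that covers the origin.\<close>

lemma dyadic_symbol_bump_disjoint:
  assumes "i + 2 \<le> j \<or> j + 2 \<le> i" "j > 0"
  shows "dyadic_symbol j \<xi> * bump i \<xi> = 0"
proof (rule ccontr)
  assume "\<not> ?thesis"
  then have nz: "dyadic_piece \<psi> j \<xi> \<noteq> 0" "small_bump (\<xi> - lattice_point (dyadic_site i)) \<noteq> 0" by (auto simp: dyadic_symbol_def bump_def)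
  then have "norm (\<xi> - lattice_point (dyadic_site i)) < 1 / 4" using small_bump_props(2) by (meson not_le)
  then have n: "norm \<xi> < 2 ^ i + 1 / 4" "2 ^ i - 1 / 4 < norm \<xi>"
    using norm_triangle_ineq2[of \<xi> "lattice_point (dyadic_site i)"] norm_triangle_ineq3[of \<xi> "lattice_point (dyadic_site i)"]
    by (auto simp: norm_lattice_dyadic_site)
  have s: "norm \<xi> < 2 ^ Suc j" "2 ^ j < norm \<xi> * 2"
    using dyadic_piece_support(1)[of j \<xi>] dyadic_piece_support(2)[of \<xi> j] assms(2) nz(1) by (meson not_le)+
  show False
  proof (cases "i + 2 \<le> j")
    case True
    then obtain d where "j = i + 2 + d" using le_Suc_ex by blast
    then have "(2::real) ^ j = 4 * 2 ^ i * 2 ^ d" by (simp add: power_add)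
    moreover have "(1::real) \<le> 2 ^ d" "(1::real) \<le> 2 ^ i" by simp_all
    ultimately have "(2::real) ^ j \<ge> 4 * 2 ^ i" by (simp add: mult_left_le)
    then show False using n s \<open>(1::real) \<le> 2 ^ i\<close> by linarith
  next
    case False
    then have "j + 2 \<le> i" using assms by simp
    then obtain d where "i = j + 2 + d" using le_Suc_ex by blast
    then have "(2::real) ^ i = 4 * 2 ^ j * 2 ^ d" by (simp add: power_add)
    moreover have "(1::real) \<le> 2 ^ d" "(1::real) \<le> 2 ^ j" by simp_all
    ultimately have "(2::real) ^ i \<ge> 4 * 2 ^ j" by (simp add: mult_left_le)
    then show False using n s \<open>(1::real) \<le> 2 ^ j\<close> by simp
  qed
qed

text \<open>Only the bump of index j survives the dyadic symbol. Moved to the origin, it is weighted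
  by a real symbol of size at least 1/2 and by a character whose phase, in turns, is at most 1/8
  when |x| \<le> 1/2, so no cancellation occurs. The bound does not depend on j or on the other
  sites.\<close>

lemma dyadic_fn_test_dist:
  obtains c :: real and j0 :: nat where "c > 0" "j0 > 0"
    "\<And>J j x. spread J \<Longrightarrow> J \<subseteq> {j0..} \<Longrightarrow> j \<in> J \<Longrightarrow> norm x \<le> 1 / 2 \<Longrightarrow> c \<le> norm (dyadic_fn (test_dist J) j x)"
proof -
  define rg where "rg \<xi> = \<psi> \<xi> - \<psi> (2 *\<^sub>R \<xi>)" for \<xi>
  have "isCont rg unit_some_coord"
    using continuous_dyadic_piece continuous_on_eq_continuous_at open_UNIV unfolding rg_def[abs_def] by blast
  moreover have "rg unit_some_coord = 1" using psi_props(3)[of unit_some_coord] psi_props(4)[of "2 *\<^sub>R unit_some_coord"] by (simp add: rg_def norm_unit_some_coord)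
  ultimately obtain d where d: "d > 0" "\<And>v. dist v unit_some_coord < d \<Longrightarrow> dist (rg v) 1 < 1 / 2"
    unfolding continuous_at_eps_delta by (metis half_gt_zero zero_less_one)
  \<comment> \<open>Rescaled by 2^(-j), the bump around 2^j e has radius below 2^(-j), and for j
    \<ge> \<open>j0\<close> lies within \<open>d\<close> of e, where the annular profile exceeds
    1/2. The successor below also makes \<open>j0\<close> positive, which excludes the symbol of
    index 0.\<close>
  obtain i0 where "(1 / 2 :: real) ^ i0 < d" using real_arch_pow_inv[OF d(1), of "1 / 2"] by auto
  define j0 where "j0 = Suc i0"
  have j0: "(1 / 2 :: real) ^ j < d" if "j \<ge> j0" for j
  proof -
    have "(1 / 2 :: real) ^ j \<le> (1 / 2) ^ i0" using that by (intro power_decreasing) (auto simp: j0_def)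
    then show ?thesis using \<open>(1 / 2 :: real) ^ i0 < d\<close> by (rule le_less_trans)
  qed
  \<comment> \<open>One quarter is the product of 1/2 for the dyadic symbol and 1/2 for the real
    part of the character.\<close>
  define c where "c = norm inversion_const * ((LINT \<xi>|lborel. small_bump \<xi>) / 4)"
  have "c > 0" unfolding c_def using inversion_const_nonzero small_bump_integral_pos by simp
  moreover have "c \<le> norm (dyadic_fn (test_dist J) j x)"
    if J: "spread J" "J \<subseteq> {j0..}" and j: "j \<in> J" and x: "norm x \<le> 1 / 2" for J j x
  proof -
    have "finite J" and "j \<ge> j0" using J j by (auto simp: spread_def)
    then have jp: "j > 0" by (auto simp: j0_def)
    have gx: "dyadic_fn (test_dist J) j x = inversion_const * inv_fourier (\<lambda>\<xi>. dyadic_symbol j \<xi> * bump_sum J \<xi>) x"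
      unfolding dyadic_fn_def test_dist_def by (rule of_function_multiplier[OF bump_sum_schwartz dyadic_symbol_schwartz])
    have "dyadic_symbol j \<xi> * bump_sum J \<xi> = (\<Sum>i\<in>J. if i = j then dyadic_symbol j \<xi> * bump i \<xi> else 0)" for \<xi>
      unfolding bump_sum_def sum_distrib_left
    proof (intro sum.cong refl)
      fix i assume i: "i \<in> J"
      show "dyadic_symbol j \<xi> * bump i \<xi> = (if i = j then dyadic_symbol j \<xi> * bump i \<xi> else 0)"
      proof (cases "i = j")
        case False
        then have "i + 2 \<le> j \<or> j + 2 \<le> i" using J(1) i j unfolding spread_def by (metis linorder_neqE_nat)
        then show ?thesis using False dyadic_symbol_bump_disjoint[OF _ jp, of i \<xi>] by simp
      qed simp
    qed
    then have pc: "(\<lambda>\<xi>. dyadic_symbol j \<xi> * bump_sum J \<xi>) = (\<lambda>\<xi>. dyadic_symbol j \<xi> * bump j \<xi>)" using \<open>finite J\<close> j by auto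
    define p where "p = lattice_point (dyadic_site j)"
    define F where "F \<eta> = dyadic_symbol j (\<eta> + p) * complex_of_real (small_bump \<eta>)" for \<eta>
    have FS: "F \<in> schwartz" unfolding F_def by (intro schwartz_mult schwartz_translate dyadic_symbol_schwartz small_bump_schwartz)
    have "(\<lambda>\<xi>. dyadic_symbol j \<xi> * bump j \<xi>) = (\<lambda>\<xi>. F (\<xi> - p))" by (auto simp: F_def bump_def p_def)
    then have ng: "norm (dyadic_fn (test_dist J) j x) = norm inversion_const * norm (inv_fourier F x)"
      unfolding gx pc by (simp add: inv_fourier_translate norm_mult)
    have Fr: "F \<eta> = of_real (dyadic_piece \<psi> j (\<eta> + p) * small_bump \<eta>)" for \<eta> by (simp add: F_def dyadic_symbol_def)
    have low: "dyadic_piece \<psi> j (\<eta> + p) \<ge> 1 / 2" if "norm \<eta> < 1 / 4" for \<eta>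
    proof -
      have eq: "dyadic_piece \<psi> j (\<eta> + p) = rg ((1 / 2) ^ j *\<^sub>R (\<eta> + p))"
        using jp by (simp add: dyadic_piece_def dyadic_bump_def rg_def)
      have "(1 / 2) ^ j *\<^sub>R (\<eta> + p) - unit_some_coord = (1 / 2) ^ j *\<^sub>R \<eta>"
        by (simp add: p_def lattice_dyadic_site scaleR_add_right power_divide)
      then have "dist ((1 / 2) ^ j *\<^sub>R (\<eta> + p)) unit_some_coord = (1 / 2) ^ j * norm \<eta>" by (simp add: dist_norm)
      also have "\<dots> \<le> (1 / 2) ^ j * 1" using that by (intro mult_left_mono) auto
      also have "\<dots> < d" using j0[OF \<open>j \<ge> j0\<close>] by simp
      finally have "dist (rg ((1 / 2) ^ j *\<^sub>R (\<eta> + p))) 1 < 1 / 2" by (rule d(2))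
      then show ?thesis unfolding eq dist_real_def by linarith
    qed
    have int: "integrable lborel (\<lambda>\<xi>. unit_char (x \<bullet> \<xi>) * F \<xi>)"
      by (intro schwartz_integrable schwartz_modulate FS)
    have "(LINT \<xi>|lborel. small_bump \<xi>) / 4 = (LINT \<xi>|lborel. small_bump \<xi> / 4)" by simp
    also have "\<dots> \<le> (LINT \<xi>|lborel. Re (unit_char (x \<bullet> \<xi>) * F \<xi>))"
    proof (rule integral_mono)
      show "integrable lborel (\<lambda>\<xi>. small_bump \<xi> / 4)" using small_bump_integrable by simp
      show "integrable lborel (\<lambda>\<xi>. Re (unit_char (x \<bullet> \<xi>) * F \<xi>))" using int by (rule integrable_Re)
      fix \<xi>
      show "small_bump \<xi> / 4 \<le> Re (unit_char (x \<bullet> \<xi>) * F \<xi>)"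
      proof (cases "norm \<xi> < 1 / 4")
        case True
        have "\<bar>x \<bullet> \<xi>\<bar> \<le> norm x * norm \<xi>" by (rule Cauchy_Schwarz_ineq2)
        also have "\<dots> \<le> (1 / 2) * (1 / 4)" using x True by (intro mult_mono) auto
        finally have "Re (unit_char (x \<bullet> \<xi>)) \<ge> 1 / 2" by (intro cos_ge_half) simp
        then have "(1 / 2) * ((1 / 2) * small_bump \<xi>) \<le> Re (unit_char (x \<bullet> \<xi>)) * (dyadic_piece \<psi> j (\<xi> + p) * small_bump \<xi>)"
          using low[OF True] small_bump_props(1) by (intro mult_mono mult_right_mono) auto
        then show ?thesis unfolding Fr by simp
      next
        case False
        then show ?thesis using small_bump_props(2)[of \<xi>] unfolding Fr by simp
      qed
    qed
    also have "\<dots> = Re (inv_fourier F x)" unfolding inv_fourier_eq using int by (rule integral_Re)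
    also have "\<dots> \<le> norm (inv_fourier F x)" by (rule complex_Re_le_cmod)
    finally show ?thesis unfolding ng c_def by (intro mult_left_mono) auto
  qed
  ultimately show ?thesis using that[of c j0] by (simp add: j0_def)
qed

lemma triebel_lower:
  assumes P: "P > 0" and \<Lambda>: "\<Lambda> \<ge> 0" and u: "u \<in> tempered"
    and lower: "\<And>x. norm x \<le> 1 / 2 \<Longrightarrow> ennreal \<Lambda> \<le> weighted_norm r s u x"
  shows "ennreal (\<Lambda> * measure lborel (cball (0 :: real ^ 'n) (1 / 2)) powr (1 / P)) \<le> triebel_norm \<psi> s (ennreal P) r u"
proof -
  define v where "v = measure lborel (cball (0 :: real ^ 'n) (1 / 2))"
  have unit_some_coord: "emeasure lborel (cball (0 :: real ^ 'n) (1 / 2)) = ennreal v"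
    unfolding v_def by (intro emeasure_eq_ennreal_measure) (simp add: emeasure_cball)
  have "ennreal (\<Lambda> * v powr (1 / P)) = ennpowr (ennreal (\<Lambda> powr P) * ennreal v) (1 / P)"
    using P \<Lambda> by (simp add: ennpowr_mult ennpowr_ennreal powr_powr v_def ennreal_mult')
  also have "ennreal (\<Lambda> powr P) * ennreal v = (\<integral>\<^sup>+x. ennreal (\<Lambda> powr P) * indicator (cball (0 :: real ^ 'n) (1 / 2)) x \<partial>lborel)"
    unfolding unit_some_coord[symmetric] by (rule nn_integral_cmult_indicator[symmetric]) simp
  also have "ennpowr \<dots> (1 / P) \<le> ennpowr (\<integral>\<^sup>+x. ennpowr (weighted_norm r s u x) P \<partial>lborel) (1 / P)"
  proof (intro ennpowr_mono nn_integral_mono)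
    fix x :: "real ^ 'n"
    show "ennreal (\<Lambda> powr P) * indicator (cball 0 (1 / 2)) x \<le> ennpowr (weighted_norm r s u x) P"
    proof (cases "norm x \<le> 1 / 2")
      case True
      have "ennpowr (ennreal \<Lambda>) P \<le> ennpowr (weighted_norm r s u x) P"
        using P by (intro ennpowr_mono lower True) auto
      then show ?thesis using True \<Lambda> by (simp add: ennpowr_ennreal)
    qed simp
  qed (use P in auto)
  finally show ?thesis unfolding triebel_norm_eq[OF u P] v_def .
qed

lemma lp_norm_ge_point: "r > 0 \<Longrightarrow> a j \<le> lp_norm r (a :: nat \<Rightarrow> ennreal)"
proof (cases "r = \<infinity>")
  case True
  have "AE j in count_space UNIV. a j \<le> esssup (count_space UNIV) a" by (rule esssup_AE)
  then show ?thesis using True by (simp add: AE_count_space Lp_norm_def)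
next
  case False
  assume "r > 0"
  then have R: "enn2real r > 0" using False by (simp add: enn2real_positive_iff less_top)
  have "ennpowr (a j) (enn2real r) \<le> (\<integral>\<^sup>+j. ennpowr (a j) (enn2real r) \<partial>count_space UNIV)" by (rule nn_integral_ge_point) simp
  then have "ennpowr (ennpowr (a j) (enn2real r)) (1 / enn2real r) \<le> lp_norm r a"
    using False R by (auto simp: Lp_norm_def intro!: ennpowr_mono)
  then show ?thesis using R by (simp add: ennpowr_inverse)
qed

text \<open>A single site of large index j makes the Triebel norm at least a multiple of 2^(js)
  against a fixed Wiener norm, so s \<le> 0. For s = 0, N sites compare N^(1/r) with N^(1/q), which
  fails for large N if r < q.\<close>

lemma necessity:
  fixes r :: ennreal and s P Q :: real
  assumes P: "0 < P" and Q: "0 < Q" and r: "0 < r"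
    and emb: "embeds (wiener_norm \<sigma> (ennreal P) (ennreal Q)) (triebel_norm \<psi> s (ennreal P) r)"
  shows "s \<le> 0 \<and> (ennreal Q \<le> r \<or> s < 0)"
proof -
  obtain C :: real where C: "\<And>u. u \<in> space_of (wiener_norm \<sigma> (ennreal P) (ennreal Q)) \<Longrightarrow>
    triebel_norm \<psi> s (ennreal P) r u \<le> ennreal C * wiener_norm \<sigma> (ennreal P) (ennreal Q) u"
    using emb unfolding embeds_def by blast
  obtain K where K: "K \<ge> 0" "\<And>J. finite J \<Longrightarrow> wiener_norm \<sigma> (ennreal P) (ennreal Q) (test_dist J) = ennreal (real (card J) powr (1 / Q) * K)"
    using wiener_test_dist[OF P Q] by metis
  obtain c j0 where c: "c > 0" "j0 > 0"
    "\<And>J j x. spread J \<Longrightarrow> J \<subseteq> {j0..} \<Longrightarrow> j \<in> J \<Longrightarrow> norm x \<le> 1 / 2 \<Longrightarrow> c \<le> norm (dyadic_fn (test_dist J) j x)"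
    using dyadic_fn_test_dist by blast
  define v where "v = measure lborel (cball (0 :: real ^ 'n) (1 / 2)) powr (1 / P)"
  have v: "v > 0" unfolding v_def using content_cball_pos[of "1 / 2" "0 :: real ^ 'n"] by simp
  define M where "M = \<bar>C\<bar> * K / v"
  \<comment> \<open>\<Lambda> is a pointwise lower bound on the ball of radius 1/2, which the
    embedding limits by the number of sites. The absolute value of \<open>C\<close> is taken because
    \<open>embeds\<close> does not fix the sign of its constant.\<close>
  have main: "\<Lambda> \<le> M * real (card J) powr (1 / Q)"
    if J: "finite J" and \<Lambda>: "\<Lambda> \<ge> 0"
      and lower: "\<And>x. norm x \<le> 1 / 2 \<Longrightarrow> ennreal \<Lambda> \<le> lp_norm r (\<lambda>j. ennreal (2 powr (real j * s) * norm (dyadic_fn (test_dist J) j x)))" for \<Lambda> J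
  proof -
    have "test_dist J \<in> space_of (wiener_norm \<sigma> (ennreal P) (ennreal Q))"
      by (simp add: space_of_def test_dist_tempered K(2)[OF J])
    have "ennreal (\<Lambda> * v) \<le> triebel_norm \<psi> s (ennreal P) r (test_dist J)"
      unfolding v_def by (rule triebel_lower[OF P \<Lambda> test_dist_tempered lower])
    also have "\<dots> \<le> ennreal C * ennreal (real (card J) powr (1 / Q) * K)"
      using C[OF \<open>test_dist J \<in> _\<close>] K(2)[OF J] by simp
    also have "\<dots> \<le> ennreal \<bar>C\<bar> * ennreal (real (card J) powr (1 / Q) * K)"
      by (intro mult_right_mono ennreal_leI) auto
    also have "\<dots> = ennreal (\<bar>C\<bar> * (real (card J) powr (1 / Q) * K))"
      using K(1) by (simp add: ennreal_mult')
    finally have "\<Lambda> * v \<le> \<bar>C\<bar> * (real (card J) powr (1 / Q) * K)"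
      using K(1) by (subst (asm) ennreal_le_iff) auto
    then show ?thesis using v by (simp add: M_def field_simps)
  qed
  have "\<not> s > 0"
  proof
    assume s: "s > 0"
    have x1: "1 < 2 powr s" using s by simp
    obtain n where n: "M / c < (2 powr s) ^ n" using real_arch_pow[OF x1] by blast
    define j where "j = n + j0"
    have "2 powr (real j * s) * c \<le> M * real (card {j}) powr (1 / Q)"
    proof (rule main)
      fix x :: "real ^ 'n" assume x: "norm x \<le> 1 / 2"
      have "c \<le> norm (dyadic_fn (test_dist {j}) j x)" by (rule c(3)[OF _ _ _ x]) (auto simp: spread_def j_def)
      then have "ennreal (2 powr (real j * s) * c) \<le> ennreal (2 powr (real j * s) * norm (dyadic_fn (test_dist {j}) j x))"
        by (intro ennreal_leI mult_left_mono) auto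
      also have "\<dots> \<le> lp_norm r (\<lambda>i. ennreal (2 powr (real i * s) * norm (dyadic_fn (test_dist {j}) i x)))"
        by (rule lp_norm_ge_point[OF r, of "\<lambda>i. ennreal (2 powr (real i * s) * norm (dyadic_fn (test_dist {j}) i x))"])
      finally show "ennreal (2 powr (real j * s) * c) \<le> lp_norm r (\<lambda>i. ennreal (2 powr (real i * s) * norm (dyadic_fn (test_dist {j}) i x)))" .
    qed (use c in auto)
    then have "2 powr (real j * s) \<le> M / c" using c(1) by (simp add: field_simps)
    moreover have "2 powr (real j * s) = (2 powr s) ^ j" by (simp add: powr_power mult.commute)
    moreover have "(2 powr s) ^ n \<le> (2 powr s) ^ j" using x1 by (intro power_increasing) (auto simp: j_def)
    ultimately show False using n by linarith
  qed
  moreover have "ennreal Q \<le> r" if "s = 0"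
  proof (rule ccontr)
    assume "\<not> ennreal Q \<le> r"
    then have rQ: "r < ennreal Q" by simp
    define R where "R = enn2real r"
    have "r < top" using rQ ennreal_less_top less_trans by blast
    then have rR: "r = ennreal R" by (simp add: R_def)
    have R: "R > 0" "R < Q" using r rQ Q unfolding rR by (auto simp: ennreal_less_iff R_def)
    have bnd: "real N powr (1 / R) * c \<le> M * real N powr (1 / Q)" for N :: nat
    proof -
      \<comment> \<open>An arithmetic progression of step 2 from \<open>j0\<close>: spread, within
        the admissible indices, and with N elements.\<close>
      define J where "J = (\<lambda>i. j0 + 2 * i) ` {..<N}"
      have card: "card J = N" unfolding J_def by (subst card_image) (auto simp: inj_on_def)
      have J: "spread J" "J \<subseteq> {j0..}" by (auto simp: J_def spread_def)
      then have "finite J" by (simp add: spread_def)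
      have "real N powr (1 / R) * c \<le> M * real (card J) powr (1 / Q)"
      proof (rule main[OF \<open>finite J\<close>])
        fix x :: "real ^ 'n" assume x: "norm x \<le> 1 / 2"
        have "ennreal (real N * c powr R) = (\<Sum>j\<in>J. ennreal (c powr R))"
          by (simp add: card ennreal_mult' ennreal_of_nat_eq_real_of_nat)
        also have "\<dots> \<le> (\<Sum>j\<in>J. ennreal (norm (dyadic_fn (test_dist J) j x) powr R))"
          using R c(1) by (intro sum_mono ennreal_leI powr_mono2 c(3)[OF J _ x]) auto
        also have "\<dots> = (\<integral>\<^sup>+j. ennreal (norm (dyadic_fn (test_dist J) j x) powr R) * indicator J j \<partial>count_space UNIV)"
          using \<open>finite J\<close> by (subst nn_integral_count_space'[of J]) auto
        also have "\<dots> \<le> (\<integral>\<^sup>+j. ennreal (norm (dyadic_fn (test_dist J) j x) powr R) \<partial>count_space UNIV)"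
          by (intro nn_integral_mono) (auto simp: indicator_def)
        finally have "ennpowr (ennreal (real N * c powr R)) (1 / R) \<le> ennpowr (\<integral>\<^sup>+j. ennreal (norm (dyadic_fn (test_dist J) j x) powr R) \<partial>count_space UNIV) (1 / R)"
          using R by (intro ennpowr_mono) auto
        then show "ennreal (real N powr (1 / R) * c) \<le> lp_norm r (\<lambda>j. ennreal (2 powr (real j * s) * norm (dyadic_fn (test_dist J) j x)))"
          using R c(1) that by (simp add: rR Lp_norm_def ennpowr_ennreal powr_mult powr_powr)
      qed (use c in auto)
      then show ?thesis by (simp add: card)
    qed
    define e where "e = 1 / R - 1 / Q"
    have e: "e > 0" using R Q by (simp add: e_def field_simps)
    \<comment> \<open>N^e has to reach |M| / c + 1; the summand 1 makes the base positive and the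
      final contradiction strict.\<close>
    obtain N :: nat where N: "(\<bar>M\<bar> / c + 1) powr (1 / e) < N" using reals_Archimedean2 by blast
    have N0: "real N > 0" using N by (smt (verit) powr_ge_zero)
    have "(\<bar>M\<bar> / c + 1) = ((\<bar>M\<bar> / c + 1) powr (1 / e)) powr e"
      using e c(1) by (simp add: powr_powr)
    also have "\<dots> \<le> real N powr e" using e N by (intro powr_mono2) auto
    also have "\<dots> = real N powr (1 / R) / real N powr (1 / Q)" by (simp add: e_def powr_diff)
    also have "\<dots> \<le> M / c" using bnd[of N] N0 c(1) by (simp add: field_simps)
    finally have "\<bar>M\<bar> / c + 1 \<le> M / c" .
    moreover have "M / c \<le> \<bar>M\<bar> / c" using c(1) by (intro divide_right_mono) auto
    ultimately show False by linarith
  qed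
  ultimately show ?thesis by linarith
qed

end

theorem theorem14:
  fixes \<sigma> :: "real ^ 'n::finite \<Rightarrow> complex"
    and \<psi> :: "real ^ 'n \<Rightarrow> real"
    and p q r :: ennreal
    and s :: real
  assumes "wiener_window \<sigma>"
    and "triebel_window \<psi>"
    and "0 < p" and "p \<le> 1"
    and "0 < q" and "0 < r"
    and "q \<le> 2"
  shows "embeds (wiener_norm \<sigma> p q) (triebel_norm \<psi> s p r) \<longleftrightarrow>
      (p \<ge> q \<and> q \<le> r \<and> s \<le> 0) \<or>
      (p \<ge> q \<and> q > r \<and> s < 0) \<or>
      (p < q \<and> q \<le> 2 \<and> q \<le> r \<and> s \<le> 0) \<or>
      (p < q \<and> q \<le> 2 \<and> q > r \<and> s < 0)"
proof -
  interpret amalgam \<psi> \<sigma> by unfold_locales (use assms in auto)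
  \<comment> \<open>The exponents p and q are finite by their upper bounds and are handled as reals;
    r may be infinite and stays extended.\<close>
  obtain P where P: "p = ennreal P" "0 < P" "P \<le> 1"
    using assms(3,4) by (cases p) (auto simp: ennreal_le_1 top_unique)
  obtain Q where Q: "q = ennreal Q" "0 < Q" "Q \<le> 2"
    using assms(5,7) by (cases q) (auto simp: top_unique ennreal_le_iff simp flip: ennreal_numeral)
  have "embeds (wiener_norm \<sigma> p q) (triebel_norm \<psi> s p r) \<longleftrightarrow> s \<le> 0 \<and> (q \<le> r \<or> s < 0)"
    unfolding P(1) Q(1)
    using necessity[OF P(2) Q(2) assms(6)] sufficiency[OF P(2,3) Q(2,3) assms(6)] by blast
  then show ?thesis using assms(7) by (auto simp: not_le)
qed

end
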